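(* Let $m\ge 1$ and consider the random $m$-ary hooking network $(G_n)_{n\ge 0}$ grown, under the uniform model, from a connected seed $G_0$ with $\tau_0\ge 2$ vertices, whose distinct vertex degrees are $d_1<\cdots<d_k$, with $n_\ell\ge 1$ vertices of degree $d_\ell$ for $\ell\in\{1,\dots,k\}$, and whose hook has degree $h=d_i$. Assume that the network is nondegenerate, i.e. no component of the principal eigenvector $\mathbf v_1$ of $\mathbf A^T$ is $0$, where $\mathbf A$ is the associated replacement matrix. For $j\in\{1,\dots,k\}$ and $s\in\{0,1,\dots,m\}$, let $D_{n,d_j+sh}$ be the number of nodes of $G_n$ that are originally of degree $d_j$ and experience latching $s$ times by age $n$, and let $\mathbf D_n$ be the random vector with these components, consisting of the $m+1$ stacked blocks $(D_{n,d_1+sh},\dots,D_{n,d_k+sh})^T$, $s=0,1,\dots,m$. Let $\alpha_m=m\tau_0-m-1$, $$\mathbf y_1=\frac{m}{m\tau_0-1}\,(n_1,\dots,n_{i-1},\,n_i-1,\,n_{i+1},\dots,n_k)^T ,$$ and let $\mathbf D^*$ (the almost-sure limit of $\frac1n\mathbf D_n$ in the strong law for the degrees) be the vector of $m+1$ stacked blocks whose block with index $s$ is $\alpha_m\frac{(m-1)_s}{(m\tau_0-2)_s}\,\mathbf y_1$ for $s=0,\dots,m-1$, and whose last block ($s=m$) is $\frac{(m-1)_{m-1}}{(m\tau_0-2)_{m-1}}\,\mathbf y_1$. Then, as $n\to\infty$, $$\frac{1}{\sqrt n}\,(\mathbf D_n-n\mathbf D^* )\ \longrightarrow\ \mathcal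 N(\mathbf 0,\mathbf\Sigma)\quad\text{in distribution},$$ where $\mathcal N(\mathbf 0,\mathbf\Sigma)$ is the multivariate normal law with mean vector $\mathbf 0$ and $\mathbf\Sigma$ is some $(m+1)k\times(m+1)k$ covariance matrix.
   Context: Notation: $(x)_r=x(x-1)\cdots(x-r+1)$ is the falling factorial, with $(x)_0=1$; $\mathbf I_k$ is the $k\times k$ identity matrix. The $m$-ary hooking network. The seed $G_0$ is a fixed connected finite graph (loops allowed, a loop contributing 2 to the degree of its vertex), with one designated vertex called the hook. Each vertex of $G_0$ initially has $m$ insertion positions. For $n\ge 1$, $G_n$ is obtained from $G_{n-1}$ as follows: one insertion position is chosen uniformly at random among all insertion positions of $G_{n-1}$; the vertex it belongs to is called the latch; a fresh copy of the seed is attached by identifying (fusing) its hook with the latch. The latch then is said to have experienced latching (recruited) one more time; it loses one insertion position (a vertex that has recruited $s\le m$ times has $m-s$ insertion positions), and its degree increases by $h$. The hook of the incoming copy brings no new insertion positions and is not counted as a new vertex. Each of the other $\tau_0-1$ vertices of the new copy becomes a new vertex with $m$ insertion positions. A vertex that has recruited $m$ times is inactive. $G_n$ is the network at age $n$. A vertex is "originally of degree $d_j$" if its degree at the time it enters the network is $d_j$. The quantities $D_{n,d_j+sh}$ are indexed by the pair $(j,s)$; different pairs are counted separately even if the numbers $d_j+sh$ coincide. The associated urn. The insertion positions are viewed as balls in a Pólya urn with $mk$ colors; an insertion position at a vertex originally of degree $d_j$ that has recruited $s$ times ($0\le s\le m-1$) has color $j+sk$. The replacement matrix $\mathbf A$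 is the $mk\times mk$ matrix made of $m^2$ blocks $\mathbf H_{r,t}$ ($1\le r,t\le m$) of size $k\times k$. Let $\mathbf H_k$ be the $k\times k$ matrix with $(p,q)$ entry $m(n_q-\delta_{p,q}-\delta_{q,i})$, with $\delta$ the Kronecker delta and $i$ the index of the hook degree, and let $\mathbf H_k'=\mathbf H_k+m\mathbf I_k$. Then $\mathbf H_{1,1}=\mathbf H_k$; $\mathbf H_{r,1}=\mathbf H_k'$ for $2\le r\le m$; $\mathbf H_{r,r}=-(m-r+1)\mathbf I_k$ for $2\le r\le m$; $\mathbf H_{r,r+1}=(m-r)\mathbf I_k$ for $1\le r\le m-1$; all other blocks are zero. The principal eigenvector $\mathbf v_1$ is the eigenvector of $\mathbf A^T$ for its eigenvalue of largest real part (the simple eigenvalue $m\tau_0-m-1$), normalized to have $\ell^1$-norm $1$.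
   Formalization: For s=0,…,m-1 the block of D* is taken as the printed one divided by m-s; the printed block counts insertion positions rather than nodes, and with it the claim fails for every m≥2 (e.g. triangle seed, m=2: 12/5 printed, but only 2 new nodes per step). *)

theory Defs
  imports
    "HOL-Probability.Probability"
    "HOL-Library.Uprod"
    "Jordan_Normal_Form.Char_Poly"
begin

section \<open>Graphs, seeds and networks\<close>

text \<open>Hooking copies of a seed that carries loops at its hook creates parallel loops, so graphs have a
  multiset of edges; an edge is an unordered pair, and a loop at \<open>v\<close> is \<open>Upair v v\<close>.\<close>

record 'a graph =
  verts :: "'a set"
  edges :: "'a uprod multiset"

definition vertex_degree :: "('a, 'z) graph_scheme \<Rightarrow> 'a \<Rightarrow> nat" where
  "vertex_degree G v = size {#e \<in># edges G. v \<in> set_uprod e#} + count (edges G) (Upair v v)"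

definition finite_graph :: "('a, 'z) graph_scheme \<Rightarrow> bool" where
  "finite_graph G \<longleftrightarrow> finite (verts G) \<and> (\<forall>e \<in># edges G. set_uprod e \<subseteq> verts G)"

definition connected_graph :: "('a, 'z) graph_scheme \<Rightarrow> bool" where
  "connected_graph G \<longleftrightarrow>
     verts G \<noteq> {} \<and>
     (\<forall>u \<in> verts G. \<forall>v \<in> verts G. (u, v) \<in> {(a, b). Upair a b \<in># edges G}\<^sup>*)"

record 'a seed = "'a graph" +
  hook :: 'a

definition is_seed :: "'a seed \<Rightarrow> bool" where
  "is_seed S \<longleftrightarrow> finite_graph S \<and> connected_graph S \<and> hook S \<in> verts S"

text \<open>A network remembers, for each of its vertices, the degree at the time it entered and the
  number of times it has been a latch.\<close>

record 'a network = "'a graph" +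
  orig_degree :: "'a \<Rightarrow> nat"
  recruits :: "'a \<Rightarrow> nat"

section \<open>Growth of the network\<close>

text \<open>The vertex \<open>(t, v)\<close> is the copy of the seed vertex \<open>v\<close> that entered at age \<open>t\<close>.\<close>

definition initial_network :: "'v seed \<Rightarrow> (nat \<times> 'v) network" where
  "initial_network S =
    (let G0 = \<lparr>verts = Pair 0 ` verts S, edges = image_mset (map_uprod (Pair 0)) (edges S)\<rparr>
     in \<lparr>verts = verts G0, edges = edges G0, orig_degree = vertex_degree G0, recruits = (\<lambda>_. 0)\<rparr>)"

definition fuse :: "'v seed \<Rightarrow> nat \<Rightarrow> nat \<times> 'v \<Rightarrow> 'v \<Rightarrow> nat \<times> 'v" where
  "fuse S t latch v = (if v = hook S then latch else (t, v))"

definition attach ::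
  "'v seed \<Rightarrow> nat \<Rightarrow> (nat \<times> 'v) network \<Rightarrow> nat \<times> 'v \<Rightarrow> (nat \<times> 'v) network" where
  "attach S t G latch =
    (let new = Pair t ` (verts S - {hook S});
         G' = \<lparr>verts = verts G \<union> new,
               edges = edges G + image_mset (map_uprod (fuse S t latch)) (edges S)\<rparr>
     in \<lparr>verts = verts G', edges = edges G',
         orig_degree = (\<lambda>v. if v \<in> new then vertex_degree G' v else orig_degree G v),
         recruits = (\<lambda>v. if v \<in> new then 0
                         else if v = latch then recruits G v + 1 else recruits G v)\<rparr>)"

definition insertion_positions :: "nat \<Rightarrow> 'a network \<Rightarrow> ('a \<times> nat) set" where
  "insertion_positions m G = (SIGMA v : verts G. {..<m - recruits G v})"

text \<open>\<open>hooking_network m S n\<close> is the law of the network at age \<open>n\<close>.\<close>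

primrec hooking_network :: "nat \<Rightarrow> 'v seed \<Rightarrow> nat \<Rightarrow> (nat \<times> 'v) network pmf" where
  "hooking_network m S 0 = return_pmf (initial_network S)"
| "hooking_network m S (Suc n) =
     bind_pmf (hooking_network m S n) (\<lambda>G.
       map_pmf (\<lambda>(latch, _). attach S (Suc n) G latch) (pmf_of_set (insertion_positions m G)))"

definition degree_count :: "'a network \<Rightarrow> nat \<Rightarrow> nat \<Rightarrow> nat" where
  "degree_count G dj s = card {v \<in> verts G. orig_degree G v = dj \<and> recruits G v = s}"

section \<open>The associated urn\<close>

definition kron :: "nat \<Rightarrow> nat \<Rightarrow> complex" where
  "kron p q = (if p = q then 1 else 0)"

definition urn_H :: "nat \<Rightarrow> (nat \<Rightarrow> nat) \<Rightarrow> nat \<Rightarrow> nat \<Rightarrow> nat \<Rightarrow> complex" where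
  "urn_H m N i p q = of_nat m * (of_nat (N q) - kron p q - kron q i)"

definition urn_block ::
  "nat \<Rightarrow> (nat \<Rightarrow> nat) \<Rightarrow> nat \<Rightarrow> nat \<Rightarrow> nat \<Rightarrow> nat \<Rightarrow> nat \<Rightarrow> complex" where
  "urn_block m N i r t p q =
    (if r = 1 \<and> t = 1 then urn_H m N i p q
     else if t = 1 then urn_H m N i p q + of_nat m * kron p q
     else if t = r then - (of_nat m - of_nat r + 1) * kron p q
     else if t = r + 1 then (of_nat m - of_nat r) * kron p q
     else 0)"

text \<open>Block and in-block indices of \<open>urn_block\<close> are 1-based, matrix indices are 0-based.\<close>

definition replacement_matrix :: "nat \<Rightarrow> nat \<Rightarrow> (nat \<Rightarrow> nat) \<Rightarrow> nat \<Rightarrow> complex Matrix.mat" where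
  "replacement_matrix m k N i =
    Matrix.mat (m * k) (m * k)
      (\<lambda>(a, b). urn_block m N i (a div k + 1) (b div k + 1) (a mod k + 1) (b mod k + 1))"

text \<open>The normalization fixes the vector only up to a factor of modulus 1.\<close>

definition principal_eigenvector :: "complex Matrix.mat \<Rightarrow> complex Matrix.vec \<Rightarrow> bool" where
  "principal_eigenvector A v \<longleftrightarrow>
    (\<exists>lam. eigenvector (transpose_mat A) v lam \<and>
           (\<forall>mu. eigenvalue (transpose_mat A) mu \<longrightarrow> Re mu \<le> Re lam)) \<and>
    (\<Sum>c<dim_vec v. cmod (vec_index v c)) = 1"

section \<open>The limit vector\<close>

definition falling_fact :: "real \<Rightarrow> nat \<Rightarrow> real" where
  "falling_fact x r = (\<Prod>t<r. x - real t)"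

definition y1_vec :: "nat \<Rightarrow> nat \<Rightarrow> (nat \<Rightarrow> nat) \<Rightarrow> nat \<Rightarrow> nat \<Rightarrow> real" where
  "y1_vec m \<tau> N i j =
     real m / (real m * real \<tau> - 1) * (real (N j) - (if j = i then 1 else 0))"

text \<open>The principal eigenvector has blocks \<open>(m - 1)\<^sub>s / (m\<tau> - 2)\<^sub>s * y1\<close> for \<open>s = 0, ..., m - 1\<close>;
  \<open>\<alpha>\<close> times it (\<open>\<alpha> = m\<tau> - m - 1\<close>) is the limiting number per step of insertion positions. A vertex
  that has recruited \<open>s < m\<close> times owns \<open>m - s\<close> of these, whence the division by \<open>m - s\<close> in the
  limiting number of vertices.\<close>

definition D_star :: "nat \<Rightarrow> nat \<Rightarrow> (nat \<Rightarrow> nat) \<Rightarrow> nat \<Rightarrow> nat \<Rightarrow> nat \<Rightarrow> real" where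
  "D_star m \<tau> N i j s =
    (if s < m
     then (real m * real \<tau> - real m - 1) *
          (falling_fact (real m - 1) s / falling_fact (real m * real \<tau> - 2) s) * y1_vec m \<tau> N i j
            / real (m - s)
     else falling_fact (real m - 1) (m - 1) / falling_fact (real m * real \<tau> - 2) (m - 1)
          * y1_vec m \<tau> N i j)"

section \<open>Convergence in distribution and multivariate normal laws\<close>

definition converges_in_law ::
  "(nat \<Rightarrow> 'a::topological_space measure) \<Rightarrow> 'a measure \<Rightarrow> bool" where
  "converges_in_law M L \<longleftrightarrow>
    (\<forall>f :: 'a \<Rightarrow> real. continuous_on UNIV f \<and> bounded (range f) \<longrightarrow>
       (\<lambda>n. integral\<^sup>L (M n) f) \<longlonglongrightarrow> integral\<^sup>L L f)"

definition covariance_matrix :: "real^'c^'c \<Rightarrow> bool" where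
  "covariance_matrix \<Sigma> \<longleftrightarrow>
     Finite_Cartesian_Product.transpose \<Sigma> = \<Sigma> \<and> (\<forall>a. 0 \<le> inner a (\<Sigma> *v a))"

definition normal_law :: "real \<Rightarrow> real \<Rightarrow> real measure" where
  "normal_law \<mu> var =
     (if var = 0 then return borel \<mu> else density lborel (normal_density \<mu> (sqrt var)))"

text \<open>Covariance matrices may be singular, so the law is characterized by its one-dimensional
  linear images rather than by a density.\<close>

definition multivariate_normal :: "real^'c \<Rightarrow> real^'c^'c \<Rightarrow> (real^'c) measure \<Rightarrow> bool" where
  "multivariate_normal \<mu> \<Sigma> L \<longleftrightarrow>
     covariance_matrix \<Sigma> \<and> prob_space L \<and> sets L = sets borel \<and>
     (\<forall>a. distr L borel (\<lambda>x. inner a x) = normal_law (inner a \<mu>) (inner a (\<Sigma> *v a)))"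

text \<open>The coordinates of the degree vector are labelled by the pairs \<open>(j, s)\<close>; \<open>lab\<close> assigns to each
  element of the index type its label. Any ordering of the coordinates is thus admissible, in
  particular the one by blocks of constant \<open>s\<close>.\<close>

definition degree_vec :: "('c::finite \<Rightarrow> nat \<times> nat) \<Rightarrow> (nat \<Rightarrow> nat) \<Rightarrow> 'a network \<Rightarrow> real^'c" where
  "degree_vec lab d G = (\<chi> c. real (degree_count G (d (fst (lab c))) (snd (lab c))))"

definition D_star_vec ::
  "('c::finite \<Rightarrow> nat \<times> nat) \<Rightarrow> nat \<Rightarrow> nat \<Rightarrow> (nat \<Rightarrow> nat) \<Rightarrow> nat \<Rightarrow> real^'c" where
  "D_star_vec lab m \<tau> N i = (\<chi> c. D_star m \<tau> N i (fst (lab c)) (snd (lab c)))"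

end

theory Submission
  imports Defs "HOL-Real_Asymp.Real_Asymp"
begin

text \<open>
  The total number of insertion positions at age \<open>n\<close> is the deterministic number
  \<open>T n = m \<tau> + \<alpha> n\<close> with \<open>\<alpha> = m \<tau> - m - 1\<close>. The latch has initial degree \<open>d j\<close> and \<open>s\<close> earlier
  recruitments with probability \<open>(m - s) D\<^sub>j\<^sub>,\<^sub>s / T n\<close>, so the counts perform a Markov chain whose drift is
  linear. For fixed \<open>j\<close> the drift is that of a pure death chain: each of the \<open>p = m - s\<close> positions of a vertex
  is lost at the same rate. Such a chain is diagonalized by factorial moments: the number
  \<open>\<Sum>s. (m - s choose r) D\<^sub>j\<^sub>,\<^sub>s\<close> of \<open>r\<close>-element sets of positions at common vertices has drift \<open>- r / T n\<close> times
  itself plus a constant. If \<open>\<alpha> > 0\<close>, then, centred at \<open>T n / \<alpha>\<close> times the same moment of the limit vector, it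
  satisfies \<open>E[X (n + 1) | G\<^sub>n] = (1 - r / T n) X n\<close> exactly (\<open>moment_drift\<close>). All the eigenvalues
  \<open>- r\<close> are nonpositive while the urn grows linearly, so that fluctuations are of order \<open>sqrt n\<close> and Gaussian.

  The central limit theorem for such a process (\<open>charf_tendsto\<close>) is proved by characteristic functions.
  In one step the characteristic function at weights \<open>w\<close> equals the earlier one at
  the damped weights \<open>(1 - r / T n) w\<close>, times \<open>exp (- v(w) / 2)\<close> for the limiting jump variance \<open>v\<close>, up to
  \<open>O(|w|\<^sup>3 + |w|\<^sup>2 / sqrt n)\<close>; the second term is the law of large numbers for the colour probabilities, in
  the form of the bound \<open>E |X n| = O(sqrt n)\<close>. Damped weights are no larger, so for weights of order
  \<open>1 / sqrt n\<close> the errors of all steps add up to \<open>O(1 / sqrt n)\<close>, and the exponents add up to a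
  quadratic form which, divided by \<open>n\<close>, converges to the solution of a Lyapunov equation.

  The counts are linear functions of the factorial moments (\<open>factorial_moment_inversion\<close>), so the characteristic functions
  of the scaled degree vector converge. To conclude, a normal law with the limiting covariance is
  built from independent one-dimensional ones by a Cholesky decomposition (\<open>multivariate_normal_exists\<close>), and
  the continuity theorem is extended to Euclidean spaces (\<open>levy_continuity_euclidean\<close>) by approximating test functions
  with trigonometric polynomials. In the remaining case \<open>\<alpha> = 0\<close> the counts differ from \<open>n\<close> times
  the limit vector by a bounded amount.
\<close>

section \<open>The continuity theorem in Euclidean spaces\<close>

text \<open>The phase \<open>t\<close> covers sines and makes the product of two generators a sum of two
  generators, so that this class is an algebra. The integrals of its members depend on the measure only
  through finitely many values of its characteristic function.\<close>

inductive trig_poly :: "('a::euclidean_space \<Rightarrow> real) \<Rightarrow> bool" where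
  wave: "trig_poly (\<lambda>x. c * cos (inner a x + t))"
| add: "trig_poly f \<Longrightarrow> trig_poly g \<Longrightarrow> trig_poly (\<lambda>x. f x + g x)"

lemma trig_poly_const: "trig_poly (\<lambda>x. c)"
  using trig_poly.wave[of c 0 0] by simp

lemma trig_poly_cos: "trig_poly (\<lambda>x. c * cos (inner a x))"
  using trig_poly.wave[of c a 0] by simp

lemma trig_poly_sin: "trig_poly (\<lambda>x. c * sin (inner a x))"
  using trig_poly.wave[of c a "- pi / 2"] by (simp add: cos_diff)

lemma trig_poly_sum:
  assumes "\<And>i. i \<in> A \<Longrightarrow> trig_poly (f i)"
  shows "trig_poly (\<lambda>x. \<Sum>i\<in>A. f i x)"
proof (cases "finite A")
  case True
  then show ?thesis
    using assms by (induction A) (auto intro: trig_poly_const trig_poly.add)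
qed (simp add: trig_poly_const)

lemma trig_poly_mult:
  assumes "trig_poly f" "trig_poly g"
  shows "trig_poly (\<lambda>x. f x * g x)"
  using assms
proof (induction f)
  case (wave c a t)
  from wave.prems show ?case
  proof (induction g)
    case (wave c' a' t')
    have "(\<lambda>x. c * cos (inner a x + t) * (c' * cos (inner a' x + t'))) =
          (\<lambda>x. c * c' / 2 * cos (inner (a - a') x + (t - t')) + c * c' / 2 * cos (inner (a + a') x + (t + t')))"
    proof
      fix x
      have *: "inner (a - a') x + (t - t') = (inner a x + t) - (inner a' x + t')"
        "inner (a + a') x + (t + t') = (inner a x + t) + (inner a' x + t')"
        by (auto simp: inner_simps)
      show "c * cos (inner a x + t) * (c' * cos (inner a' x + t')) =
          c * c' / 2 * cos (inner (a - a') x + (t - t')) + c * c' / 2 * cos (inner (a + a') x + (t + t'))"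
        unfolding * cos_add[of "inner a x + t"] cos_diff[of "inner a x + t"] by (simp add: field_simps)
    qed
    then show ?case
      by (simp only:) (intro trig_poly.intros)
  next
    case (add g h)
    then show ?case by (simp add: distrib_left trig_poly.add)
  qed
next
  case (add f h)
  then show ?case by (simp add: distrib_right trig_poly.add)
qed

text \<open>Coordinates are wrapped around circles of circumference \<open>2 * R\<close>; a point of the torus is the pair
  of the vectors of its cosines and of its sines.\<close>

definition torus_map :: "real \<Rightarrow> 'a::euclidean_space \<Rightarrow> 'a \<times> 'a" where
  "torus_map R x = ((\<Sum>b\<in>Basis. cos (pi * inner x b / R) *\<^sub>R b), (\<Sum>b\<in>Basis. sin (pi * inner x b / R) *\<^sub>R b))"

text \<open>This is what turns polynomial approximation on the torus into trigonometric approximation on the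
  whole space.\<close>

lemma trig_poly_polynomial_torus_map:
  fixes P :: "'a::euclidean_space \<times> 'a \<Rightarrow> real"
  assumes "real_polynomial_function P"
  shows "trig_poly (\<lambda>x. P (torus_map R x))"
  using assms
proof (induction P)
  case (linear h)
  then interpret bounded_linear h .
  have "torus_map R x = (\<Sum>b\<in>Basis. cos (inner ((pi / R) *\<^sub>R b) x) *\<^sub>R (b, 0) + sin (inner ((pi / R) *\<^sub>R b) x) *\<^sub>R (0, b))" for x :: 'a
    by (simp add: torus_map_def sum_prod inner_commute prod_eq_iff fst_sum snd_sum)
  then have "(\<lambda>x. h (torus_map R x)) =
      (\<lambda>x. \<Sum>b\<in>Basis. h (b, 0) * cos (inner ((pi / R) *\<^sub>R b) x) + h (0, b) * sin (inner ((pi / R) *\<^sub>R b) x))"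
    by (simp add: sum add scaleR mult.commute del: scaleR_Pair)
  then show ?case
    by (simp only:) (intro trig_poly_sum trig_poly.add trig_poly_cos trig_poly_sin)
qed (auto intro: trig_poly_const trig_poly.add trig_poly_mult)

text \<open>The cutoff vanishes outside the cube \<open>{-R<..<R}\<close>, on which \<open>torus_map R\<close> is injective.\<close>

definition tent :: "real \<Rightarrow> 'a::euclidean_space \<Rightarrow> real" where
  "tent R x = max 0 (1 - (\<Sum>b\<in>Basis. \<bar>inner x b\<bar>) / R)"

lemma tent_bounds: "0 \<le> tent R x" "0 < R \<Longrightarrow> tent R x \<le> 1"
  by (auto simp: tent_def sum_nonneg)

lemma tent_eq_0:
  assumes "0 < R" "b \<in> Basis" "R \<le> \<bar>inner x b\<bar>"
  shows "tent R x = 0"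
proof -
  have "\<bar>inner x b\<bar> \<le> (\<Sum>b\<in>Basis. \<bar>inner x b\<bar>)"
    using assms(2) by (intro member_le_sum) auto
  with assms show ?thesis by (simp add: tent_def max_def field_simps)
qed

text \<open>The right-hand side is a sum of bounded continuous functions of single coordinates, so its
  integrals are controlled by the one-dimensional marginals. This is how tightness enters.\<close>

lemma one_minus_tent_le:
  assumes "0 < R"
  shows "1 - tent R x \<le> (\<Sum>b\<in>Basis. min 1 (\<bar>inner x b\<bar> / R))"
proof (cases "\<exists>b\<in>Basis. R \<le> \<bar>inner x b\<bar>")
  case True
  then obtain b where b: "b \<in> Basis" "R \<le> \<bar>inner x b\<bar>" by auto
  have "1 = min 1 (\<bar>inner x b\<bar> / R)"
    using b assms by (simp add: min_def field_simps)
  also have "\<dots> \<le> (\<Sum>b\<in>Basis. min 1 (\<bar>inner x b\<bar> / R))"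
    using b assms by (intro member_le_sum) auto
  finally show ?thesis using tent_bounds(1)[of R x] by linarith
next
  case False
  then have "(\<Sum>b\<in>Basis. min 1 (\<bar>inner x b\<bar> / R)) = (\<Sum>b\<in>Basis. \<bar>inner x b\<bar> / R)"
    using assms by (intro sum.cong refl) (auto simp: min_def field_simps not_le)
  then show ?thesis
    by (simp add: tent_def sum_divide_distrib)
qed

definition torus_angle :: "'a::euclidean_space \<times> 'a \<Rightarrow> 'a \<Rightarrow> real" where
  "torus_angle z b = Arg (Complex (inner (fst z) b) (inner (snd z) b))"

definition torus_inv :: "real \<Rightarrow> 'a::euclidean_space \<times> 'a \<Rightarrow> 'a" where
  "torus_inv R z = (\<Sum>b\<in>Basis. (R / pi * torus_angle z b) *\<^sub>R b)"

definition torus :: "('a::euclidean_space \<times> 'a) set" where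
  "torus = {z. \<forall>b\<in>Basis. (inner (fst z) b)\<^sup>2 + (inner (snd z) b)\<^sup>2 = 1}"

lemma torus_map_in_torus: "torus_map R x \<in> torus"
  by (auto simp: torus_def torus_map_def inner_sum_left inner_Basis if_distrib cong: if_cong)

lemma torus_coordinate_bounds:
  assumes "z \<in> torus" "b \<in> Basis"
  shows "\<bar>inner (fst z) b\<bar> \<le> 1" "\<bar>inner (snd z) b\<bar> \<le> 1"
proof -
  have "(inner (fst z) b)\<^sup>2 + (inner (snd z) b)\<^sup>2 = 1" using assms by (auto simp: torus_def)
  then have "(inner (fst z) b)\<^sup>2 \<le> 1" "(inner (snd z) b)\<^sup>2 \<le> 1"
    by (smt (verit) zero_le_power2)+
  then show "\<bar>inner (fst z) b\<bar> \<le> 1" "\<bar>inner (snd z) b\<bar> \<le> 1"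
    by (auto simp: abs_square_le_1)
qed

lemma compact_torus: "compact (torus :: ('a::euclidean_space \<times> 'a) set)"
proof -
  have "closed (torus :: ('a \<times> 'a) set)"
    unfolding torus_def Collect_ball_eq
    by (intro closed_INT ballI closed_Collect_eq continuous_intros)
  moreover have "bounded (torus :: ('a \<times> 'a) set)"
    unfolding bounded_iff
  proof (intro exI ballI)
    fix z :: "'a \<times> 'a" assume z: "z \<in> torus"
    note torus_coordinate_bounds[OF z]
    then have "norm (fst z) \<le> real DIM('a)" "norm (snd z) \<le> real DIM('a)"
      using norm_le_l1[of "fst z"] norm_le_l1[of "snd z"] sum_bounded_above[of Basis "\<lambda>b. \<bar>inner (fst z) b\<bar>" 1]
        sum_bounded_above[of Basis "\<lambda>b. \<bar>inner (snd z) b\<bar>" 1]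
      by force+
    moreover have "norm z \<le> norm (fst z) + norm (snd z)"
      by (metis norm_Pair_le prod.collapse)
    ultimately show "norm z \<le> 2 * real DIM('a)"
      by linarith
  qed
  ultimately show ?thesis
    using compact_eq_bounded_closed by blast
qed

lemma abs_torus_angle:
  assumes "z \<in> torus" "b \<in> Basis"
  shows "\<bar>torus_angle z b\<bar> = arccos (inner (fst z) b)"
proof -
  define w where "w = Complex (inner (fst z) b) (inner (snd z) b)"
  have n: "cmod w = 1"
    using assms by (simp add: w_def torus_def cmod_def)
  then have "w \<noteq> 0" by auto
  then have "inner (fst z) b = cos (Arg w)"
    using n by (simp add: cos_Arg w_def)
  then show ?thesis
    using Arg_bounded[of w] unfolding torus_angle_def w_def[symmetric]
    by (simp add: arccos_cos_eq_abs abs_le_iff)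
qed

lemma torus_inv_torus_map:
  assumes "0 < R" "\<And>b. b \<in> Basis \<Longrightarrow> \<bar>inner x b\<bar> < R"
  shows "torus_inv R (torus_map R x) = x"
proof -
  have "torus_angle (torus_map R x) b = pi * inner x b / R" if b: "b \<in> Basis" for b
  proof -
    have "Complex (inner (fst (torus_map R x)) b) (inner (snd (torus_map R x)) b) = cis (pi * inner x b / R)"
      using b by (auto simp: torus_map_def inner_sum_left inner_Basis if_distrib complex_eq_iff cong: if_cong)
    moreover have "- R < inner x b" "inner x b < R" using assms(2)[OF b] by auto
    then have "- pi < pi * inner x b / R" "pi * inner x b / R \<le> pi"
      using assms(1) mult_strict_left_mono[of "-R" "inner x b" pi] mult_strict_left_mono[of "inner x b" R pi]
      by (auto simp: field_simps)
    ultimately show ?thesis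
      unfolding torus_angle_def by (simp add: Arg_cis)
  qed
  then have "torus_inv R (torus_map R x) = (\<Sum>b\<in>Basis. inner x b *\<^sub>R b)"
    unfolding torus_inv_def using assms(1) by (intro sum.cong) auto
  then show ?thesis by (simp add: euclidean_representation)
qed

text \<open>The angle function jumps where a coordinate of the torus equals \<open>-1\<close>. This does not harm: the
  tent depends on the absolute values of the angles only, which are continuous on the torus as
  arccosines, and it vanishes at the jumps, where the other factor stays bounded.\<close>

lemma continuous_on_torus_localization:
  fixes f :: "'a::euclidean_space \<Rightarrow> real"
  assumes f: "continuous_on UNIV f" and B: "\<And>x. \<bar>f x\<bar> \<le> B" and R: "0 < R"
  shows "continuous_on torus (\<lambda>z. f (torus_inv R z) * tent R (torus_inv R z))"
proof -
  define h where "h z = max 0 (1 - (\<Sum>b\<in>Basis. arccos (inner (fst z) b)) / pi)" for z :: "'a \<times> 'a"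
  have th: "tent R (torus_inv R z) = h z" if z: "z \<in> torus" for z :: "'a \<times> 'a"
  proof -
    have "\<bar>inner (torus_inv R z) b\<bar> = R / pi * arccos (inner (fst z) b)" if b: "b \<in> Basis" for b
      using b R abs_torus_angle[OF z b]
      by (simp add: torus_inv_def inner_sum_left inner_Basis if_distrib abs_mult cong: if_cong)
    then have "(\<Sum>b\<in>Basis. \<bar>inner (torus_inv R z) b\<bar>) = R / pi * (\<Sum>b\<in>Basis. arccos (inner (fst z) b))"
      by (simp add: sum_distrib_left)
    then show ?thesis using R by (simp add: tent_def h_def)
  qed
  have h: "continuous_on torus h"
    unfolding h_def
    by (intro continuous_intros) (use torus_coordinate_bounds(1) in \<open>auto simp: abs_le_iff minus_le_iff\<close>)
  show ?thesis
    unfolding continuous_on_def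
  proof
    fix z :: "'a \<times> 'a" assume z: "z \<in> torus"
    show "((\<lambda>z. f (torus_inv R z) * tent R (torus_inv R z)) \<longlongrightarrow> f (torus_inv R z) * tent R (torus_inv R z)) (at z within torus)"
    proof (cases "\<exists>b\<in>Basis. Complex (inner (fst z) b) (inner (snd z) b) \<in> \<real>\<^sub>\<le>\<^sub>0")
      case True
      then obtain b where b: "b \<in> Basis" "inner (snd z) b = 0" "inner (fst z) b \<le> 0"
        by (auto simp: complex_nonpos_Reals_iff)
      then have "inner (fst z) b = -1"
        using z by (auto simp: torus_def power2_eq_1_iff)
      then have "\<bar>inner (torus_inv R z) b\<bar> = R"
        using b R abs_torus_angle[OF z b(1)]
        by (simp add: torus_inv_def inner_sum_left inner_Basis if_distrib abs_mult cong: if_cong)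
      then have t0: "tent R (torus_inv R z) = 0"
        using b R by (intro tent_eq_0) auto
      have "(h \<longlongrightarrow> 0) (at z within torus)"
        using h z t0 th[OF z] by (auto simp: continuous_on_def)
      then have "((\<lambda>z. B * h z) \<longlongrightarrow> 0) (at z within torus)"
        by (rule tendsto_mult_right_zero)
      moreover have "\<forall>\<^sub>F z in at z within torus. norm (f (torus_inv R z) * tent R (torus_inv R z)) \<le> B * h z"
        unfolding eventually_at_filter
      proof (intro always_eventually allI impI)
        fix z :: "'a \<times> 'a" assume "z \<in> torus"
        then show "norm (f (torus_inv R z) * tent R (torus_inv R z)) \<le> B * h z"
          using B tent_bounds(1)[of R "torus_inv R z"]
          by (simp add: abs_mult th[symmetric] mult_right_mono)
      qed
      ultimately show ?thesis
        unfolding t0 mult_zero_right by (rule Lim_null_comparison[rotated])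
    next
      case False
      have "((\<lambda>z. torus_inv R z) \<longlongrightarrow> torus_inv R z) (at z within torus)"
        unfolding torus_inv_def torus_angle_def
      proof (intro tendsto_sum tendsto_scaleR tendsto_mult tendsto_const)
        fix b :: 'a assume b: "b \<in> Basis"
        have "((\<lambda>z. Complex (inner (fst z) b) (inner (snd z) b)) \<longlongrightarrow> Complex (inner (fst z) b) (inner (snd z) b)) (at z within torus)"
          by (intro tendsto_intros)
        moreover have "isCont Arg (Complex (inner (fst z) b) (inner (snd z) b))"
          using False b by (intro continuous_at_Arg) auto
        ultimately show "((\<lambda>z. Arg (Complex (inner (fst z) b) (inner (snd z) b))) \<longlongrightarrow> Arg (Complex (inner (fst z) b) (inner (snd z) b))) (at z within torus)"
          by (rule isCont_tendsto_compose[rotated])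
      qed
      then have "((\<lambda>z. f (torus_inv R z)) \<longlongrightarrow> f (torus_inv R z)) (at z within torus)"
        using f by (intro isCont_tendsto_compose[of _ f]) (auto simp: continuous_on_eq_continuous_at)
      moreover have "((\<lambda>z. tent R (torus_inv R z)) \<longlongrightarrow> tent R (torus_inv R z)) (at z within torus)"
      proof -
        have "(h \<longlongrightarrow> h z) (at z within torus)"
          using h z by (auto simp: continuous_on_def)
        then have "(h \<longlongrightarrow> tent R (torus_inv R z)) (at z within torus)"
          by (simp add: th[OF z])
        then show ?thesis
          by (rule Lim_transform_eventually) (auto simp: eventually_at_filter th)
      qed
      ultimately show ?thesis by (rule tendsto_mult)
    qed
  qed
qed

text \<open>Approximating the localized function by trigonometric polynomials uniformly on the torus gives a
  periodic function on the whole space. Outside the cube it is unrelated to \<open>f\<close>, but there it is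
  bounded by about \<open>B\<close> while the tent is zero, so one error bound serves everywhere.\<close>

lemma trig_poly_approx:
  fixes f :: "'a::euclidean_space \<Rightarrow> real"
  assumes f: "continuous_on UNIV f" and B: "\<And>x. \<bar>f x\<bar> \<le> B" and R: "0 < R" and \<epsilon>: "0 < \<epsilon>"
  obtains g where "trig_poly g" "\<And>x. \<bar>f x - g x\<bar> \<le> \<epsilon> + 2 * B * (1 - tent R x)"
proof -
  define F where "F z = f (torus_inv R z) * tent R (torus_inv R z)" for z
  obtain P where P: "real_polynomial_function P" "\<And>z. z \<in> torus \<Longrightarrow> \<bar>F z - P z\<bar> < \<epsilon>"
    using Stone_Weierstrass_real_polynomial_function[OF compact_torus
        continuous_on_torus_localization[OF f B R] \<epsilon>] unfolding F_def by metis
  have "\<bar>f x - P (torus_map R x)\<bar> \<le> \<epsilon> + 2 * B * (1 - tent R x)" for x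
  proof -
    have FP: "\<bar>F (torus_map R x) - P (torus_map R x)\<bar> < \<epsilon>"
      by (rule P(2)[OF torus_map_in_torus])
    have B0: "0 \<le> B" using B[of 0] by linarith
    have t: "0 \<le> tent R x" "tent R x \<le> 1" using tent_bounds R by auto
    show ?thesis
    proof (cases "\<forall>b\<in>Basis. \<bar>inner x b\<bar> < R")
      case True
      then have "F (torus_map R x) = f x * tent R x"
        using R by (simp add: F_def torus_inv_torus_map)
      then have "f x - F (torus_map R x) = f x * (1 - tent R x)"
        by (simp add: algebra_simps)
      then have "\<bar>f x - F (torus_map R x)\<bar> \<le> B * (1 - tent R x)"
        using B[of x] t by (simp add: abs_mult mult_right_mono)
      moreover have "0 \<le> B * (1 - tent R x)" using B0 t by simp
      ultimately show ?thesis using FP by linarith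
    next
      case False
      then obtain b where "b \<in> Basis" "R \<le> \<bar>inner x b\<bar>" by (auto simp: not_less)
      then have "tent R x = 0" using R by (intro tent_eq_0)
      moreover have "\<bar>F (torus_map R x)\<bar> \<le> B"
        unfolding F_def abs_mult using B tent_bounds R B0
        by (metis abs_of_nonneg abs_ge_zero mult_mono mult.right_neutral)
      ultimately show ?thesis using FP B[of x] by simp
    qed
  qed
  then show thesis
    using that trig_poly_polynomial_torus_map[OF P(1)] by blast
qed

lemma integrable_bounded_borel:
  fixes f :: "'a::topological_space \<Rightarrow> 'b::{banach, second_countable_topology}"
  assumes "prob_space M" "sets M = sets borel" "f \<in> borel_measurable borel" "\<And>x. norm (f x) \<le> B"
  shows "integrable M f"
proof -
  interpret prob_space M by fact
  have "f \<in> borel_measurable M"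
    using assms(2,3) measurable_cong_sets by blast
  then show ?thesis
    using assms(4) by (intro integrable_const_bound[of _ B]) auto
qed

lemma trig_poly_bounded_continuous:
  assumes "trig_poly g"
  shows "continuous_on UNIV g \<and> (\<exists>B. \<forall>x. \<bar>g x\<bar> \<le> B)"
  using assms
proof (induction g)
  case (wave c a t)
  have "\<bar>c * cos (inner a x + t)\<bar> \<le> \<bar>c\<bar>" for x
    by (simp add: abs_mult mult_left_le)
  then show ?case
    by (auto intro!: continuous_intros)
next
  case (add f g)
  then obtain B1 B2 where B: "\<And>x. \<bar>f x\<bar> \<le> B1" "\<And>x. \<bar>g x\<bar> \<le> B2" by auto
  have "\<bar>f x + g x\<bar> \<le> B1 + B2" for x
    using B[of x] by linarith
  with add show ?case
    by (auto intro!: continuous_on_add)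
qed

lemma integrable_trig_poly:
  assumes "prob_space M" "sets M = sets borel" "trig_poly g"
  shows "integrable M g"
proof -
  obtain B where "continuous_on UNIV g" "\<And>x. norm (g x) \<le> B"
    using trig_poly_bounded_continuous[OF assms(3)] by auto
  then show ?thesis
    by (intro integrable_bounded_borel[OF assms(1,2)] borel_measurable_continuous_onI)
qed

lemma trig_poly_integral_tendsto:
  fixes M :: "nat \<Rightarrow> 'a::euclidean_space measure"
  assumes M: "\<And>n. prob_space (M n)" "\<And>n. sets (M n) = sets borel"
    and L: "prob_space L" "sets L = sets borel"
    and chars: "\<And>a. (\<lambda>n. CLINT x|M n. iexp (inner a x)) \<longlonglongrightarrow> (CLINT x|L. iexp (inner a x))"
    and g: "trig_poly g"
  shows "(\<lambda>n. integral\<^sup>L (M n) g) \<longlonglongrightarrow> integral\<^sup>L L g"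
  using g
proof (induction g)
  case (wave c a t)
  have *: "(LINT x|N. c * cos (inner a x + t)) = c * Re (cis t * (CLINT x|N. iexp (inner a x)))"
    if N: "prob_space N" "sets N = sets borel" for N :: "'a measure"
  proof -
    have i: "integrable N (\<lambda>x. iexp (inner a x))"
      by (rule integrable_bounded_borel[OF N, where B=1]) auto
    have "cis t * (CLINT x|N. iexp (inner a x)) = (CLINT x|N. cis t * iexp (inner a x))"
      by simp
    also have "Re \<dots> = (LINT x|N. Re (cis t * iexp (inner a x)))"
      using i by (intro integral_Re[symmetric]) simp
    also have "\<dots> = (LINT x|N. cos (inner a x + t))"
      by (simp add: cis_conv_exp[symmetric] cos_add mult.commute)
    finally show ?thesis by simp
  qed
  show ?case
    unfolding *[OF M] *[OF L] by (intro tendsto_intros chars)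
next
  case (add f g)
  have "integral\<^sup>L N (\<lambda>x. f x + g x) = integral\<^sup>L N f + integral\<^sup>L N g"
    if N: "prob_space N" "sets N = sets borel" for N :: "'a measure"
    using integrable_trig_poly[OF N] add by simp
  then show ?case
    using tendsto_add[OF add.IH] M L by simp
qed

lemma char_marginal:
  fixes N :: "'a::euclidean_space measure"
  assumes "prob_space N" "sets N = sets borel"
  shows "real_distribution (distr N borel (inner a))"
    and "char (distr N borel (inner a)) t = (CLINT x|N. iexp (inner (t *\<^sub>R a) x))"
proof -
  interpret prob_space N by fact
  have m [measurable]: "inner a \<in> borel_measurable N"
    unfolding measurable_cong_sets[OF assms(2) refl] by measurable
  show "real_distribution (distr N borel (inner a))"
    by (rule real_distribution_distr) simp
  show "char (distr N borel (inner a)) t = (CLINT x|N. iexp (inner (t *\<^sub>R a) x))"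
    unfolding char_def by (subst integral_distr) (auto simp: mult.commute)
qed

text \<open>A trigonometric polynomial \<open>g\<close> is close to \<open>f\<close> up to an error that is small where the tent is
  near 1. The integral of \<open>g\<close> converges by hypothesis; the integral of the error is small uniformly
  in \<open>n\<close> because the marginals are tight.\<close>

theorem levy_continuity_euclidean:
  fixes M :: "nat \<Rightarrow> 'a::euclidean_space measure"
  assumes M: "\<And>n. prob_space (M n)" "\<And>n. sets (M n) = sets borel"
    and L: "prob_space L" "sets L = sets borel"
    and chars: "\<And>a. (\<lambda>n. CLINT x|M n. iexp (inner a x)) \<longlonglongrightarrow> (CLINT x|L. iexp (inner a x))"
  shows "converges_in_law M L"
  unfolding converges_in_law_def
proof (intro allI impI)
  fix f :: "'a \<Rightarrow> real" assume f: "continuous_on UNIV f \<and> bounded (range f)"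
  then obtain B where B: "0 < B" "\<And>x. \<bar>f x\<bar> \<le> B"
    unfolding bounded_pos by auto
  define d where "d R x = (\<Sum>b\<in>Basis. min 1 (\<bar>inner x b\<bar> / R))" for R and x :: 'a
  have d_cont [continuous_intros]: "continuous_on UNIV (d R)" for R
    unfolding d_def by (auto intro!: continuous_intros simp: divide_inverse)
  have d_bd: "norm (d R x) \<le> real DIM('a)" if "0 < R" for R x
    unfolding d_def real_norm_def using that
    by (intro order_trans[OF sum_abs] sum_bounded_above[where K=1, simplified]) auto
  have d_int: "integrable N (d R)" if "prob_space N" "sets N = sets borel" "0 < R" for N R
    by (rule integrable_bounded_borel[OF that(1,2) borel_measurable_continuous_onI[OF d_cont] d_bd[OF that(3)]])
  have d_sum: "integral\<^sup>L N (d R) = (\<Sum>b\<in>Basis. LINT t|distr N borel (inner b). min 1 (\<bar>t\<bar> / R))"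
    if N: "prob_space N" "sets N = sets borel" and R: "0 < R" for N R
  proof -
    have meas: "(\<lambda>x. min 1 (\<bar>inner x b\<bar> / R)) \<in> borel_measurable borel" for b :: 'a
      by (intro borel_measurable_continuous_onI continuous_intros) (use R in auto)
    have "integral\<^sup>L N (d R) = (\<Sum>b\<in>Basis. LINT x|N. min 1 (\<bar>inner x b\<bar> / R))"
      unfolding d_def using R
      by (intro Bochner_Integration.integral_sum integrable_bounded_borel[OF N meas, where B=1]) auto
    also have "\<dots> = (\<Sum>b\<in>Basis. LINT t|distr N borel (inner b). min 1 (\<bar>t\<bar> / R))"
    proof (intro sum.cong refl)
      fix b :: 'a
      have "inner b \<in> measurable N borel"
        unfolding measurable_cong_sets[OF N(2) refl] by measurable
      then show "(LINT x|N. min 1 (\<bar>inner x b\<bar> / R)) = (LINT t|distr N borel (inner b). min 1 (\<bar>t\<bar> / R))"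
        by (subst integral_distr) (auto simp: inner_commute)
    qed
    finally show ?thesis .
  qed
  \<comment> \<open>tightness, from the one-dimensional continuity theorem applied to each coordinate\<close>
  have d_lim: "(\<lambda>n. integral\<^sup>L (M n) (d R)) \<longlonglongrightarrow> integral\<^sup>L L (d R)" if R: "0 < R" for R
    unfolding d_sum[OF M R] d_sum[OF L R]
  proof (intro tendsto_sum)
    fix b :: 'a
    have "weak_conv_m (\<lambda>n. distr (M n) borel (inner b)) (distr L borel (inner b))"
    proof (rule levy_continuity)
      show "(\<lambda>n. char (distr (M n) borel (inner b)) t) \<longlonglongrightarrow> char (distr L borel (inner b)) t" for t
        unfolding char_marginal(2)[OF M] char_marginal(2)[OF L] by (rule chars)
    qed (intro char_marginal M L)+
    then show "(\<lambda>n. LINT t|distr (M n) borel (inner b). min 1 (\<bar>t\<bar> / R)) \<longlonglongrightarrow> (LINT t|distr L borel (inner b). min 1 (\<bar>t\<bar> / R))"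
      by (rule weak_conv_imp_integral_bdd_continuous_conv[where B=1, rotated 2])
        (use R in \<open>auto intro!: continuous_intros char_marginal M L\<close>)
  qed
  have d_small: "\<exists>R>0. integral\<^sup>L L (d R) < \<epsilon>" if \<epsilon>: "0 < \<epsilon>" for \<epsilon>
  proof -
    have "(\<lambda>n. integral\<^sup>L L (d (real (Suc n)))) \<longlonglongrightarrow> integral\<^sup>L L (\<lambda>x :: 'a. 0)"
    proof (rule integral_dominated_convergence[where w="\<lambda>x::'a. real DIM('a)"])
      interpret prob_space L by fact
      show "integrable L (\<lambda>x::'a. real DIM('a))" by simp
      show "AE x :: 'a in L. (\<lambda>n. d (real (Suc n)) x) \<longlonglongrightarrow> 0"
      proof (rule AE_I2)
        fix x :: 'a
        have "(\<lambda>n. min 1 (\<bar>inner x b\<bar> / real (Suc n))) \<longlonglongrightarrow> 0" for b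
        proof (rule tendsto_sandwich[OF _ _ tendsto_const])
          show "(\<lambda>n. \<bar>inner x b\<bar> / real (Suc n)) \<longlonglongrightarrow> 0"
            by (rule LIMSEQ_Suc[OF lim_const_over_n])
        qed auto
        then show "(\<lambda>n. d (real (Suc n)) x) \<longlonglongrightarrow> 0"
          unfolding d_def by (intro tendsto_null_sum)
      qed
    qed (use d_int[OF L] d_bd in \<open>auto simp del: of_nat_Suc intro: borel_measurable_integrable\<close>)
    then have "\<forall>\<^sub>F n in sequentially. integral\<^sup>L L (d (real (Suc n))) < \<epsilon>"
      using \<epsilon> by (intro order_tendstoD) auto
    then obtain n where "integral\<^sup>L L (d (real (Suc n))) < \<epsilon>"
      using eventually_happens by fastforce
    then show ?thesis by (intro exI[of _ "real (Suc n)"]) auto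
  qed
  show "(\<lambda>n. integral\<^sup>L (M n) f) \<longlonglongrightarrow> integral\<^sup>L L f"
  proof (rule LIMSEQ_I)
    fix e :: real assume e: "0 < e"
    \<comment> \<open>the three error terms below add up to less than \<open>3 * \<epsilon> + 4 * B * \<epsilon>\<close>\<close>
    define \<epsilon> where "\<epsilon> = e / (4 + 8 * B)"
    have \<epsilon>: "0 < \<epsilon>" using e B by (simp add: \<epsilon>_def)
    obtain R where R: "0 < R" "integral\<^sup>L L (d R) < \<epsilon>" using d_small[OF \<epsilon>] by auto
    obtain g where g: "trig_poly g" and fg: "\<And>x. \<bar>f x - g x\<bar> \<le> \<epsilon> + 2 * B * (1 - tent R x)"
      using trig_poly_approx[of f B R \<epsilon>] f B(2) R(1) \<epsilon> by metis
    have close: "\<bar>integral\<^sup>L N f - integral\<^sup>L N g\<bar> \<le> \<epsilon> + 2 * B * integral\<^sup>L N (d R)"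
      if N: "prob_space N" "sets N = sets borel" for N
    proof -
      interpret prob_space N by fact
      have fi: "integrable N f"
        using f B(2) by (intro integrable_bounded_borel[OF N, where B=B] borel_measurable_continuous_onI) auto
      note gi = integrable_trig_poly[OF N g]
      note di = d_int[OF N R(1)]
      have "\<bar>integral\<^sup>L N f - integral\<^sup>L N g\<bar> = \<bar>LINT x|N. f x - g x\<bar>"
        using fi gi by simp
      also have "\<dots> \<le> (LINT x|N. \<bar>f x - g x\<bar>)"
        by (rule integral_abs_bound)
      also have "\<dots> \<le> (LINT x|N. \<epsilon> + 2 * B * d R x)"
      proof (rule integral_mono)
        fix x
        have "2 * B * (1 - tent R x) \<le> 2 * B * d R x"
          using one_minus_tent_le[OF R(1), of x] B(1) by (intro mult_left_mono) (auto simp: d_def)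
        then show "\<bar>f x - g x\<bar> \<le> \<epsilon> + 2 * B * d R x"
          using fg[of x] by linarith
      qed (use fi gi di in auto)
      also have "\<dots> = \<epsilon> + 2 * B * integral\<^sup>L N (d R)"
        using di by (simp add: prob_space)
      finally show ?thesis .
    qed
    have ev1: "\<forall>\<^sub>F n in sequentially. \<bar>integral\<^sup>L (M n) g - integral\<^sup>L L g\<bar> < \<epsilon>"
      using tendstoD[OF trig_poly_integral_tendsto[OF M L chars g] \<epsilon>] by (simp add: dist_real_def)
    have ev2: "\<forall>\<^sub>F n in sequentially. integral\<^sup>L (M n) (d R) < \<epsilon>"
      by (rule order_tendstoD(2)[OF d_lim[OF R(1)] R(2)])
    have "\<forall>\<^sub>F n in sequentially. norm (integral\<^sup>L (M n) f - integral\<^sup>L L f) < e"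
      using ev1 ev2
    proof eventually_elim
      case (elim n)
      have "2 * B * integral\<^sup>L (M n) (d R) \<le> 2 * B * \<epsilon>" "2 * B * integral\<^sup>L L (d R) \<le> 2 * B * \<epsilon>"
        using elim(2) R(2) B(1) by (auto intro!: mult_left_mono)
      then have "\<bar>integral\<^sup>L (M n) f - integral\<^sup>L L f\<bar> < 3 * \<epsilon> + 4 * (B * \<epsilon>)"
        using close[OF M, of n] close[OF L] elim(1) by linarith
      also have "\<dots> \<le> (4 + 8 * B) * \<epsilon>"
        using B(1) \<epsilon> by (simp add: algebra_simps)
      also have "\<dots> = e" using B(1) by (simp add: \<epsilon>_def)
      finally show ?case by simp
    qed
    then show "\<exists>no. \<forall>n\<ge>no. norm (integral\<^sup>L (M n) f - integral\<^sup>L L f) < e"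
      by (simp add: eventually_sequentially)
  qed
qed

section \<open>Normal laws with a given covariance matrix\<close>

lemma real_distribution_normal_law: "0 \<le> v \<Longrightarrow> real_distribution (normal_law 0 v)"
  unfolding normal_law_def real_distribution_def real_distribution_axioms_def
  by (auto intro!: prob_space_return prob_space_normal_density)

lemma char_normal_law:
  assumes "0 \<le> v"
  shows "char (normal_law 0 v) t = of_real (exp (- (v * t\<^sup>2) / 2))"
proof (cases "v = 0")
  case True
  then show ?thesis
    by (simp add: normal_law_def char_def integral_return)
next
  case False
  then have s: "0 < sqrt v" using assms by simp
  interpret std: prob_space std_normal_distribution
    by (intro prob_space_normal_density) simp
  have "distributed std_normal_distribution lborel (\<lambda>x. x) (normal_density 0 1)"
    by (auto simp: distributed_def distr_id2)
  from std.normal_density_affine[OF this, of "sqrt v" 0]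
  have "distr std_normal_distribution lborel (\<lambda>x. sqrt v * x) = density lborel (normal_density 0 (sqrt v))"
    using s by (auto simp: distributed_def)
  then have "normal_law 0 v = distr std_normal_distribution borel (\<lambda>x. sqrt v * x)"
    using False distr_cong[OF refl sets_lborel refl, of std_normal_distribution "\<lambda>x. sqrt v * x"]
    by (simp add: normal_law_def)
  then have "char (normal_law 0 v) t = char std_normal_distribution (t * sqrt v)"
    by (simp add: char_def integral_distr mult.assoc)
  also have "\<dots> = of_real (exp (- (v * t\<^sup>2) / 2))"
    using assms by (simp add: char_std_normal_distribution power_mult_distrib mult.commute)
  finally show ?thesis .
qed

lemma covariance_matrix_symmetric_form:
  assumes "Finite_Cartesian_Product.transpose (\<Sigma> :: real^'c^'c) = \<Sigma>"
  shows "inner a (\<Sigma> *v b) = inner (\<Sigma> *v a) b"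
  using dot_lmul_matrix[of a \<Sigma> b] assms by (metis transpose_matrix_vector)

text \<open>One step of a Cholesky decomposition. Positivity of the deflated form is the Cauchy-Schwarz
  inequality of the form of \<open>\<Sigma>\<close> between \<open>a\<close> and the basis vector, read off from the quadratic
  polynomial \<open>t \<mapsto> (a - t e)\<^sup>T \<Sigma> (a - t e)\<close>; in particular \<open>\<gamma> = 0\<close> would force \<open>u = 0\<close>.\<close>

lemma covariance_matrix_deflate:
  fixes \<Sigma> :: "real^'c^'c"
  assumes \<Sigma>: "covariance_matrix \<Sigma>" and u: "u = \<Sigma> *v axis c 1" "u \<noteq> 0"
  defines "\<gamma> \<equiv> inner (axis c 1) u"
  defines "\<Sigma>' \<equiv> (\<chi> i j. vec_nth (vec_nth \<Sigma> i) j - vec_nth u i * vec_nth u j / \<gamma>)"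
  shows "0 < \<gamma>" "covariance_matrix \<Sigma>'"
    "\<And>a. \<Sigma>' *v a = \<Sigma> *v a - (inner u a / \<gamma>) *\<^sub>R u"
proof -
  have sym: "Finite_Cartesian_Product.transpose \<Sigma> = \<Sigma>" and psd: "\<And>a. 0 \<le> inner a (\<Sigma> *v a)"
    using \<Sigma> by (auto simp: covariance_matrix_def)
  have quad: "0 \<le> inner a (\<Sigma> *v a) - 2 * t * inner u a + t\<^sup>2 * \<gamma>" for a t
  proof -
    have "inner (a - t *\<^sub>R axis c 1) (\<Sigma> *v (a - t *\<^sub>R axis c 1)) =
        inner a (\<Sigma> *v a) - t * inner a u - t * inner (axis c 1) (\<Sigma> *v a) + t\<^sup>2 * \<gamma>"
      by (simp add: u(1) \<gamma>_def matrix_vector_mult_diff_distrib matrix_vector_mult_scaleR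
          inner_diff_left inner_diff_right power2_eq_square algebra_simps)
    moreover have "inner (axis c 1) (\<Sigma> *v a) = inner u a"
      unfolding u(1) by (rule covariance_matrix_symmetric_form[OF sym])
    ultimately show ?thesis
      using psd[of "a - t *\<^sub>R axis c 1"] by (simp add: inner_commute)
  qed
  show pos: "0 < \<gamma>"
  proof (rule ccontr)
    assume "\<not> 0 < \<gamma>"
    moreover have "0 \<le> \<gamma>" unfolding \<gamma>_def u(1) by (rule psd)
    ultimately have "\<gamma> = 0" by simp
    define s where "s = inner u u"
    have "0 < s" using u(2) by (simp add: s_def)
    have "0 \<le> inner u (\<Sigma> *v u) - 2 * t * s" for t
      using quad[of u t] \<open>\<gamma> = 0\<close> by (simp add: s_def)
    from this[of "(inner u (\<Sigma> *v u) + 1) / s"] show False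
      using \<open>0 < s\<close> psd[of u] by simp
  qed
  show mult: "\<Sigma>' *v a = \<Sigma> *v a - (inner u a / \<gamma>) *\<^sub>R u" for a
  proof (rule Finite_Cartesian_Product.vec_eq_iff[THEN iffD2], rule allI)
    fix i
    have "vec_nth (vec_nth \<Sigma>' i) j * vec_nth a j =
        vec_nth (vec_nth \<Sigma> i) j * vec_nth a j - vec_nth u i / \<gamma> * (vec_nth u j * vec_nth a j)" for j
      by (simp add: \<Sigma>'_def left_diff_distrib)
    then show "vec_nth (\<Sigma>' *v a) i = vec_nth (\<Sigma> *v a - (inner u a / \<gamma>) *\<^sub>R u) i"
      by (simp add: matrix_vector_mult_def inner_vec_def sum_subtractf sum_divide_distrib sum_distrib_left sum_distrib_right mult_ac)
  qed
  have "0 \<le> inner a (\<Sigma>' *v a)" for a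
  proof -
    have "inner a (\<Sigma>' *v a) = inner a (\<Sigma> *v a) - 2 * (inner u a / \<gamma>) * inner u a + (inner u a / \<gamma>)\<^sup>2 * \<gamma>"
      unfolding mult using pos by (simp add: inner_diff_right inner_commute power2_eq_square)
    then show ?thesis using quad[of a "inner u a / \<gamma>"] by simp
  qed
  moreover have "Finite_Cartesian_Product.transpose \<Sigma>' = \<Sigma>'"
    using sym by (simp add: \<Sigma>'_def Finite_Cartesian_Product.vec_eq_iff Finite_Cartesian_Product.transpose_def mult.commute)
  ultimately show "covariance_matrix \<Sigma>'"
    by (simp add: covariance_matrix_def)
qed

text \<open>Adding an independent Gaussian multiple of \<open>u\<close> adds the rank-one form of \<open>u\<close> to the exponent.\<close>

lemma gaussian_char_add_rank_one:
  fixes u :: "'a::euclidean_space"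
  assumes L: "prob_space L" "sets L = sets borel"
  defines "L' \<equiv> distr (L \<Otimes>\<^sub>M std_normal_distribution) borel (\<lambda>(x, z). x + z *\<^sub>R u)"
  shows "prob_space L'" "sets L' = sets borel"
    "(CLINT x|L'. iexp (inner a x)) = (CLINT x|L. iexp (inner a x)) * of_real (exp (- (inner a u)\<^sup>2 / 2))"
proof -
  interpret L: prob_space L by fact
  interpret std: prob_space std_normal_distribution
    by (intro prob_space_normal_density) simp
  interpret pair_prob_space L std_normal_distribution ..
  note [measurable_cong] = L(2)
  have m [measurable]: "(\<lambda>(x, z). x + z *\<^sub>R u) \<in> measurable (L \<Otimes>\<^sub>M std_normal_distribution) borel"
    by measurable
  show "prob_space L'" unfolding L'_def by (rule prob_space_distr) (rule m)
  show "sets L' = sets borel" by (simp add: L'_def)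
  have int: "integrable (L \<Otimes>\<^sub>M std_normal_distribution) (\<lambda>(x, z). iexp (inner a x) * iexp (inner a u * z))"
    by (rule integrable_const_bound[of _ 1]) (auto simp: norm_mult)
  have "(CLINT x|L'. iexp (inner a x)) =
      (LINT p|(L \<Otimes>\<^sub>M std_normal_distribution). (case p of (x, z) \<Rightarrow> iexp (inner a x) * iexp (inner a u * z)))"
    unfolding L'_def
    by (subst integral_distr) (auto intro!: Bochner_Integration.integral_cong
        simp: inner_add_right exp_add[symmetric] algebra_simps)
  also have "\<dots> = (CLINT x|L. (CLINT z|std_normal_distribution. iexp (inner a x) * iexp (inner a u * z)))"
    using integral_fst'[OF int] by simp
  also have "\<dots> = (CLINT x|L. iexp (inner a x)) * char std_normal_distribution (inner a u)"
    by (simp add: char_def)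
  finally show "(CLINT x|L'. iexp (inner a x)) = (CLINT x|L. iexp (inner a x)) * of_real (exp (- (inner a u)\<^sup>2 / 2))"
    by (simp add: char_std_normal_distribution)
qed

text \<open>Each deflation kills one more basis vector and none of those already killed is revived, so the
  decomposition ends after finitely many rank-one steps. Singular matrices are covered.\<close>

lemma gaussian_with_char:
  fixes \<Sigma> :: "real^'c^'c"
  assumes "covariance_matrix \<Sigma>"
  shows "\<exists>L. prob_space L \<and> sets L = sets borel \<and>
           (\<forall>a. (CLINT x|L. iexp (inner a x)) = of_real (exp (- inner a (\<Sigma> *v a) / 2)))"
  using assms
proof (induction "card {c. \<Sigma> *v axis c 1 \<noteq> 0}" arbitrary: \<Sigma> rule: less_induct)
  case less
  show ?case
  proof (cases "\<exists>c. \<Sigma> *v axis c 1 \<noteq> 0")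
    case False
    then have "\<Sigma> = 0"
      by (simp add: Finite_Cartesian_Product.vec_eq_iff matrix_vector_mult_basis column_def)
    then have "(CLINT x|return borel 0. iexp (inner a x)) = of_real (exp (- inner a (\<Sigma> *v a) / 2))" for a
      by (subst integral_return) auto
    then show ?thesis
      by (intro exI[of _ "return borel 0"]) (auto intro!: prob_space_return)
  next
    case True
    then obtain c where c: "\<Sigma> *v axis c 1 \<noteq> 0" by auto
    define u where "u = \<Sigma> *v axis c 1"
    define \<gamma> where "\<gamma> = inner (axis c 1) u"
    define \<Sigma>' where "\<Sigma>' = (\<chi> i j. vec_nth (vec_nth \<Sigma> i) j - vec_nth u i * vec_nth u j / \<gamma>)"
    note defl = covariance_matrix_deflate[OF less.prems u_def c[folded u_def], folded \<gamma>_def, folded \<Sigma>'_def]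
    have "{d. \<Sigma>' *v axis d 1 \<noteq> 0} \<subset> {d. \<Sigma> *v axis d 1 \<noteq> 0}"
    proof
      show "{d. \<Sigma>' *v axis d 1 \<noteq> 0} \<subseteq> {d. \<Sigma> *v axis d 1 \<noteq> 0}"
      proof (intro subsetI, simp, rule notI)
        fix d assume d: "\<Sigma>' *v axis d 1 \<noteq> 0" "\<Sigma> *v axis d 1 = 0"
        have "inner u (axis d 1) = inner (axis c 1) (\<Sigma> *v axis d 1)"
          unfolding u_def using less.prems
          by (intro covariance_matrix_symmetric_form[symmetric]) (simp add: covariance_matrix_def)
        with d show False by (simp add: defl(3))
      qed
      have "\<Sigma>' *v axis c 1 = 0"
        using defl(1) by (simp add: defl(3) u_def[symmetric] \<gamma>_def inner_commute)
      then show "{d. \<Sigma>' *v axis d 1 \<noteq> 0} \<noteq> {d. \<Sigma> *v axis d 1 \<noteq> 0}"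
        using c by blast
    qed
    then have "card {d. \<Sigma>' *v axis d 1 \<noteq> 0} < card {d. \<Sigma> *v axis d 1 \<noteq> 0}"
      by (intro psubset_card_mono) auto
    from less.hyps[OF this defl(2)] obtain L where L: "prob_space L" "sets L = sets borel"
      and ch: "\<And>a. (CLINT x|L. iexp (inner a x)) = of_real (exp (- inner a (\<Sigma>' *v a) / 2))"
      by auto
    define w where "w = (1 / sqrt \<gamma>) *\<^sub>R u"
    have "exp (- inner a (\<Sigma>' *v a) / 2) * exp (- (inner a w)\<^sup>2 / 2) = exp (- inner a (\<Sigma> *v a) / 2)" for a
    proof -
      have "(inner a w)\<^sup>2 = (inner u a)\<^sup>2 / \<gamma>"
        using defl(1) by (simp add: w_def power_divide inner_commute)
      moreover have "inner a (\<Sigma>' *v a) = inner a (\<Sigma> *v a) - (inner u a)\<^sup>2 / \<gamma>"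
        by (simp add: defl(3) inner_diff_right inner_commute power2_eq_square)
      ultimately have "- inner a (\<Sigma>' *v a) / 2 + - (inner a w)\<^sup>2 / 2 = - inner a (\<Sigma> *v a) / 2"
        by (simp add: diff_divide_distrib)
      then show ?thesis by (simp add: exp_add[symmetric])
    qed
    then have "(CLINT x|distr (L \<Otimes>\<^sub>M std_normal_distribution) borel (\<lambda>(x, z). x + z *\<^sub>R w). iexp (inner a x))
        = of_real (exp (- inner a (\<Sigma> *v a) / 2))" for a
      unfolding gaussian_char_add_rank_one(3)[OF L] ch of_real_mult[symmetric] by simp
    with gaussian_char_add_rank_one(1,2)[OF L, of w] show ?thesis
      by blast
  qed
qed

text \<open>The linear images are identified by their characteristic functions.\<close>

theorem multivariate_normal_exists:
  fixes \<Sigma> :: "real^'c^'c"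
  assumes \<Sigma>: "covariance_matrix \<Sigma>"
  obtains L where "multivariate_normal 0 \<Sigma> L"
    "\<And>a. (CLINT x|L. iexp (inner a x)) = of_real (exp (- inner a (\<Sigma> *v a) / 2))"
proof -
  obtain L where L: "prob_space L" "sets L = sets borel"
    and ch: "\<And>a. (CLINT x|L. iexp (inner a x)) = of_real (exp (- inner a (\<Sigma> *v a) / 2))"
    using gaussian_with_char[OF \<Sigma>] by auto
  have "distr L borel (inner a) = normal_law 0 (inner a (\<Sigma> *v a))" for a
  proof (rule Levy_uniqueness)
    have v: "0 \<le> inner a (\<Sigma> *v a)" using \<Sigma> by (simp add: covariance_matrix_def)
    have meas: "inner a \<in> borel_measurable L"
      unfolding measurable_cong_sets[OF L(2) refl] by measurable
    interpret prob_space L by fact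
    show "real_distribution (distr L borel (inner a))"
      by (rule real_distribution_distr) (rule meas)
    show "real_distribution (normal_law 0 (inner a (\<Sigma> *v a)))"
      by (rule real_distribution_normal_law) (rule v)
    show "char (distr L borel (inner a)) = char (normal_law 0 (inner a (\<Sigma> *v a)))"
    proof
      fix t
      have "char (distr L borel (inner a)) t = (CLINT x|L. iexp (inner (t *\<^sub>R a) x))"
        unfolding char_def by (subst integral_distr[OF meas]) auto
      also have "\<dots> = char (normal_law 0 (inner a (\<Sigma> *v a))) t"
        unfolding ch char_normal_law[OF v]
        by (simp add: matrix_vector_mult_scaleR power2_eq_square mult_ac)
      finally show "char (distr L borel (inner a)) t = char (normal_law 0 (inner a (\<Sigma> *v a))) t" .
    qed
  qed
  then have "multivariate_normal 0 \<Sigma> L"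
    using L \<Sigma> by (simp add: multivariate_normal_def)
  with ch show thesis using that by blast
qed

lemma normal_limit_of_chars:
  fixes \<Sigma> :: "real^'c^'c" and Y :: "nat \<Rightarrow> 's \<Rightarrow> real^'c"
  assumes \<Sigma>: "covariance_matrix \<Sigma>"
    and chars: "\<And>a. (\<lambda>n. measure_pmf.expectation (p n) (\<lambda>G. iexp (inner a (Y n G))))
                   \<longlonglongrightarrow> of_real (exp (- inner a (\<Sigma> *v a) / 2))"
  shows "\<exists>(\<Sigma> :: real^'c^'c) L. multivariate_normal 0 \<Sigma> L \<and>
     converges_in_law (\<lambda>n. distr (measure_pmf (p n)) borel (Y n)) L"
proof -
  obtain L where L: "multivariate_normal 0 \<Sigma> L"
    and ch: "\<And>a. (CLINT x|L. iexp (inner a x)) = of_real (exp (- inner a (\<Sigma> *v a) / 2))"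
    using multivariate_normal_exists[OF \<Sigma>] by blast
  have "converges_in_law (\<lambda>n. distr (measure_pmf (p n)) borel (Y n)) L"
  proof (rule levy_continuity_euclidean)
    show "(\<lambda>n. CLINT x|distr (measure_pmf (p n)) borel (Y n). iexp (inner a x)) \<longlonglongrightarrow> (CLINT x|L. iexp (inner a x))" for a
      unfolding ch using chars[of a] by (subst integral_distr) auto
    show "prob_space (distr (measure_pmf (p n)) borel (Y n))" for n
      by (rule prob_space.prob_space_distr) (auto intro: prob_space_measure_pmf)
  qed (use L in \<open>auto simp: multivariate_normal_def\<close>)
  with L show ?thesis by blast
qed

section \<open>A central limit theorem for urns with diagonal drift\<close>

lemma sum_inverse_sqrt_le: "(\<Sum>l<n. 1 / sqrt (real (Suc l))) \<le> 2 * sqrt (real n)"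
proof (induction n)
  case (Suc n)
  have "1 / sqrt (real (Suc n)) \<le> 2 * (sqrt (real (Suc n)) - sqrt (real n))"
  proof -
    define x y where "x = sqrt (real (Suc n))" and "y = sqrt (real n)"
    have "x * x - y * y = 1" "y \<le> x" "0 < x"
      by (auto simp: x_def y_def)
    moreover have "(x - y) * (x + y) \<le> (x - y) * (2 * x)"
      using calculation by (intro mult_left_mono) auto
    ultimately have "1 \<le> 2 * (x - y) * x"
      by (simp add: algebra_simps)
    then show ?thesis
      using \<open>0 < x\<close> unfolding x_def[symmetric] y_def[symmetric] by (simp add: field_simps)
  qed
  with Suc show ?case
    by simp
qed simp

lemma abs_exp_minus_le:
  fixes x :: real
  assumes "0 \<le> x"
  shows "\<bar>exp (- x) - (1 - x)\<bar> \<le> x\<^sup>2 / 2"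
proof -
  have "1 - x \<le> exp (- x)"
    using exp_ge_add_one_self[of "-x"] by simp
  moreover have "exp (- x) \<le> 1 - x + x\<^sup>2 / 2"
  proof -
    have "(\<lambda>t. 1 - t + t\<^sup>2 / 2 - exp (- t)) 0 \<le> (\<lambda>t. 1 - t + t\<^sup>2 / 2 - exp (- t)) x"
    proof (rule DERIV_nonneg_imp_nondecreasing[OF assms])
      fix t :: real
      show "\<exists>y. ((\<lambda>t. 1 - t + t\<^sup>2 / 2 - exp (- t)) has_real_derivative y) (at t) \<and> 0 \<le> y"
        by (rule exI[of _ "-1 + t + exp (- t)"], rule conjI, auto intro!: derivative_eq_intros)
           (use exp_ge_add_one_self[of "-t"] in simp)
    qed
    then show ?thesis by simp
  qed
  ultimately show ?thesis by simp
qed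

text \<open>With \<open>\<theta> = g / (\<alpha> + r1 + r2)\<close> the sequence \<open>T n * \<theta>\<close> solves the recursion up to an error
  \<open>r1 * r2 * \<theta> / T n\<close>. The factors of the recursion are at most 1, so these errors only add up, to
  \<open>O(sqrt n)\<close> at most.\<close>

lemma recursion_div_n_tendsto:
  fixes s a T :: "nat \<Rightarrow> real" and r1 r2 \<alpha> T0 g :: real
  assumes "0 < \<alpha>" "0 < T0" "0 \<le> r1" "0 \<le> r2"
    and T: "\<And>n. T n = T0 + \<alpha> * real n" and r: "\<And>n. r1 \<le> T n" "\<And>n. r2 \<le> T n"
    and s0: "s 0 = 0"
    and s: "\<And>n. s (Suc n) = (1 - r1 / T n) * (1 - r2 / T n) * s n + g"
  shows "(\<lambda>n. s n / real n) \<longlonglongrightarrow> \<alpha> * g / (\<alpha> + r1 + r2)"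
proof -
  define \<theta> where "\<theta> = g / (\<alpha> + r1 + r2)"
  define \<delta> where "\<delta> n = s n - T n * \<theta>" for n
  have Tpos: "0 < T n" for n
    using assms(1,2) by (simp add: T add_pos_nonneg)
  define c where "c = min T0 \<alpha>"
  have cpos: "0 < c" using assms by (simp add: c_def)
  have Tc: "c * real (Suc n) \<le> T n" for n
  proof -
    have "c * real n \<le> \<alpha> * real n" "c \<le> T0" by (auto simp: c_def intro: mult_right_mono)
    then show ?thesis by (simp add: T algebra_simps)
  qed
  define B where "B = \<bar>r1 * r2 * \<theta>\<bar> / c"
  have step: "\<bar>\<delta> (Suc n)\<bar> \<le> \<bar>\<delta> n\<bar> + B * (1 / sqrt (real (Suc n)))" for n
  proof -
    have g: "g = \<theta> * (\<alpha> + r1 + r2)" using assms by (simp add: \<theta>_def)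
    have "\<delta> (Suc n) = (1 - r1 / T n) * (1 - r2 / T n) * \<delta> n + r1 * r2 * \<theta> / T n"
    proof -
      have TS: "T (Suc n) = T n + \<alpha>" by (simp add: T algebra_simps)
      show ?thesis
        unfolding \<delta>_def s g TS using Tpos[of n] by (simp add: field_simps power2_eq_square)
    qed
    then have "\<bar>\<delta> (Suc n)\<bar> \<le> \<bar>(1 - r1 / T n) * (1 - r2 / T n)\<bar> * \<bar>\<delta> n\<bar> + \<bar>r1 * r2 * \<theta>\<bar> / T n"
      using Tpos[of n] by (metis abs_divide abs_mult abs_of_pos abs_triangle_ineq)
    moreover have "\<bar>(1 - r1 / T n) * (1 - r2 / T n)\<bar> \<le> 1"
      unfolding abs_mult using Tpos[of n] r[of n] assms by (intro mult_le_one) auto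
    then have "\<bar>(1 - r1 / T n) * (1 - r2 / T n)\<bar> * \<bar>\<delta> n\<bar> \<le> \<bar>\<delta> n\<bar>"
      by (simp add: mult_left_le_one_le)
    moreover have "\<bar>r1 * r2 * \<theta>\<bar> / T n \<le> B * (1 / sqrt (real (Suc n)))"
    proof -
      have "sqrt (real (Suc n)) \<le> real (Suc n)"
        using real_sqrt_le_mono[of "real (Suc n)" "(real (Suc n))\<^sup>2"] by (simp add: power2_eq_square)
      then have "c * sqrt (real (Suc n)) \<le> T n"
        using Tc[of n] cpos by (meson mult_left_mono order.strict_implies_order order_trans)
      then have "\<bar>r1 * r2 * \<theta>\<bar> / T n \<le> \<bar>r1 * r2 * \<theta>\<bar> / (c * sqrt (real (Suc n)))"
        using cpos by (intro divide_left_mono) (auto simp: Tpos)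
      then show ?thesis by (simp add: B_def)
    qed
    ultimately show ?thesis by linarith
  qed
  have "\<bar>\<delta> n\<bar> \<le> \<bar>\<delta> 0\<bar> + B * (\<Sum>l<n. 1 / sqrt (real (Suc l)))" for n
  proof (induction n)
    case (Suc n)
    then show ?case using step[of n] by (simp add: algebra_simps)
  qed simp
  moreover have "0 \<le> B" using cpos by (simp add: B_def)
  ultimately have bd: "\<bar>\<delta> n\<bar> \<le> \<bar>\<delta> 0\<bar> + B * (2 * sqrt (real n))" for n
    by (rule order_trans[OF _ add_left_mono[OF mult_left_mono[OF sum_inverse_sqrt_le]]])
  have "(\<lambda>n. (\<bar>\<delta> 0\<bar> + B * (2 * sqrt (real n))) / real n) \<longlonglongrightarrow> 0"
    by real_asymp
  then have "(\<lambda>n. \<delta> n / real n) \<longlonglongrightarrow> 0"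
    by (rule Lim_null_comparison[rotated]) (auto intro!: always_eventually divide_right_mono bd)
  moreover have "(\<lambda>n. T n * \<theta> / real n) \<longlonglongrightarrow> \<alpha> * \<theta>"
    unfolding T by real_asymp
  ultimately have "(\<lambda>n. \<delta> n / real n + T n * \<theta> / real n) \<longlonglongrightarrow> 0 + \<alpha> * \<theta>"
    by (rule tendsto_add)
  moreover have "\<delta> n / real n + T n * \<theta> / real n = s n / real n" for n
    by (simp add: \<delta>_def diff_divide_distrib)
  ultimately show ?thesis
    by (simp add: \<theta>_def)
qed

text \<open>A Markov chain with states \<open>x\<close>, whose step is selected by a random choice \<open>e\<close> with law \<open>R n x\<close>.
  The choice matters for the observables \<open>X\<close> only through its colour, which has finitely many values
  and shifts \<open>X\<close> by a fixed vector \<open>J\<close>. The observables are chosen so that their mean drift is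
  diagonal, \<open>E[X (n + 1) | x] = (1 - r / T n) * X n\<close>, and the conditional law of the colour differs
  from the limit law \<open>\<pi>\<close> by at most a multiple of \<open>|X| / T n\<close>. Since \<open>T n\<close> grows linearly and \<open>r\<close> is
  nonnegative, past fluctuations are damped and each step adds a nearly independent increment.\<close>

locale linear_urn =
  fixes p :: "nat \<Rightarrow> 's pmf" and R :: "nat \<Rightarrow> 's \<Rightarrow> 'e pmf" and nxt :: "nat \<Rightarrow> 's \<Rightarrow> 'e \<Rightarrow> 's"
    and col :: "'s \<Rightarrow> 'e \<Rightarrow> 'k" and K :: "'k set" and I :: "'i set"
    and X :: "nat \<Rightarrow> 's \<Rightarrow> 'i \<Rightarrow> real" and J :: "'k \<Rightarrow> 'i \<Rightarrow> real"
    and r :: "'i \<Rightarrow> real" and \<pi> :: "'k \<Rightarrow> real" and \<alpha> T0 C :: real and T :: "nat \<Rightarrow> real"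
  assumes finite_I: "finite I" and finite_K: "finite K"
    and finite_p: "finite (set_pmf (p n))"
    and finite_R: "x \<in> set_pmf (p n) \<Longrightarrow> finite (set_pmf (R n x))"
    and p_Suc: "p (Suc n) = bind_pmf (p n) (\<lambda>x. map_pmf (nxt n x) (R n x))"
    and col_in: "x \<in> set_pmf (p n) \<Longrightarrow> e \<in> set_pmf (R n x) \<Longrightarrow> col x e \<in> K"
    and jump: "x \<in> set_pmf (p n) \<Longrightarrow> e \<in> set_pmf (R n x) \<Longrightarrow> i \<in> I \<Longrightarrow>
                 X (Suc n) (nxt n x e) i = X n x i + J (col x e) i"
    and drift: "x \<in> set_pmf (p n) \<Longrightarrow> i \<in> I \<Longrightarrow>
                 (\<Sum>\<kappa>\<in>K. pmf (map_pmf (col x) (R n x)) \<kappa> * J \<kappa> i) = - (r i / T n) * X n x i"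
    and near: "x \<in> set_pmf (p n) \<Longrightarrow> \<kappa> \<in> K \<Longrightarrow>
                 \<bar>pmf (map_pmf (col x) (R n x)) \<kappa> - \<pi> \<kappa>\<bar> \<le> C / T n * (\<Sum>i\<in>I. \<bar>X n x i\<bar>)"
    and T: "T n = T0 + \<alpha> * real n" and T0_pos: "0 < T0" and \<alpha>_pos: "0 < \<alpha>"
    and r_nonneg: "i \<in> I \<Longrightarrow> 0 \<le> r i" and r_le: "i \<in> I \<Longrightarrow> r i \<le> T n"
    and \<pi>_nonneg: "\<kappa> \<in> K \<Longrightarrow> 0 \<le> \<pi> \<kappa>" and C_nonneg: "0 \<le> C"
begin

abbreviation q :: "nat \<Rightarrow> 's \<Rightarrow> 'k \<Rightarrow> real" where
  "q n x \<kappa> \<equiv> pmf (map_pmf (col x) (R n x)) \<kappa>"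

definition lin :: "('i \<Rightarrow> real) \<Rightarrow> ('i \<Rightarrow> real) \<Rightarrow> real" where
  "lin w y = (\<Sum>i\<in>I. w i * y i)"

lemma T_ge: "min T0 \<alpha> * real (Suc n) \<le> T n"
proof -
  have "min T0 \<alpha> * real n \<le> \<alpha> * real n" "min T0 \<alpha> \<le> T0"
    by (auto intro: mult_right_mono)
  then show ?thesis by (simp add: T algebra_simps)
qed

lemma T_pos: "0 < T n"
  using T0_pos \<alpha>_pos by (simp add: T add_pos_nonneg)

lemma sum_q: "x \<in> set_pmf (p n) \<Longrightarrow> (\<Sum>\<kappa>\<in>K. q n x \<kappa>) = 1"
  using col_in by (intro sum_pmf_eq_1 finite_K) auto

lemma expectation_Suc:
  fixes g :: "real \<Rightarrow> 'b::{banach, second_countable_topology}"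
  shows "measure_pmf.expectation (p (Suc n)) (\<lambda>x. g (lin w (X (Suc n) x))) =
         measure_pmf.expectation (p n) (\<lambda>x. \<Sum>\<kappa>\<in>K. q n x \<kappa> *\<^sub>R g (lin w (X n x) + lin w (J \<kappa>)))"
proof -
  have inner: "measure_pmf.expectation (map_pmf (nxt n x) (R n x)) (\<lambda>x. g (lin w (X (Suc n) x))) =
        (\<Sum>\<kappa>\<in>K. q n x \<kappa> *\<^sub>R g (lin w (X n x) + lin w (J \<kappa>)))" if x: "x \<in> set_pmf (p n)" for x
  proof -
    have "measure_pmf.expectation (map_pmf (nxt n x) (R n x)) (\<lambda>x. g (lin w (X (Suc n) x))) =
          measure_pmf.expectation (R n x) (\<lambda>e. g (lin w (X n x) + lin w (J (col x e))))"
      unfolding integral_map_pmf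
      using x by (intro integral_cong_AE)
        (auto simp: AE_measure_pmf_iff lin_def jump algebra_simps sum.distrib)
    also have "\<dots> = measure_pmf.expectation (map_pmf (col x) (R n x))
                     (\<lambda>\<kappa>. g (lin w (X n x) + lin w (J \<kappa>)))"
      by simp
    also have "\<dots> = (\<Sum>\<kappa>\<in>K. q n x \<kappa> *\<^sub>R g (lin w (X n x) + lin w (J \<kappa>)))"
      using x col_in by (intro integral_measure_pmf finite_K) auto
    finally show ?thesis .
  qed
  have "measure_pmf.expectation (p (Suc n)) (\<lambda>x. g (lin w (X (Suc n) x))) =
        (\<Sum>x\<in>set_pmf (p n). pmf (p n) x *\<^sub>R
           measure_pmf.expectation (map_pmf (nxt n x) (R n x)) (\<lambda>x. g (lin w (X (Suc n) x))))"
    unfolding p_Suc by (intro pmf_expectation_bind finite_p) (auto simp: finite_R)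
  also have "\<dots> = (\<Sum>x\<in>set_pmf (p n). pmf (p n) x *\<^sub>R
           (\<Sum>\<kappa>\<in>K. q n x \<kappa> *\<^sub>R g (lin w (X n x) + lin w (J \<kappa>))))"
    by (intro sum.cong refl) (simp add: inner del: integral_map_pmf)
  also have "\<dots> = measure_pmf.expectation (p n)
                     (\<lambda>x. \<Sum>\<kappa>\<in>K. q n x \<kappa> *\<^sub>R g (lin w (X n x) + lin w (J \<kappa>)))"
    by (intro integral_measure_pmf[symmetric] finite_p) auto
  finally show ?thesis .
qed

lemma integrable_p [simp]:
  fixes f :: "'s \<Rightarrow> 'b::{banach, second_countable_topology}"
  shows "integrable (measure_pmf (p n)) f"
  by (rule integrable_measure_pmf_finite[OF finite_p])

definition Jbound :: real where
  "Jbound = (\<Sum>\<kappa>\<in>K. \<Sum>i\<in>I. \<bar>J \<kappa> i\<bar>)"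

lemma Jbound_nonneg: "0 \<le> Jbound"
  by (simp add: Jbound_def sum_nonneg)

lemma lin_J_le:
  assumes "\<kappa> \<in> K" "\<And>i. i \<in> I \<Longrightarrow> \<bar>w i\<bar> \<le> \<rho>" "0 \<le> \<rho>"
  shows "\<bar>lin w (J \<kappa>)\<bar> \<le> \<rho> * Jbound"
proof -
  have "\<bar>lin w (J \<kappa>)\<bar> \<le> (\<Sum>i\<in>I. \<bar>w i\<bar> * \<bar>J \<kappa> i\<bar>)"
    unfolding lin_def by (rule order_trans[OF sum_abs]) (simp add: abs_mult)
  also have "\<dots> \<le> \<rho> * (\<Sum>i\<in>I. \<bar>J \<kappa> i\<bar>)"
    unfolding sum_distrib_left using assms by (intro sum_mono mult_right_mono) auto
  also have "(\<Sum>i\<in>I. \<bar>J \<kappa> i\<bar>) \<le> Jbound"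
    unfolding Jbound_def using assms(1) finite_K
    by (intro member_le_sum[of \<kappa> K "\<lambda>\<kappa>. \<Sum>i\<in>I. \<bar>J \<kappa> i\<bar>"]) (auto intro: sum_nonneg)
  finally show ?thesis
    using assms(3) by (meson mult_left_mono order_trans)
qed

text \<open>The cross term \<open>2 * X * E[\<Delta>X]\<close> is nonpositive because the drift points towards the origin, so the
  second moment grows by a bounded amount per step.\<close>

lemma second_moment_le:
  obtains B where "0 \<le> B" "\<And>n i. i \<in> I \<Longrightarrow>
    measure_pmf.expectation (p n) (\<lambda>x. (X n x i)\<^sup>2) \<le> B * real (Suc n)"
proof -
  define B0 where "B0 = (\<Sum>i\<in>I. measure_pmf.expectation (p 0) (\<lambda>x. (X 0 x i)\<^sup>2))"
  have B0: "0 \<le> B0" by (simp add: B0_def sum_nonneg)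
  have bd: "measure_pmf.expectation (p n) (\<lambda>x. (X n x i)\<^sup>2) \<le> B0 + Jbound\<^sup>2 * real n"
    if i: "i \<in> I" for n i
  proof (induction n)
    case 0
    show ?case unfolding B0_def using i finite_I
      by (auto intro!: member_le_sum)
  next
    case (Suc n)
    define w where "w = (\<lambda>j. if j = i then 1 else 0 :: real)"
    have lin: "lin w y = y i" for y
      using i finite_I by (simp add: lin_def w_def if_distrib[of "\<lambda>u. u * _"] cong: if_cong)
    have Ji: "\<bar>J \<kappa> i\<bar> \<le> Jbound" if "\<kappa> \<in> K" for \<kappa>
      using lin_J_le[OF that, of w 1] lin by (simp add: w_def)
    have "measure_pmf.expectation (p (Suc n)) (\<lambda>x. (X (Suc n) x i)\<^sup>2) =
          measure_pmf.expectation (p n) (\<lambda>x. \<Sum>\<kappa>\<in>K. q n x \<kappa> * (X n x i + J \<kappa> i)\<^sup>2)"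
      using expectation_Suc[of n "\<lambda>t. t\<^sup>2" w] by (simp add: lin)
    also have "\<dots> \<le> measure_pmf.expectation (p n) (\<lambda>x. (X n x i)\<^sup>2 + Jbound\<^sup>2)"
    proof (intro integral_mono_AE)
      show "AE x in measure_pmf (p n). (\<Sum>\<kappa>\<in>K. q n x \<kappa> * (X n x i + J \<kappa> i)\<^sup>2) \<le> (X n x i)\<^sup>2 + Jbound\<^sup>2"
        unfolding AE_measure_pmf_iff
      proof
        fix x assume x: "x \<in> set_pmf (p n)"
        have "(\<Sum>\<kappa>\<in>K. q n x \<kappa> * (X n x i + J \<kappa> i)\<^sup>2) =
              (X n x i)\<^sup>2 * (\<Sum>\<kappa>\<in>K. q n x \<kappa>) + 2 * X n x i * (\<Sum>\<kappa>\<in>K. q n x \<kappa> * J \<kappa> i)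
               + (\<Sum>\<kappa>\<in>K. q n x \<kappa> * (J \<kappa> i)\<^sup>2)"
          by (simp add: sum_distrib_left power2_eq_square algebra_simps sum.distrib)
        also have "\<dots> = (X n x i)\<^sup>2 - 2 * (r i / T n) * (X n x i)\<^sup>2 + (\<Sum>\<kappa>\<in>K. q n x \<kappa> * (J \<kappa> i)\<^sup>2)"
          by (simp add: sum_q[OF x] drift[OF x i] power2_eq_square)
        also have "\<dots> \<le> (X n x i)\<^sup>2 + (\<Sum>\<kappa>\<in>K. q n x \<kappa> * (J \<kappa> i)\<^sup>2)"
          using r_nonneg[OF i] T_pos[of n] by simp
        also have "(\<Sum>\<kappa>\<in>K. q n x \<kappa> * (J \<kappa> i)\<^sup>2) \<le> (\<Sum>\<kappa>\<in>K. q n x \<kappa> * Jbound\<^sup>2)"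
          using Ji Jbound_nonneg by (intro sum_mono mult_left_mono) (auto simp: abs_le_square_iff[symmetric])
        also have "\<dots> = Jbound\<^sup>2"
          by (simp add: sum_distrib_right[symmetric] sum_q[OF x])
        finally show "(\<Sum>\<kappa>\<in>K. q n x \<kappa> * (X n x i + J \<kappa> i)\<^sup>2) \<le> (X n x i)\<^sup>2 + Jbound\<^sup>2"
          by simp
      qed
    qed auto
    also have "\<dots> = measure_pmf.expectation (p n) (\<lambda>x. (X n x i)\<^sup>2) + Jbound\<^sup>2"
      by simp
    finally show ?case
      using Suc by (simp add: algebra_simps)
  qed
  show thesis
  proof (rule that[of "B0 + Jbound\<^sup>2"])
    fix n i assume "i \<in> I"
    then show "measure_pmf.expectation (p n) (\<lambda>x. (X n x i)\<^sup>2) \<le> (B0 + Jbound\<^sup>2) * real (Suc n)"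
      using bd[of i n] B0 by (simp add: algebra_simps) (smt (verit) mult_nonneg_nonneg of_nat_0_le_iff zero_le_power2)
  qed (use B0 in auto)
qed

definition height :: "nat \<Rightarrow> 's \<Rightarrow> real" where
  "height n x = (\<Sum>i\<in>I. \<bar>X n x i\<bar>)"

lemma height_nonneg: "0 \<le> height n x"
  by (simp add: height_def sum_nonneg)

lemma expectation_height_le:
  obtains B where "0 \<le> B"
    "\<And>n. measure_pmf.expectation (p n) (height n) \<le> B * sqrt (real (Suc n))"
proof -
  obtain B where B: "0 \<le> B" "\<And>n i. i \<in> I \<Longrightarrow>
    measure_pmf.expectation (p n) (\<lambda>x. (X n x i)\<^sup>2) \<le> B * real (Suc n)"
    using second_moment_le by blast
  have *: "measure_pmf.expectation (p n) (\<lambda>x. \<bar>X n x i\<bar>) \<le> (B + 1) * sqrt (real (Suc n))"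
    if i: "i \<in> I" for n i
  proof -
    define s where "s = sqrt (real (Suc n))"
    have s: "0 < s" "s\<^sup>2 = real (Suc n)" by (auto simp: s_def)
    have "\<bar>X n x i\<bar> \<le> (X n x i)\<^sup>2 / s + s" for x
    proof -
      have "0 \<le> (\<bar>X n x i\<bar> - s)\<^sup>2" by simp
      then have "2 * \<bar>X n x i\<bar> * s \<le> (X n x i)\<^sup>2 + s\<^sup>2"
        by (simp add: power2_diff)
      moreover have "0 \<le> \<bar>X n x i\<bar> * s" using s by simp
      ultimately have "\<bar>X n x i\<bar> * s \<le> (X n x i)\<^sup>2 + s\<^sup>2"
        by linarith
      then have "\<bar>X n x i\<bar> \<le> ((X n x i)\<^sup>2 + s\<^sup>2) / s"
        using s by (simp add: pos_le_divide_eq)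
      then show ?thesis using s by (simp add: add_divide_distrib power2_eq_square)
    qed
    then have "measure_pmf.expectation (p n) (\<lambda>x. \<bar>X n x i\<bar>) \<le>
          measure_pmf.expectation (p n) (\<lambda>x. (X n x i)\<^sup>2 / s + s)"
      by (intro integral_mono) auto
    also have "\<dots> = measure_pmf.expectation (p n) (\<lambda>x. (X n x i)\<^sup>2) / s + s"
      by simp
    also have "\<dots> \<le> B * s\<^sup>2 / s + s"
      using B(2)[OF i, of n] s by (simp add: divide_right_mono)
    finally show ?thesis
      using s unfolding s_def[symmetric] by (simp add: power2_eq_square algebra_simps)
  qed
  show thesis
  proof (rule that[of "real (card I) * (B + 1)"])
    fix n
    have "measure_pmf.expectation (p n) (height n) =
        (\<Sum>i\<in>I. measure_pmf.expectation (p n) (\<lambda>x. \<bar>X n x i\<bar>))"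
      unfolding height_def by (rule Bochner_Integration.integral_sum) simp
    also have "\<dots> \<le> (\<Sum>i\<in>I. (B + 1) * sqrt (real (Suc n)))"
      by (intro sum_mono *)
    finally show "measure_pmf.expectation (p n) (height n) \<le> real (card I) * (B + 1) * sqrt (real (Suc n))"
      by simp
  qed (use B in auto)
qed

definition var :: "('i \<Rightarrow> real) \<Rightarrow> real" where
  "var w = (\<Sum>\<kappa>\<in>K. \<pi> \<kappa> * (lin w (J \<kappa>))\<^sup>2)"

text \<open>The linear functional whose value at time \<open>n\<close> is the conditional mean of the value of \<open>w\<close> at time
  \<open>Suc n\<close>.\<close>

definition damp :: "nat \<Rightarrow> ('i \<Rightarrow> real) \<Rightarrow> 'i \<Rightarrow> real" where
  "damp n w i = (1 - r i / T n) * w i"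

definition charf :: "nat \<Rightarrow> ('i \<Rightarrow> real) \<Rightarrow> complex" where
  "charf n w = measure_pmf.expectation (p n) (\<lambda>x. iexp (lin w (X n x)))"

lemma var_nonneg: "0 \<le> var w"
  by (auto simp: var_def intro!: sum_nonneg mult_nonneg_nonneg \<pi>_nonneg)

text \<open>Conditionally on the state, the increment of the functional \<open>w\<close> minus its mean is a centred variable
  of size \<open>O(\<rho>)\<close>. Its characteristic function is \<open>1 - V / 2\<close> up to \<open>O(\<rho>\<^sup>3)\<close>, where the conditional
  variance \<open>V\<close> differs from \<open>var w\<close> by \<open>O(\<rho>\<^sup>2)\<close> times the distance of the colour law from its limit.\<close>

lemma one_step_pointwise:
  assumes x: "x \<in> set_pmf (p n)" and w: "\<And>i. i \<in> I \<Longrightarrow> \<bar>w i\<bar> \<le> \<rho>" and \<rho>: "0 \<le> \<rho>" "\<rho> \<le> 1"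
  shows "cmod ((\<Sum>\<kappa>\<in>K. q n x \<kappa> *\<^sub>R iexp (lin w (X n x) + lin w (J \<kappa>)))
           - exp (- var w / 2) *\<^sub>R iexp (lin (damp n w) (X n x)))
         \<le> ((2 * Jbound) ^ 3 / 6 + (Jbound\<^sup>2 * (\<Sum>\<kappa>\<in>K. \<pi> \<kappa>))\<^sup>2 / 8) * \<rho> ^ 3
            + (Jbound\<^sup>2 * (C * real (card K)) + Jbound * (\<Sum>i\<in>I. r i)) / 2 * (\<rho>\<^sup>2 * (height n x / T n))"
proof -
  define b where "b = Jbound"
  define h where "h = height n x / T n"
  have b: "0 \<le> b" by (simp add: b_def Jbound_nonneg)
  have h: "0 \<le> h" using T_pos[of n] by (simp add: h_def height_nonneg)
  have q0: "0 \<le> q n x \<kappa>" for \<kappa> by simp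
  have wJ: "\<bar>lin w (J \<kappa>)\<bar> \<le> \<rho> * b" if "\<kappa> \<in> K" for \<kappa>
    unfolding b_def using that w \<rho>(1) by (rule lin_J_le)
  define \<theta> where "\<theta> = (\<Sum>i\<in>I. w i * (r i / T n * X n x i))"
  have \<theta>: "\<theta> = - (\<Sum>\<kappa>\<in>K. q n x \<kappa> * lin w (J \<kappa>))"
  proof -
    have "(\<Sum>\<kappa>\<in>K. q n x \<kappa> * lin w (J \<kappa>)) = (\<Sum>i\<in>I. w i * (\<Sum>\<kappa>\<in>K. q n x \<kappa> * J \<kappa> i))"
      unfolding lin_def sum_distrib_left by (subst sum.swap) (simp add: mult_ac)
    also have "\<dots> = - \<theta>"
      by (simp add: drift[OF x] \<theta>_def sum_negf)
    finally show ?thesis by simp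
  qed
  have damp: "lin (damp n w) (X n x) = lin w (X n x) - \<theta>"
    by (simp add: lin_def damp_def \<theta>_def algebra_simps sum_subtractf)
  \<comment> \<open>two bounds on the mean increment: the first keeps the centred increment of order \<open>\<rho>\<close>, the
    second makes its square negligible\<close>
  have \<theta>1: "\<bar>\<theta>\<bar> \<le> \<rho> * b"
  proof -
    have "\<bar>\<theta>\<bar> \<le> (\<Sum>\<kappa>\<in>K. \<bar>q n x \<kappa> * lin w (J \<kappa>)\<bar>)"
      unfolding \<theta> abs_minus_cancel by (rule sum_abs)
    also have "\<dots> \<le> (\<Sum>\<kappa>\<in>K. q n x \<kappa> * (\<rho> * b))"
      unfolding abs_mult by (intro sum_mono mult_mono wJ) auto
    also have "\<dots> = \<rho> * b"
      by (simp add: sum_distrib_right[symmetric] sum_q[OF x])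
    finally show ?thesis .
  qed
  have \<theta>2: "\<bar>\<theta>\<bar> \<le> \<rho> * (\<Sum>i\<in>I. r i) * h"
  proof -
    have "\<bar>\<theta>\<bar> \<le> (\<Sum>i\<in>I. \<bar>w i * (r i / T n * X n x i)\<bar>)"
      unfolding \<theta>_def by (rule sum_abs)
    also have "\<dots> \<le> (\<Sum>i\<in>I. \<rho> * (r i * h))"
    proof (intro sum_mono)
      fix i assume i: "i \<in> I"
      have "\<bar>X n x i\<bar> \<le> height n x"
        unfolding height_def using i finite_I by (intro member_le_sum) auto
      then have "\<bar>r i / T n * X n x i\<bar> \<le> r i * h"
        using r_nonneg[OF i] T_pos[of n]
        by (simp add: h_def abs_mult divide_right_mono mult_left_mono)
      then show "\<bar>w i * (r i / T n * X n x i)\<bar> \<le> \<rho> * (r i * h)"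
        unfolding abs_mult[of "w i"] using w[OF i] \<rho> by (intro mult_mono) auto
    qed
    finally show ?thesis
      by (simp add: sum_distrib_left sum_distrib_right mult_ac)
  qed
  define \<xi> where "\<xi> \<kappa> = lin w (J \<kappa>) + \<theta>" for \<kappa>
  have \<xi>: "\<bar>\<xi> \<kappa>\<bar> \<le> 2 * (\<rho> * b)" if "\<kappa> \<in> K" for \<kappa>
    unfolding \<xi>_def using wJ[OF that] \<theta>1 by linarith
  define V where "V = (\<Sum>\<kappa>\<in>K. q n x \<kappa> * (\<xi> \<kappa>)\<^sup>2)"
  \<comment> \<open>the first-order term vanishes because the increment is centred\<close>
  have taylor: "cmod ((\<Sum>\<kappa>\<in>K. q n x \<kappa> *\<^sub>R iexp (\<xi> \<kappa>)) - (1 - V / 2)) \<le> (2 * (\<rho> * b)) ^ 3 / 6"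
  proof -
    have mean: "(\<Sum>\<kappa>\<in>K. q n x \<kappa> * \<xi> \<kappa>) = 0"
    proof -
      have "(\<Sum>\<kappa>\<in>K. q n x \<kappa> * \<xi> \<kappa>) = (\<Sum>\<kappa>\<in>K. q n x \<kappa> * lin w (J \<kappa>)) + \<theta> * (\<Sum>\<kappa>\<in>K. q n x \<kappa>)"
        by (simp add: \<xi>_def algebra_simps sum.distrib sum_distrib_left)
      then show ?thesis
        using \<theta> sum_q[OF x] by simp
    qed
    have "(\<Sum>\<kappa>\<in>K. q n x \<kappa> *\<^sub>R (1 + \<i> * \<xi> \<kappa> - (\<xi> \<kappa>)\<^sup>2 / 2)) =
          of_real (\<Sum>\<kappa>\<in>K. q n x \<kappa>) + \<i> * of_real (\<Sum>\<kappa>\<in>K. q n x \<kappa> * \<xi> \<kappa>) - of_real V / 2"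
      by (simp add: V_def scaleR_conv_of_real algebra_simps sum.distrib sum_subtractf
          sum_distrib_left sum_divide_distrib)
    also have "\<dots> = 1 - V / 2"
      by (simp only: mean sum_q[OF x]) simp
    finally have "(\<Sum>\<kappa>\<in>K. q n x \<kappa> *\<^sub>R iexp (\<xi> \<kappa>)) - (1 - V / 2) =
          (\<Sum>\<kappa>\<in>K. q n x \<kappa> *\<^sub>R (iexp (\<xi> \<kappa>) - (1 + \<i> * \<xi> \<kappa> - (\<xi> \<kappa>)\<^sup>2 / 2)))"
      by (simp add: scaleR_diff_right sum_subtractf)
    also have "cmod \<dots> \<le> (\<Sum>\<kappa>\<in>K. q n x \<kappa> * ((2 * (\<rho> * b)) ^ 3 / 6))"
    proof (intro order_trans[OF norm_sum] sum_mono)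
      fix \<kappa> assume \<kappa>: "\<kappa> \<in> K"
      have "cmod (iexp (\<xi> \<kappa>) - (1 + \<i> * \<xi> \<kappa> - (\<xi> \<kappa>)\<^sup>2 / 2)) \<le> \<bar>\<xi> \<kappa>\<bar> ^ 3 / 6"
        using iexp_approx1[of "\<xi> \<kappa>" 2]
        by (simp add: numeral_eq_Suc power2_eq_square algebra_simps)
      also have "\<dots> \<le> (2 * (\<rho> * b)) ^ 3 / 6"
        using \<xi>[OF \<kappa>] by (intro divide_right_mono power_mono) auto
      finally show "cmod (q n x \<kappa> *\<^sub>R (iexp (\<xi> \<kappa>) - (1 + \<i> * \<xi> \<kappa> - (\<xi> \<kappa>)\<^sup>2 / 2)))
            \<le> q n x \<kappa> * ((2 * (\<rho> * b)) ^ 3 / 6)"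
        unfolding norm_scaleR abs_of_nonneg[OF q0] by (rule mult_left_mono[OF _ q0])
    qed
    finally show ?thesis
      by (simp add: sum_divide_distrib[symmetric] sum_distrib_right[symmetric] sum_q[OF x])
  qed
  have V: "\<bar>V - var w\<bar> \<le> (b\<^sup>2 * (C * real (card K)) + b * (\<Sum>i\<in>I. r i)) * (\<rho>\<^sup>2 * h)"
  proof -
    have "V = (\<Sum>\<kappa>\<in>K. q n x \<kappa> * (lin w (J \<kappa>))\<^sup>2) + 2 * \<theta> * (\<Sum>\<kappa>\<in>K. q n x \<kappa> * lin w (J \<kappa>))
            + \<theta>\<^sup>2 * (\<Sum>\<kappa>\<in>K. q n x \<kappa>)"
      unfolding V_def \<xi>_def sum_distrib_left
      by (simp add: power2_eq_square algebra_simps sum.distrib)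
    also have "\<dots> = (\<Sum>\<kappa>\<in>K. q n x \<kappa> * (lin w (J \<kappa>))\<^sup>2) - \<theta>\<^sup>2"
      using \<theta> by (simp add: sum_q[OF x] power2_eq_square)
    finally have "V - var w = (\<Sum>\<kappa>\<in>K. (q n x \<kappa> - \<pi> \<kappa>) * (lin w (J \<kappa>))\<^sup>2) - \<theta>\<^sup>2"
      by (simp add: var_def sum_subtractf left_diff_distrib)
    then have "\<bar>V - var w\<bar> \<le> (\<Sum>\<kappa>\<in>K. \<bar>(q n x \<kappa> - \<pi> \<kappa>) * (lin w (J \<kappa>))\<^sup>2\<bar>) + \<bar>\<theta>\<bar> * \<bar>\<theta>\<bar>"
      using sum_abs[of "\<lambda>\<kappa>. (q n x \<kappa> - \<pi> \<kappa>) * (lin w (J \<kappa>))\<^sup>2" K] abs_mult_self_eq[of \<theta>] zero_le_square[of \<theta>]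
      unfolding power2_eq_square[of \<theta>] by linarith
    also have "\<dots> \<le> (\<Sum>\<kappa>\<in>K. (C * h) * (\<rho> * b)\<^sup>2) + (\<rho> * b) * (\<rho> * (\<Sum>i\<in>I. r i) * h)"
    proof (intro add_mono sum_mono mult_mono \<theta>1 \<theta>2)
      fix \<kappa> assume \<kappa>: "\<kappa> \<in> K"
      have "\<bar>q n x \<kappa> - \<pi> \<kappa>\<bar> \<le> C * h"
        using near[OF x \<kappa>] by (simp add: h_def height_def)
      moreover have "(lin w (J \<kappa>))\<^sup>2 \<le> (\<rho> * b)\<^sup>2"
        using power_mono[OF wJ[OF \<kappa>], of 2] by simp
      ultimately show "\<bar>(q n x \<kappa> - \<pi> \<kappa>) * (lin w (J \<kappa>))\<^sup>2\<bar> \<le> (C * h) * (\<rho> * b)\<^sup>2"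
        unfolding abs_mult using C_nonneg h by (intro mult_mono) auto
    qed (use \<rho> b in auto)
    also have "\<dots> = (b\<^sup>2 * (C * real (card K)) + b * (\<Sum>i\<in>I. r i)) * (\<rho>\<^sup>2 * h)"
      by (simp add: power2_eq_square algebra_simps)
    finally show ?thesis .
  qed
  have exp: "\<bar>exp (- var w / 2) - (1 - var w / 2)\<bar> \<le> (b\<^sup>2 * (\<Sum>\<kappa>\<in>K. \<pi> \<kappa>))\<^sup>2 / 8 * \<rho> ^ 3"
  proof -
    have "var w \<le> (\<Sum>\<kappa>\<in>K. \<pi> \<kappa> * (\<rho> * b)\<^sup>2)"
      unfolding var_def
    proof (intro sum_mono mult_left_mono \<pi>_nonneg)
      fix \<kappa> assume "\<kappa> \<in> K"
      then show "(lin w (J \<kappa>))\<^sup>2 \<le> (\<rho> * b)\<^sup>2"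
        using power_mono[OF wJ, of \<kappa> 2] by simp
    qed
    also have "\<dots> = \<rho>\<^sup>2 * (b\<^sup>2 * (\<Sum>\<kappa>\<in>K. \<pi> \<kappa>))"
      by (simp add: sum_distrib_right[symmetric] power_mult_distrib)
    finally have v: "var w \<le> \<rho>\<^sup>2 * (b\<^sup>2 * (\<Sum>\<kappa>\<in>K. \<pi> \<kappa>))" .
    have "\<bar>exp (- var w / 2) - (1 - var w / 2)\<bar> \<le> (var w)\<^sup>2 / 8"
      using abs_exp_minus_le[of "var w / 2"] var_nonneg[of w] by (simp add: power_divide)
    also have "(var w)\<^sup>2 \<le> (\<rho>\<^sup>2 * (b\<^sup>2 * (\<Sum>\<kappa>\<in>K. \<pi> \<kappa>)))\<^sup>2"
      using v var_nonneg by (rule power_mono)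
    also have "\<dots> = \<rho> ^ 4 * (b\<^sup>2 * (\<Sum>\<kappa>\<in>K. \<pi> \<kappa>))\<^sup>2"
      by (simp add: power_mult_distrib)
    also have "\<dots> \<le> \<rho> ^ 3 * (b\<^sup>2 * (\<Sum>\<kappa>\<in>K. \<pi> \<kappa>))\<^sup>2"
      using \<rho> by (intro mult_right_mono power_decreasing) auto
    finally show ?thesis
      by (simp add: divide_right_mono mult.commute)
  qed
  have "(\<Sum>\<kappa>\<in>K. q n x \<kappa> *\<^sub>R iexp (lin w (X n x) + lin w (J \<kappa>))) - exp (- var w / 2) *\<^sub>R iexp (lin (damp n w) (X n x))
       = iexp (lin (damp n w) (X n x)) * ((\<Sum>\<kappa>\<in>K. q n x \<kappa> *\<^sub>R iexp (\<xi> \<kappa>)) - exp (- var w / 2))"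
  proof -
    have "iexp (lin w (X n x) + lin w (J \<kappa>)) = iexp (lin (damp n w) (X n x)) * iexp (\<xi> \<kappa>)" for \<kappa>
      by (simp add: damp \<xi>_def exp_add[symmetric] algebra_simps)
    then show ?thesis
      by (simp add: sum_distrib_left right_diff_distrib scaleR_conv_of_real mult_ac exp_of_real[symmetric])
  qed
  then have "cmod ((\<Sum>\<kappa>\<in>K. q n x \<kappa> *\<^sub>R iexp (lin w (X n x) + lin w (J \<kappa>))) - exp (- var w / 2) *\<^sub>R iexp (lin (damp n w) (X n x)))
       = cmod ((\<Sum>\<kappa>\<in>K. q n x \<kappa> *\<^sub>R iexp (\<xi> \<kappa>)) - of_real (exp (- var w / 2)))"
    by (simp add: norm_mult exp_of_real[symmetric])
  also have "\<dots> \<le> cmod ((\<Sum>\<kappa>\<in>K. q n x \<kappa> *\<^sub>R iexp (\<xi> \<kappa>)) - (1 - V / 2))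
       + \<bar>(1 - V / 2) - exp (- var w / 2)\<bar>"
  proof -
    have "cmod (of_real (1 - V / 2) - of_real (exp (- var w / 2))) = \<bar>(1 - V / 2) - exp (- var w / 2)\<bar>"
      unfolding of_real_diff[symmetric] by (rule norm_of_real)
    then show ?thesis
      using norm_triangle_ineq[of "(\<Sum>\<kappa>\<in>K. q n x \<kappa> *\<^sub>R iexp (\<xi> \<kappa>)) - of_real (1 - V / 2)"
          "of_real (1 - V / 2) - of_real (exp (- var w / 2))"]
      by simp
  qed
  also have "\<dots> \<le> (2 * (\<rho> * b)) ^ 3 / 6 + (\<bar>V - var w\<bar> / 2 + \<bar>exp (- var w / 2) - (1 - var w / 2)\<bar>)"
  proof (rule add_mono[OF taylor])
    have "\<bar>(var w - V) / 2 - (e - (1 - var w / 2))\<bar> \<le> \<bar>(var w - V) / 2\<bar> + \<bar>e - (1 - var w / 2)\<bar>" for e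
      by (rule abs_triangle_ineq4)
    moreover have "(var w - V) / 2 - (e - (1 - var w / 2)) = (1 - V / 2) - e" for e
      by (simp add: diff_divide_distrib)
    moreover have "\<bar>(var w - V) / 2\<bar> = \<bar>V - var w\<bar> / 2"
      by (simp add: abs_minus_commute)
    ultimately show "\<bar>(1 - V / 2) - exp (- var w / 2)\<bar> \<le> \<bar>V - var w\<bar> / 2 + \<bar>exp (- var w / 2) - (1 - var w / 2)\<bar>"
      by metis
  qed
  also have "\<dots> \<le> (2 * (\<rho> * b)) ^ 3 / 6 + ((b\<^sup>2 * (C * real (card K)) + b * (\<Sum>i\<in>I. r i)) * (\<rho>\<^sup>2 * h) / 2
        + (b\<^sup>2 * (\<Sum>\<kappa>\<in>K. \<pi> \<kappa>))\<^sup>2 / 8 * \<rho> ^ 3)"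
    using V exp by (intro add_left_mono add_mono divide_right_mono) auto
  finally show ?thesis
    by (simp add: b_def h_def power_mult_distrib algebra_simps)
qed

lemma one_step:
  obtains A where "0 \<le> A"
    "\<And>n w \<rho>. (\<And>i. i \<in> I \<Longrightarrow> \<bar>w i\<bar> \<le> \<rho>) \<Longrightarrow> 0 \<le> \<rho> \<Longrightarrow> \<rho> \<le> 1 \<Longrightarrow>
       cmod (charf (Suc n) w - exp (- var w / 2) *\<^sub>R charf n (damp n w))
         \<le> A * (\<rho> ^ 3 + \<rho>\<^sup>2 * (1 / sqrt (real (Suc n))))"
proof -
  obtain B where B: "0 \<le> B" "\<And>n. measure_pmf.expectation (p n) (height n) \<le> B * sqrt (real (Suc n))"
    by (rule expectation_height_le) (rule that)
  define A1 where "A1 = (2 * Jbound) ^ 3 / 6 + (Jbound\<^sup>2 * (\<Sum>\<kappa>\<in>K. \<pi> \<kappa>))\<^sup>2 / 8"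
  define A2 where "A2 = (Jbound\<^sup>2 * (C * real (card K)) + Jbound * (\<Sum>i\<in>I. r i)) / 2"
  define c where "c = min T0 \<alpha>"
  have A: "0 \<le> A1" "0 \<le> A2"
    unfolding A1_def A2_def using Jbound_nonneg C_nonneg r_nonneg by (auto intro!: add_nonneg_nonneg sum_nonneg mult_nonneg_nonneg)
  have c: "0 < c" using T0_pos \<alpha>_pos by (simp add: c_def)
  have main: "cmod (charf (Suc n) w - exp (- var w / 2) *\<^sub>R charf n (damp n w))
         \<le> (A1 + A2 * (B / c)) * (\<rho> ^ 3 + \<rho>\<^sup>2 * (1 / sqrt (real (Suc n))))"
    if w: "\<And>i. i \<in> I \<Longrightarrow> \<bar>w i\<bar> \<le> \<rho>" and \<rho>: "0 \<le> \<rho>" "\<rho> \<le> 1" for n w \<rho>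
  proof -
    let ?d = "\<lambda>x. (\<Sum>\<kappa>\<in>K. q n x \<kappa> *\<^sub>R iexp (lin w (X n x) + lin w (J \<kappa>)))
           - exp (- var w / 2) *\<^sub>R iexp (lin (damp n w) (X n x))"
    have eq: "charf (Suc n) w - exp (- var w / 2) *\<^sub>R charf n (damp n w) = measure_pmf.expectation (p n) ?d"
      unfolding charf_def expectation_Suc[of n iexp w] integral_scaleR_right[symmetric]
      by (rule Bochner_Integration.integral_diff[symmetric]) (rule integrable_p)+
    have "cmod (charf (Suc n) w - exp (- var w / 2) *\<^sub>R charf n (damp n w))
        \<le> measure_pmf.expectation (p n) (\<lambda>x. cmod (?d x))"
      unfolding eq by (rule integral_norm_bound)
    also have "\<dots> \<le> measure_pmf.expectation (p n) (\<lambda>x. A1 * \<rho> ^ 3 + A2 * (\<rho>\<^sup>2 * (height n x / T n)))"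
      using one_step_pointwise[OF _ w \<rho>]
      by (intro integral_mono_AE) (auto simp: AE_measure_pmf_iff A1_def A2_def)
    also have "\<dots> = A1 * \<rho> ^ 3 + A2 * (\<rho>\<^sup>2 * (measure_pmf.expectation (p n) (height n) / T n))"
      by (subst Bochner_Integration.integral_add) (rule integrable_p, rule integrable_p, simp)
    also have "\<dots> \<le> A1 * \<rho> ^ 3 + A2 * (\<rho>\<^sup>2 * (B / c * (1 / sqrt (real (Suc n)))))"
    proof (intro add_left_mono mult_left_mono)
      have "measure_pmf.expectation (p n) (height n) / T n \<le> (B * sqrt (real (Suc n))) / (c * real (Suc n))"
        using B T_ge[of n] c by (intro frac_le) (auto simp: c_def)
      also have "\<dots> = B / c * (1 / sqrt (real (Suc n)))"
      proof -
        define u where "u = sqrt (real (Suc n))"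
        have "0 < u" "real (Suc n) = u * u" by (auto simp: u_def)
        moreover have "B * u / (c * (u * u)) = B / c * (1 / u)"
          using \<open>0 < u\<close> by simp
        ultimately show ?thesis unfolding u_def[symmetric] by metis
      qed
      finally show "measure_pmf.expectation (p n) (height n) / T n \<le> B / c * (1 / sqrt (real (Suc n)))" .
    qed (auto simp: A(2))
    also have "\<dots> \<le> (A1 + A2 * (B / c)) * (\<rho> ^ 3 + \<rho>\<^sup>2 * (1 / sqrt (real (Suc n))))"
    proof -
      define y where "y = \<rho>\<^sup>2 * (1 / sqrt (real (Suc n)))"
      define M where "M = A2 * (B / c)"
      have "0 \<le> A1 * y" "0 \<le> M * \<rho> ^ 3"
        unfolding y_def M_def using A B(1) c \<rho>(1) by (intro mult_nonneg_nonneg zero_le_power divide_nonneg_nonneg; simp)+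
      moreover have "A2 * (\<rho>\<^sup>2 * (B / c * (1 / sqrt (real (Suc n))))) = M * y"
        by (simp add: M_def y_def)
      ultimately show ?thesis
        unfolding y_def[symmetric] M_def[symmetric] by (simp add: algebra_simps)
    qed
    finally show ?thesis .
  qed
  show thesis
  proof (rule that)
    show "0 \<le> A1 + A2 * (B / c)" using A B(1) c by simp
  qed (rule main)
qed

text \<open>The exponent of the Gaussian characteristic function that obeys the one-step recursion exactly.
  It is a sum of values of \<open>var\<close> along the damped functionals, hence nonnegative.\<close>

primrec cumvar :: "nat \<Rightarrow> ('i \<Rightarrow> real) \<Rightarrow> real" where
  "cumvar 0 w = 0"
| "cumvar (Suc n) w = cumvar n (damp n w) + var w"

lemma cumvar_nonneg: "0 \<le> cumvar n w"
  by (induction n arbitrary: w) (auto simp: var_nonneg)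

text \<open>Damping does not increase the weights, so the bound \<open>\<rho>\<close> is inherited by the functional to which
  the induction hypothesis is applied and the one-step errors add up. For \<open>\<rho>\<close> of order
  \<open>1 / sqrt n\<close> the total is \<open>O(1 / sqrt n)\<close>.\<close>

lemma charf_gaussian_approx:
  obtains A A0 where "0 \<le> A" "0 \<le> A0"
    "\<And>n w \<rho>. (\<And>i. i \<in> I \<Longrightarrow> \<bar>w i\<bar> \<le> \<rho>) \<Longrightarrow> 0 \<le> \<rho> \<Longrightarrow> \<rho> \<le> 1 \<Longrightarrow>
       cmod (charf n w - exp (- cumvar n w / 2)) \<le> A0 * \<rho> + A * (real n * \<rho> ^ 3 + \<rho>\<^sup>2 * (2 * sqrt (real n)))"
proof -
  obtain A where A: "0 \<le> A" and step:
    "\<And>n w \<rho>. (\<And>i. i \<in> I \<Longrightarrow> \<bar>w i\<bar> \<le> \<rho>) \<Longrightarrow> 0 \<le> \<rho> \<Longrightarrow> \<rho> \<le> 1 \<Longrightarrow>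
       cmod (charf (Suc n) w - exp (- var w / 2) *\<^sub>R charf n (damp n w))
         \<le> A * (\<rho> ^ 3 + \<rho>\<^sup>2 * (1 / sqrt (real (Suc n))))"
    using one_step by blast
  define A0 where "A0 = measure_pmf.expectation (p 0) (height 0)"
  have A0: "0 \<le> A0" by (simp add: A0_def height_nonneg)
  have bd: "cmod (charf n w - exp (- cumvar n w / 2))
        \<le> A0 * \<rho> + A * (real n * \<rho> ^ 3 + \<rho>\<^sup>2 * (\<Sum>l<n. 1 / sqrt (real (Suc l))))"
    if "\<And>i. i \<in> I \<Longrightarrow> \<bar>w i\<bar> \<le> \<rho>" "0 \<le> \<rho>" "\<rho> \<le> 1" for n w \<rho>
    using that
  proof (induction n arbitrary: w)
    case 0
    have eq: "charf 0 w - 1 = measure_pmf.expectation (p 0) (\<lambda>x. iexp (lin w (X 0 x)) - 1)"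
      by (simp add: charf_def)
    have "cmod (charf 0 w - 1) \<le> measure_pmf.expectation (p 0) (\<lambda>x. cmod (iexp (lin w (X 0 x)) - 1))"
      unfolding eq by (rule integral_norm_bound)
    also have "\<dots> \<le> measure_pmf.expectation (p 0) (\<lambda>x. \<rho> * height 0 x)"
    proof (intro integral_mono)
      fix x
      have "cmod (iexp (lin w (X 0 x)) - 1) \<le> \<bar>lin w (X 0 x)\<bar>"
        using iexp_approx1[of "lin w (X 0 x)" 0] by simp
      also have "\<dots> \<le> (\<Sum>i\<in>I. \<bar>w i\<bar> * \<bar>X 0 x i\<bar>)"
        unfolding lin_def by (rule order_trans[OF sum_abs]) (simp add: abs_mult)
      also have "\<dots> \<le> \<rho> * height 0 x"
        unfolding height_def sum_distrib_left using 0 by (intro sum_mono mult_right_mono) auto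
      finally show "cmod (iexp (lin w (X 0 x)) - 1) \<le> \<rho> * height 0 x" .
    qed auto
    finally show ?case by (simp add: A0_def mult.commute)
  next
    case (Suc n)
    have damp: "\<bar>damp n w i\<bar> \<le> \<rho>" if i: "i \<in> I" for i
    proof -
      have "\<bar>1 - r i / T n\<bar> \<le> 1"
        using r_nonneg[OF i] r_le[OF i, of n] T_pos[of n] by (simp add: abs_if)
      then have "\<bar>damp n w i\<bar> \<le> \<bar>w i\<bar>"
        unfolding damp_def abs_mult by (simp add: mult_left_le_one_le)
      then show ?thesis using Suc.prems(1)[OF i] by linarith
    qed
    have e: "exp (- cumvar (Suc n) w / 2) = exp (- var w / 2) * exp (- cumvar n (damp n w) / 2)"
      by (simp add: exp_add[symmetric] add_divide_distrib)
    have "cmod (charf (Suc n) w - exp (- cumvar (Suc n) w / 2)) \<le>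
          cmod (charf (Suc n) w - exp (- var w / 2) *\<^sub>R charf n (damp n w))
          + cmod (exp (- var w / 2) *\<^sub>R (charf n (damp n w) - exp (- cumvar n (damp n w) / 2)))"
      unfolding e by (rule order_trans[OF _ norm_triangle_ineq]) (simp add: scaleR_conv_of_real algebra_simps)
    also have "cmod (exp (- var w / 2) *\<^sub>R (charf n (damp n w) - exp (- cumvar n (damp n w) / 2)))
          \<le> cmod (charf n (damp n w) - exp (- cumvar n (damp n w) / 2))"
      using var_nonneg[of w] by (simp add: mult_left_le_one_le)
    also have "\<dots> \<le> A0 * \<rho> + A * (real n * \<rho> ^ 3 + \<rho>\<^sup>2 * (\<Sum>l<n. 1 / sqrt (real (Suc l))))"
      by (rule Suc.IH[OF damp Suc.prems(2,3)])
    also have "cmod (charf (Suc n) w - exp (- var w / 2) *\<^sub>R charf n (damp n w))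
         \<le> A * (\<rho> ^ 3 + \<rho>\<^sup>2 * (1 / sqrt (real (Suc n))))"
      by (rule step[OF Suc.prems])
    finally show ?case
      by (simp add: algebra_simps)
  qed
  show thesis
  proof (rule that[OF A A0])
    fix n w and \<rho> :: real assume *: "\<And>i. i \<in> I \<Longrightarrow> \<bar>w i\<bar> \<le> \<rho>" "0 \<le> \<rho>" "\<rho> \<le> 1"
    show "cmod (charf n w - exp (- cumvar n w / 2)) \<le> A0 * \<rho> + A * (real n * \<rho> ^ 3 + \<rho>\<^sup>2 * (2 * sqrt (real n)))"
      by (rule order_trans[OF bd[OF *]])
         (use A *(2) in \<open>auto intro!: mult_left_mono add_left_mono sum_inverse_sqrt_le simp del: of_nat_Suc\<close>)
  qed
qed

definition jump_cov :: "'i \<Rightarrow> 'i \<Rightarrow> real" where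
  "jump_cov i j = (\<Sum>\<kappa>\<in>K. \<pi> \<kappa> * J \<kappa> i * J \<kappa> j)"

text \<open>The solution \<open>\<Theta>\<close> of the Lyapunov equation \<open>\<Theta> = jump_cov - (r i + r j) / \<alpha> * \<Theta>\<close>, which balances
  the covariance created per step against the damping.\<close>

definition limit_cov :: "'i \<Rightarrow> 'i \<Rightarrow> real" where
  "limit_cov i j = \<alpha> * jump_cov i j / (\<alpha> + r i + r j)"

lemma cumvar_tendsto:
  "(\<lambda>n. cumvar n w / real n) \<longlonglongrightarrow> (\<Sum>i\<in>I. \<Sum>j\<in>I. w i * w j * limit_cov i j)"
proof -
  define s where "s = (\<lambda>n i j. rec_nat 0 (\<lambda>n y. (1 - r i / T n) * (1 - r j / T n) * y + jump_cov i j) n)"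
  have s0: "s 0 i j = 0" and s_Suc: "s (Suc n) i j = (1 - r i / T n) * (1 - r j / T n) * s n i j + jump_cov i j"
    for n i j by (auto simp: s_def)
  have var: "var w = (\<Sum>i\<in>I. \<Sum>j\<in>I. w i * w j * jump_cov i j)" for w
  proof -
    have "var w = (\<Sum>\<kappa>\<in>K. \<Sum>i\<in>I. \<Sum>j\<in>I. w i * w j * (\<pi> \<kappa> * J \<kappa> i * J \<kappa> j))"
      unfolding var_def lin_def power2_eq_square sum_product
      by (simp add: sum_distrib_left mult_ac)
    also have "\<dots> = (\<Sum>i\<in>I. \<Sum>j\<in>I. \<Sum>\<kappa>\<in>K. w i * w j * (\<pi> \<kappa> * J \<kappa> i * J \<kappa> j))"
      unfolding sum.swap[of _ I K] by simp
    finally show ?thesis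
      by (simp add: jump_cov_def sum_distrib_left)
  qed
  have cumvar: "cumvar n w = (\<Sum>i\<in>I. \<Sum>j\<in>I. w i * w j * s n i j)" for n w
  proof (induction n arbitrary: w)
    case (Suc n)
    have "cumvar (Suc n) w = (\<Sum>i\<in>I. \<Sum>j\<in>I. damp n w i * damp n w j * s n i j + w i * w j * jump_cov i j)"
      by (simp add: Suc var sum.distrib)
    also have "\<dots> = (\<Sum>i\<in>I. \<Sum>j\<in>I. w i * w j * s (Suc n) i j)"
      by (intro sum.cong refl) (simp add: s_Suc damp_def distrib_left mult_ac)
    finally show ?case .
  qed (simp add: s0)
  have "(\<lambda>n. s n i j / real n) \<longlonglongrightarrow> limit_cov i j" if "i \<in> I" "j \<in> I" for i j
    unfolding limit_cov_def
    by (rule recursion_div_n_tendsto[OF \<alpha>_pos T0_pos _ _ T])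
       (use that in \<open>auto simp: r_nonneg r_le s0 s_Suc\<close>)
  then have "(\<lambda>n. \<Sum>i\<in>I. \<Sum>j\<in>I. w i * w j * (s n i j / real n)) \<longlonglongrightarrow> (\<Sum>i\<in>I. \<Sum>j\<in>I. w i * w j * limit_cov i j)"
    by (intro tendsto_sum tendsto_mult tendsto_const)
  then show ?thesis
    by (simp add: cumvar sum_divide_distrib)
qed

lemma limit_cov_nonneg: "0 \<le> (\<Sum>i\<in>I. \<Sum>j\<in>I. w i * w j * limit_cov i j)"
  by (rule LIMSEQ_le_const[OF cumvar_tendsto]) (auto intro!: exI[of _ 0] divide_nonneg_nonneg cumvar_nonneg)

lemma limit_cov_commute: "limit_cov i j = limit_cov j i"
  by (simp add: limit_cov_def jump_cov_def mult.commute mult.left_commute add.commute add.left_commute)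

theorem charf_tendsto:
  "(\<lambda>n. charf n (\<lambda>i. w i / sqrt (real n))) \<longlonglongrightarrow>
     of_real (exp (- (\<Sum>i\<in>I. \<Sum>j\<in>I. w i * w j * limit_cov i j) / 2))"
proof -
  obtain A A0 where A: "0 \<le> A" "0 \<le> A0" and approx:
    "\<And>n w \<rho>. (\<And>i. i \<in> I \<Longrightarrow> \<bar>w i\<bar> \<le> \<rho>) \<Longrightarrow> 0 \<le> \<rho> \<Longrightarrow> \<rho> \<le> 1 \<Longrightarrow>
       cmod (charf n w - exp (- cumvar n w / 2)) \<le> A0 * \<rho> + A * (real n * \<rho> ^ 3 + \<rho>\<^sup>2 * (2 * sqrt (real n)))"
    using charf_gaussian_approx by blast
  define W where "W = (\<Sum>i\<in>I. \<bar>w i\<bar>)"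
  have W0: "0 \<le> W" by (simp add: W_def sum_nonneg)
  have Wi: "\<bar>w i\<bar> \<le> W" if "i \<in> I" for i
    unfolding W_def using that finite_I by (intro member_le_sum) auto
  have hom: "cumvar n (\<lambda>i. c * w i) = c\<^sup>2 * cumvar n w" for n c w
  proof (induction n arbitrary: w)
    case (Suc n)
    have "var (\<lambda>i. c * w i) = c\<^sup>2 * var w"
      by (simp add: var_def lin_def mult.assoc sum_distrib_left[symmetric] power_mult_distrib)
         (simp add: sum_distrib_left mult_ac)
    moreover have "damp n (\<lambda>i. c * w i) = (\<lambda>i. c * damp n w i)"
      by (simp add: damp_def fun_eq_iff)
    ultimately show ?case
      by (simp add: Suc algebra_simps)
  qed simp
  define E where "E n = A0 * (W / sqrt (real n)) + A * (real n * (W / sqrt (real n)) ^ 3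
      + (W / sqrt (real n))\<^sup>2 * (2 * sqrt (real n)))" for n
  have E: "E \<longlonglongrightarrow> 0"
  proof (rule Lim_transform_eventually)
    show "(\<lambda>n. (A0 * W + A * W ^ 3 + 2 * A * W\<^sup>2) * (1 / sqrt (real n))) \<longlonglongrightarrow> 0"
      by (rule tendsto_mult_right_zero) real_asymp
    have E_eq: "E n = (A0 * W + A * W ^ 3 + 2 * A * W\<^sup>2) * (1 / sqrt (real n))" if "0 < n" for n
    proof -
      define x where "x = sqrt (real n)"
      have x: "0 < x" "real n = x\<^sup>2" using that by (auto simp: x_def)
      show ?thesis unfolding E_def x_def[symmetric] x(2)
        using x(1) by (simp add: field_simps power2_eq_square power3_eq_cube)
    qed
    show "\<forall>\<^sub>F n in sequentially. (A0 * W + A * W ^ 3 + 2 * A * W\<^sup>2) * (1 / sqrt (real n)) = E n"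
      by (rule eventually_mono[OF eventually_gt_at_top[of 0]]) (rule E_eq[symmetric])
  qed
  have "LIM n sequentially. sqrt (real n) :> at_top"
    by real_asymp
  then have "\<forall>\<^sub>F n in sequentially. W \<le> sqrt (real n)"
    by (simp add: filterlim_at_top)
  then have "\<forall>\<^sub>F n in sequentially. cmod (charf n (\<lambda>i. w i / sqrt (real n)) - exp (- (cumvar n w / real n) / 2)) \<le> E n"
    using eventually_gt_at_top[of 0]
  proof eventually_elim
    case (elim n)
    have "cumvar n (\<lambda>i. w i / sqrt (real n)) = cumvar n w / real n"
      using hom[of n "1 / sqrt (real n)" w] by (simp add: power_divide)
    moreover have "cmod (charf n (\<lambda>i. w i / sqrt (real n)) - exp (- cumvar n (\<lambda>i. w i / sqrt (real n)) / 2)) \<le> E n"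
      unfolding E_def
      using elim W0 Wi by (intro approx) (auto simp: divide_right_mono)
    ultimately show ?case by simp
  qed
  then have "(\<lambda>n. charf n (\<lambda>i. w i / sqrt (real n)) - of_real (exp (- (cumvar n w / real n) / 2))) \<longlonglongrightarrow> 0"
    by (intro Lim_null_comparison[OF _ E]) (simp add: exp_of_real[symmetric])
  moreover have "(\<lambda>n. of_real (exp (- (cumvar n w / real n) / 2)) :: complex) \<longlonglongrightarrow>
     of_real (exp (- (\<Sum>i\<in>I. \<Sum>j\<in>I. w i * w j * limit_cov i j) / 2))"
    by (intro tendsto_of_real tendsto_exp tendsto_divide tendsto_minus cumvar_tendsto tendsto_const) simp
  ultimately show ?thesis
    using tendsto_add by fastforce
qed

end

section \<open>Counting vertices when a copy of the seed is attached\<close>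

lemma size_filter_eq: "size {#y \<in># M. y = x#} = count M x"
  by (simp add: filter_eq_replicate_mset)

text \<open>Stated for the two summands of \<open>vertex_degree\<close> on bare edge multisets, so that it applies both to
  the initial copy of the seed and to the new edges of a later network.\<close>

lemma vertex_degree_map:
  assumes "\<And>x. f x = w \<longleftrightarrow> x = v"
  shows "size {#e \<in># image_mset (map_uprod f) E. w \<in> set_uprod e#} + count (image_mset (map_uprod f) E) (Upair w w)
       = size {#e \<in># E. v \<in> set_uprod e#} + count E (Upair v v)"
proof -
  have 1: "w \<in> set_uprod (map_uprod f e) \<longleftrightarrow> v \<in> set_uprod e" for e
    by (auto simp: uprod.set_map image_iff assms eq_commute[of w])
  have 2: "map_uprod f e = Upair w w \<longleftrightarrow> e = Upair v v" for e
    using assms by (cases e) auto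
  show ?thesis
    unfolding size_filter_eq[symmetric] filter_mset_image_mset 1 2 by simp
qed

lemma real_card_filter: "finite A \<Longrightarrow> real (card {x \<in> A. P x}) = (\<Sum>x\<in>A. if P x then 1 else 0)"
  by (simp add: sum.If_cases Int_def)

lemma verts_attach [simp]: "verts (attach S t G l) = verts G \<union> Pair t ` (verts S - {hook S})"
  by (simp add: attach_def Let_def)

lemma edges_attach [simp]:
  "edges (attach S t G l) = edges G + image_mset (map_uprod (fuse S t l)) (edges S)"
  by (simp add: attach_def Let_def)

lemma recruits_attach:
  "recruits (attach S t G l) v =
     (if v \<in> Pair t ` (verts S - {hook S}) then 0 else if v = l then recruits G v + 1 else recruits G v)"
  by (simp add: attach_def Let_def)

lemma orig_degree_attach_old:
  "v \<notin> Pair t ` (verts S - {hook S}) \<Longrightarrow> orig_degree (attach S t G l) v = orig_degree G v"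
  by (simp add: attach_def Let_def)

text \<open>A new vertex meets new edges only, and apart from the hook the fusion renames vertices injectively.\<close>

lemma orig_degree_attach_new:
  assumes "v \<in> verts S" "v \<noteq> hook S" "l \<noteq> (t, v)" "\<And>e. e \<in># edges G \<Longrightarrow> (t, v) \<notin> set_uprod e"
  shows "orig_degree (attach S t G l) (t, v) = vertex_degree S v"
proof -
  have "orig_degree (attach S t G l) (t, v) =
     size {#e \<in># edges G. (t, v) \<in> set_uprod e#} + count (edges G) (Upair (t, v) (t, v)) +
     (size {#e \<in># image_mset (map_uprod (fuse S t l)) (edges S). (t, v) \<in> set_uprod e#}
       + count (image_mset (map_uprod (fuse S t l)) (edges S)) (Upair (t, v) (t, v)))"
    using assms(1,2) by (simp add: attach_def Let_def vertex_degree_def)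
  also have "{#e \<in># edges G. (t, v) \<in> set_uprod e#} = {#}"
    using assms(4) by (intro multiset_eqI) (auto simp: count_eq_zero_iff)
  also have "count (edges G) (Upair (t, v) (t, v)) = 0"
    using assms(4)[of "Upair (t, v) (t, v)"] by (auto simp: count_eq_zero_iff)
  also have "size {#e \<in># image_mset (map_uprod (fuse S t l)) (edges S). (t, v) \<in> set_uprod e#}
       + count (image_mset (map_uprod (fuse S t l)) (edges S)) (Upair (t, v) (t, v)) = vertex_degree S v"
    unfolding vertex_degree_def
    by (rule vertex_degree_map) (use assms in \<open>auto simp: fuse_def\<close>)
  finally show ?thesis by simp
qed

locale hooking =
  fixes S :: "'v seed" and m k i \<tau> :: nat and d N :: "nat \<Rightarrow> nat"
  assumes m: "m \<ge> 1"
    and seed: "is_seed S"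
    and order: "\<tau> = card (verts S)" "\<tau> \<ge> 2"
    and degrees: "strict_mono_on {1..k} d" "d ` {1..k} = vertex_degree S ` verts S"
    and multiplicities: "\<And>l. l \<in> {1..k} \<Longrightarrow> N l = card {v \<in> verts S. vertex_degree S v = d l}"
    and hook_degree: "i \<in> {1..k}" "vertex_degree S (hook S) = d i"
begin

lemma seed_facts: "finite (verts S)" "hook S \<in> verts S" "\<And>e. e \<in># edges S \<Longrightarrow> set_uprod e \<subseteq> verts S"
  using seed by (auto simp: is_seed_def finite_graph_def)

lemma inj_d: "inj_on d {1..k}"
  using degrees(1) by (rule strict_mono_on_imp_inj_on)

text \<open>The number of vertices of initial degree \<open>d j\<close> that each new copy of the seed contributes: its
  hook is absorbed by the latch.\<close>

definition gain :: "nat \<Rightarrow> real" where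
  "gain j = real (N j) - (if j = i then 1 else 0)"

text \<open>The deterministic number of insertion positions gained per step.\<close>

definition \<alpha> :: real where
  "\<alpha> = real m * real \<tau> - real m - 1"

definition T :: "nat \<Rightarrow> real" where
  "T n = real m * real \<tau> + \<alpha> * real n"

lemma \<alpha>_nonneg: "0 \<le> \<alpha>" "real m - 1 \<le> \<alpha>"
proof -
  have "real m * 2 \<le> real m * real \<tau>" using order by (intro mult_left_mono) auto
  moreover have "1 \<le> real m" using m by simp
  ultimately show "0 \<le> \<alpha>" "real m - 1 \<le> \<alpha>" unfolding \<alpha>_def by linarith+
qed

lemma T_ge: "real m \<le> T n" "0 < T n"
proof -
  have "real m * 1 \<le> real m * real \<tau>" using order by (intro mult_left_mono) auto
  moreover have "0 \<le> \<alpha> * real n" using \<alpha>_nonneg by simp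
  moreover have "1 \<le> real m" using m by simp
  ultimately show "real m \<le> T n" "0 < T n" unfolding T_def by linarith+
qed

lemma card_new_degree:
  assumes "l \<in> {1..k}"
  shows "real (card {v \<in> verts S - {hook S}. vertex_degree S v = d l}) = gain l"
proof -
  define A where "A = {v \<in> verts S. vertex_degree S v = d l}"
  have fin: "finite A" using seed_facts by (simp add: A_def)
  have eq: "{v \<in> verts S - {hook S}. vertex_degree S v = d l} = A - {hook S}"
    by (auto simp: A_def)
  have NA: "N l = card A" using multiplicities[OF assms] by (simp add: A_def)
  show ?thesis
  proof (cases "l = i")
    case True
    then have "hook S \<in> A" using hook_degree seed_facts by (simp add: A_def)
    then have "real (card A) = real (card (A - {hook S})) + 1"
      using fin card_Suc_Diff1[of A "hook S"] by (metis of_nat_Suc add.commute)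
    then show ?thesis
      unfolding eq gain_def NA using True by simp
  next
    case False
    then have "hook S \<notin> A"
      using hook_degree inj_onD[OF inj_d, of i l] assms by (auto simp: A_def)
    then show ?thesis unfolding eq gain_def NA using False by simp
  qed
qed

definition wf_network :: "nat \<Rightarrow> (nat \<times> 'v) network \<Rightarrow> bool" where
  "wf_network n G \<longleftrightarrow>
     finite (verts G) \<and> verts G \<subseteq> {..n} \<times> UNIV \<and> (\<forall>e \<in># edges G. set_uprod e \<subseteq> verts G) \<and>
     (\<forall>v \<in> verts G. recruits G v \<le> m \<and> orig_degree G v \<in> d ` {1..k}) \<and>
     (\<Sum>v\<in>verts G. real (m - recruits G v)) = T n"

lemma wf_initial: "wf_network 0 (initial_network S)"
proof -
  have "orig_degree (initial_network S) (0, v) = vertex_degree S v" for v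
    unfolding initial_network_def Let_def vertex_degree_def
    by (simp, rule vertex_degree_map) auto
  moreover have "set_uprod e \<subseteq> Pair 0 ` verts S" if e: "e \<in># image_mset (map_uprod (Pair 0)) (edges S)" for e
  proof -
    obtain e' where e': "e' \<in># edges S" "e = map_uprod (Pair 0) e'" using e by auto
    then show ?thesis using seed_facts(3)[OF e'(1)] by (auto simp: uprod.set_map)
  qed
  moreover have "(\<Sum>v\<in>verts (initial_network S). real (m - recruits (initial_network S) v)) = T 0"
    by (simp add: initial_network_def Let_def card_image inj_on_def T_def order(1)[symmetric])
  ultimately show ?thesis
    unfolding wf_network_def degrees(2)
    using seed_facts by (auto simp: initial_network_def Let_def)
qed

lemma new_vertex_fresh:
  assumes "wf_network n G"
  shows "(Suc n, v) \<notin> verts G" "verts G \<inter> Pair (Suc n) ` A = {}"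
  using assms by (auto simp: wf_network_def)

lemma orig_degree_new:
  assumes "wf_network n G" "l \<in> verts G" "v \<in> verts S" "v \<noteq> hook S"
  shows "orig_degree (attach S (Suc n) G l) (Suc n, v) = vertex_degree S v"
proof (rule orig_degree_attach_new)
  show "(Suc n, v) \<notin> set_uprod e" if "e \<in># edges G" for e
    using that new_vertex_fresh(1)[OF assms(1), of v] assms(1) by (auto simp: wf_network_def)
  show "l \<noteq> (Suc n, v)" using new_vertex_fresh(1)[OF assms(1)] assms(2) by auto
qed (use assms in auto)

text \<open>One computation covers the number of insertion positions, the degree counts and the number of
  vertices of given initial degree: they are all sums over the vertices of a function of the two labels.\<close>

lemma sum_attach:
  fixes g :: "nat \<Rightarrow> nat \<Rightarrow> real"
  assumes wf: "wf_network n G" and l: "l \<in> verts G"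
  defines "G' \<equiv> attach S (Suc n) G l"
  shows "(\<Sum>v\<in>verts G'. g (orig_degree G' v) (recruits G' v)) =
     (\<Sum>v\<in>verts G. g (orig_degree G v) (recruits G v))
      + (g (orig_degree G l) (recruits G l + 1) - g (orig_degree G l) (recruits G l))
      + (\<Sum>v\<in>verts S - {hook S}. g (vertex_degree S v) 0)"
proof -
  have fin: "finite (verts G)" using wf by (simp add: wf_network_def)
  define new where "new = Pair (Suc n) ` (verts S - {hook S})"
  have disj: "verts G \<inter> new = {}" unfolding new_def by (rule new_vertex_fresh[OF wf])
  have old: "orig_degree G' v = orig_degree G v"
    "recruits G' v = (if v = l then recruits G v + 1 else recruits G v)" if "v \<in> verts G" for v
  proof -
    have "v \<notin> new" using that disj by auto
    then show "orig_degree G' v = orig_degree G v"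
      "recruits G' v = (if v = l then recruits G v + 1 else recruits G v)"
      unfolding new_def G'_def by (simp_all only: orig_degree_attach_old recruits_attach if_False simp_thms)
  qed
  have "(\<Sum>v\<in>verts G'. g (orig_degree G' v) (recruits G' v)) =
      (\<Sum>v\<in>verts G. g (orig_degree G' v) (recruits G' v)) + (\<Sum>v\<in>new. g (orig_degree G' v) (recruits G' v))"
    unfolding G'_def verts_attach new_def[symmetric]
    by (intro sum.union_disjoint fin disj) (simp add: new_def seed_facts)
  also have "(\<Sum>v\<in>new. g (orig_degree G' v) (recruits G' v)) = (\<Sum>v\<in>verts S - {hook S}. g (vertex_degree S v) 0)"
    unfolding new_def
    by (subst sum.reindex) (auto simp: inj_on_def G'_def orig_degree_new[OF wf l] recruits_attach intro!: sum.cong)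
  also have "(\<Sum>v\<in>verts G. g (orig_degree G' v) (recruits G' v)) =
      g (orig_degree G l) (recruits G l + 1) + (\<Sum>v\<in>verts G - {l}. g (orig_degree G v) (recruits G v))"
    unfolding sum.remove[OF fin l] using l by (intro arg_cong2[of _ _ _ _ "(+)"] sum.cong) (auto simp: old)
  also have "(\<Sum>v\<in>verts G - {l}. g (orig_degree G v) (recruits G v)) =
      (\<Sum>v\<in>verts G. g (orig_degree G v) (recruits G v)) - g (orig_degree G l) (recruits G l)"
    unfolding sum.remove[OF fin l] by simp
  finally show ?thesis by simp
qed

lemma wf_attach:
  assumes wf: "wf_network n G" and l: "l \<in> verts G" and free: "recruits G l < m"
  shows "wf_network (Suc n) (attach S (Suc n) G l)"
proof -
  let ?G = "attach S (Suc n) G l"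
  have "(\<Sum>v\<in>verts ?G. real (m - recruits ?G v)) = T n - 1 + real m * (real \<tau> - 1)"
  proof -
    have "card (verts S - {hook S}) = \<tau> - 1"
      using seed_facts order(1) by simp
    moreover have "(\<Sum>v\<in>verts G. real (m - recruits G v)) = T n"
      using wf unfolding wf_network_def by blast
    ultimately show ?thesis
      using sum_attach[OF wf l, of "\<lambda>_ r. real (m - r)"] free order(2)
      by (simp add: of_nat_diff del: verts_attach)
  qed
  also have "\<dots> = T (Suc n)"
    by (simp add: T_def \<alpha>_def algebra_simps)
  finally have total: "(\<Sum>v\<in>verts ?G. real (m - recruits ?G v)) = T (Suc n)" .
  have new: "orig_degree ?G (Suc n, v) \<in> d ` {1..k}" if "v \<in> verts S" "v \<noteq> hook S" for v
    unfolding orig_degree_new[OF wf l that] degrees(2) using that by auto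
  have old: "orig_degree ?G v = orig_degree G v" if "v \<in> verts G" for v
    using that new_vertex_fresh[OF wf] by (intro orig_degree_attach_old) auto
  have edges: "set_uprod e \<subseteq> verts ?G" if e: "e \<in># edges ?G" for e
  proof (cases "e \<in># edges G")
    case True
    then show ?thesis using wf by (auto simp: wf_network_def)
  next
    case False
    then obtain e' where e': "e' \<in># edges S" "e = map_uprod (fuse S (Suc n) l) e'"
      using e by auto
    then show ?thesis
      using seed_facts(3)[OF e'(1)] l by (auto simp: uprod.set_map fuse_def)
  qed
  have vertices: "recruits ?G v \<le> m \<and> orig_degree ?G v \<in> d ` {1..k}" if v: "v \<in> verts ?G" for v
  proof (cases "v \<in> verts G")
    case True
    then have "recruits G v \<le> m" "orig_degree G v \<in> d ` {1..k}"
      using wf unfolding wf_network_def by blast+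
    then show ?thesis
      using free by (simp only: old[OF True]) (auto simp: recruits_attach)
  next
    case False
    then obtain x where x: "x \<in> verts S" "x \<noteq> hook S" "v = (Suc n, x)" using v by auto
    then show ?thesis using new[OF x(1,2)] by (simp add: recruits_attach)
  qed
  have "finite (verts ?G)" "verts ?G \<subseteq> {..Suc n} \<times> UNIV"
    using wf seed_facts(1) by (auto simp: wf_network_def le_Suc_eq)
  then show ?thesis
    unfolding wf_network_def using total edges vertices by blast
qed

lemma insertion_positions_facts:
  assumes "wf_network n G"
  shows "finite (insertion_positions m G)" "real (card (insertion_positions m G)) = T n"
    "insertion_positions m G \<noteq> {}"
proof -
  show fin: "finite (insertion_positions m G)"
    using assms by (auto simp: insertion_positions_def wf_network_def)
  show T: "real (card (insertion_positions m G)) = T n"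
    unfolding insertion_positions_def using assms
    by (subst card_SigmaI) (auto simp: wf_network_def)
  show "insertion_positions m G \<noteq> {}"
    using T T_ge(2)[of n] by auto
qed

definition colour :: "(nat \<times> 'v) network \<Rightarrow> (nat \<times> 'v) \<times> nat \<Rightarrow> nat \<times> nat" where
  "colour G e = (inv_into {1..k} d (orig_degree G (fst e)), recruits G (fst e))"

lemma colour_position:
  assumes "wf_network n G" "e \<in> insertion_positions m G"
  shows "colour G e \<in> {1..k} \<times> {..<m}" "fst e \<in> verts G" "recruits G (fst e) < m"
    "d (fst (colour G e)) = orig_degree G (fst e)"
proof -
  have e: "fst e \<in> verts G" "recruits G (fst e) < m"
    using assms(2) by (auto simp: insertion_positions_def)
  then have "orig_degree G (fst e) \<in> d ` {1..k}"
    using assms(1) by (auto simp: wf_network_def)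
  then show "colour G e \<in> {1..k} \<times> {..<m}" "d (fst (colour G e)) = orig_degree G (fst e)"
    using e inv_into_into[of "orig_degree G (fst e)" d "{1..k}"] by (auto simp: colour_def f_inv_into_f)
qed (use assms(2) in \<open>auto simp: insertion_positions_def\<close>)

lemma pmf_colour:
  assumes wf: "wf_network n G" and j: "j \<in> {1..k}" and s: "s < m"
  shows "pmf (map_pmf (colour G) (pmf_of_set (insertion_positions m G))) (j, s)
       = real (m - s) * real (degree_count G (d j) s) / T n"
proof -
  note pos = insertion_positions_facts[OF wf]
  have fin: "finite (verts G)" using wf by (simp add: wf_network_def)
  have "insertion_positions m G \<inter> colour G -` {(j, s)} =
      {v \<in> verts G. orig_degree G v = d j \<and> recruits G v = s} \<times> {..<m - s}"
  proof (intro equalityI subsetI)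
    fix e assume e: "e \<in> insertion_positions m G \<inter> colour G -` {(j, s)}"
    then show "e \<in> {v \<in> verts G. orig_degree G v = d j \<and> recruits G v = s} \<times> {..<m - s}"
      using colour_position[OF wf, of e] by (auto simp: insertion_positions_def colour_def)
  next
    fix e assume e: "e \<in> {v \<in> verts G. orig_degree G v = d j \<and> recruits G v = s} \<times> {..<m - s}"
    then show "e \<in> insertion_positions m G \<inter> colour G -` {(j, s)}"
      using inj_d j by (auto simp: insertion_positions_def colour_def)
  qed
  then have "card (insertion_positions m G \<inter> colour G -` {(j, s)}) = degree_count G (d j) s * (m - s)"
    by (simp add: card_cartesian_product degree_count_def)
  then show ?thesis
    by (simp add: pmf_map measure_pmf_of_set[OF pos(3,1)] pos(2))
qed

lemma degree_count_attach:
  assumes wf: "wf_network n G" and e: "e \<in> insertion_positions m G" and j: "j \<in> {1..k}"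
  shows "real (degree_count (attach S (Suc n) G (fst e)) (d j) s) = real (degree_count G (d j) s)
     + (if colour G e = (j, s - 1) \<and> 0 < s then 1 else 0) - (if colour G e = (j, s) then 1 else 0)
     + (if s = 0 then gain j else 0)"
proof -
  note c = colour_position[OF wf e]
  have fin: "finite (verts G)" "finite (verts (attach S (Suc n) G (fst e)))"
    using wf seed_facts by (auto simp: wf_network_def)
  have iff: "orig_degree G (fst e) = d j \<longleftrightarrow> fst (colour G e) = j"
    using c(1,4) inj_d j by (metis inj_onD mem_Times_iff)
  define g :: "nat \<Rightarrow> nat \<Rightarrow> real" where "g = (\<lambda>a r. if a = d j \<and> r = s then 1 else 0)"
  have cnt: "real (degree_count H (d j) s) = (\<Sum>v\<in>verts H. g (orig_degree H v) (recruits H v))"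
    if "finite (verts H)" for H :: "(nat \<times> 'v) network"
    unfolding degree_count_def g_def by (rule real_card_filter[OF that])
  have "(\<Sum>v\<in>verts S - {hook S}. g (vertex_degree S v) 0) = (if s = 0 then gain j else 0)"
    unfolding g_def card_new_degree[OF j, symmetric] real_card_filter[OF finite_Diff[OF seed_facts(1)]]
    by simp
  then show ?thesis
    unfolding cnt[OF fin(1)] cnt[OF fin(2)] sum_attach[OF wf c(2)]
    using iff by (auto simp: g_def colour_def)
qed

lemma finite_hooking_network: "finite (set_pmf (hooking_network m S n))"
  and wf_hooking_network: "G \<in> set_pmf (hooking_network m S n) \<Longrightarrow> wf_network n G"
proof (induction n arbitrary: G)
  case 0
  { case 1 then show ?case by simp }
  { case 2 then show ?case by (simp add: wf_initial) }
next
  case (Suc n)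
  note IH = Suc.IH
  { case 1
    have "finite (set_pmf (pmf_of_set (insertion_positions m G)))" if "G \<in> set_pmf (hooking_network m S n)" for G
      using insertion_positions_facts[OF IH(2)[OF that]] by simp
    then show ?case using IH(1) by auto }
  { case 2
    then obtain H e where H: "H \<in> set_pmf (hooking_network m S n)"
      and e: "e \<in> set_pmf (pmf_of_set (insertion_positions m H))"
      and G: "G = attach S (Suc n) H (fst e)"
      by (auto simp: split_beta)
    have wf: "wf_network n H" by (rule IH(2)[OF H])
    have e': "e \<in> insertion_positions m H"
      using e insertion_positions_facts[OF wf] by simp
    show ?case unfolding G by (intro wf_attach wf colour_position[OF wf e']) }
qed

lemma set_pmf_positions:
  "G \<in> set_pmf (hooking_network m S n) \<Longrightarrow>
     set_pmf (pmf_of_set (insertion_positions m G)) = insertion_positions m G"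
  using insertion_positions_facts[OF wf_hooking_network] by simp

end

section \<open>Factorial moments of the insertion positions\<close>

text \<open>Newton interpolation: the polynomial of degree \<open>Suc m\<close> that is added last vanishes at \<open>0, ..., m\<close>.\<close>

lemma binomial_expansion_exists:
  fixes g :: "nat \<Rightarrow> real"
  shows "\<exists>\<beta>. \<forall>p\<le>m. g p = (\<Sum>r\<le>m. \<beta> r * real (p choose r))"
proof (induction m)
  case 0
  show ?case by (rule exI[of _ "\<lambda>_. g 0"]) simp
next
  case (Suc m)
  then obtain \<beta> where \<beta>: "\<And>p. p \<le> m \<Longrightarrow> g p = (\<Sum>r\<le>m. \<beta> r * real (p choose r))" by auto
  define \<beta>' where "\<beta>' = \<beta>(Suc m := g (Suc m) - (\<Sum>r\<le>m. \<beta> r * real (Suc m choose r)))"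
  have "(\<Sum>r\<le>m. \<beta>' r * real (p choose r)) = (\<Sum>r\<le>m. \<beta> r * real (p choose r))" for p
    by (intro sum.cong) (auto simp: \<beta>'_def)
  then have "g p = (\<Sum>r\<le>Suc m. \<beta>' r * real (p choose r))" if "p \<le> Suc m" for p
    using that \<beta>[of p] by (cases "p = Suc m") (auto simp: \<beta>'_def le_Suc_eq)
  then show ?case by blast
qed

text \<open>A sequence on \<open>{..m}\<close> is recovered linearly from its factorial moments, because indicators of
  points are combinations of binomial coefficients.\<close>

lemma factorial_moment_inversion:
  "\<exists>\<beta> :: nat \<Rightarrow> nat \<Rightarrow> real. \<forall>s\<le>m. \<forall>E. E s = (\<Sum>r\<le>m. \<beta> s r * (\<Sum>s'\<le>m. real ((m - s') choose r) * E s'))"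
proof -
  have "\<exists>b :: nat \<Rightarrow> real. s \<le> m \<longrightarrow> (\<forall>E. E s = (\<Sum>r\<le>m. b r * (\<Sum>s'\<le>m. real ((m - s') choose r) * E s')))" for s
  proof -
    obtain b where b: "\<And>p. p \<le> m \<Longrightarrow> (if p = m - s then 1 else 0) = (\<Sum>r\<le>m. b r * real (p choose r))"
      using binomial_expansion_exists[of m "\<lambda>p. if p = m - s then 1 else 0"] by auto
    have "E s = (\<Sum>r\<le>m. b r * (\<Sum>s'\<le>m. real ((m - s') choose r) * E s'))" if s: "s \<le> m" for E
    proof -
      have "(\<Sum>r\<le>m. b r * (\<Sum>s'\<le>m. real ((m - s') choose r) * E s')) =
          (\<Sum>r\<le>m. \<Sum>s'\<le>m. b r * real ((m - s') choose r) * E s')"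
        by (simp only: sum_distrib_left mult.assoc)
      also have "\<dots> = (\<Sum>s'\<le>m. \<Sum>r\<le>m. b r * real ((m - s') choose r) * E s')"
        by (rule sum.swap)
      also have "\<dots> = (\<Sum>s'\<le>m. (if s' = s then 1 else 0) * E s')"
      proof (intro sum.cong refl)
        fix s' assume "s' \<in> {..m}"
        then have "(if s' = s then 1 else 0) = (\<Sum>r\<le>m. b r * real ((m - s') choose r))"
          using b[of "m - s'"] s by (auto split: if_splits)
        then show "(\<Sum>r\<le>m. b r * real ((m - s') choose r) * E s') = (if s' = s then 1 else 0) * E s'"
          by (simp only: sum_distrib_right)
      qed
      also have "\<dots> = E s"
        using s sum.delta[of "{..m}" s E] by (simp add: if_distrib[of "\<lambda>u. u * _"] cong: if_cong)
      finally show ?thesis by simp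
    qed
    then show ?thesis by (intro exI[of _ b]) simp
  qed
  then have "\<forall>s. \<exists>b :: nat \<Rightarrow> real. s \<le> m \<longrightarrow> (\<forall>E. E s = (\<Sum>r\<le>m. b r * (\<Sum>s'\<le>m. real ((m - s') choose r) * E s')))"
    by (rule allI)
  from choice[OF this] show ?thesis .
qed

lemma binomial_absorb_diff:
  "real p * (real (p choose r) - real ((p - 1) choose r)) = real r * real (p choose r)"
proof (cases p)
  case (Suc p')
  show ?thesis
  proof (cases r)
    case (Suc r')
    have "real (Suc r') * real (Suc p' choose Suc r') = real (Suc p') * real (p' choose r')"
      using Suc_times_binomial[of r' p'] by (simp only: of_nat_mult[symmetric])
    then show ?thesis by (simp add: Suc \<open>p = Suc p'\<close>)
  qed simp
qed (cases r, auto)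

text \<open>The binomial coefficients diagonalize the pure death chain in which each of \<open>p = m - s\<close> insertion
  positions is removed at rate 1: a set of \<open>r\<close> positions at one vertex is destroyed at rate \<open>r\<close>.\<close>

lemma factorial_moment_shift:
  fixes E :: "nat \<Rightarrow> real"
  shows "(\<Sum>s\<le>m. real ((m - s) choose r) *
            ((if 0 < s then real (m - (s - 1)) * E (s - 1) else 0) - real (m - s) * E s))
       = - real r * (\<Sum>s\<le>m. real ((m - s) choose r) * E s)"
proof -
  have "(\<Sum>s\<le>m. real ((m - s) choose r) * (if 0 < s then real (m - (s - 1)) * E (s - 1) else 0)) =
        (\<Sum>s<m. real ((m - s - 1) choose r) * (real (m - s) * E s))"
  proof -
    have "(\<Sum>s\<le>m. real ((m - s) choose r) * (if 0 < s then real (m - (s - 1)) * E (s - 1) else 0)) =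
        (\<Sum>s\<in>{..<Suc m}. real ((m - s) choose r) * (if 0 < s then real (m - (s - 1)) * E (s - 1) else 0))"
      by (simp add: lessThan_Suc_atMost)
    also have "\<dots> = (\<Sum>s<m. real ((m - s - 1) choose r) * (real (m - s) * E s))"
      by (subst sum.lessThan_Suc_shift) simp
    finally show ?thesis .
  qed
  also have "\<dots> = (\<Sum>s\<le>m. real ((m - s - 1) choose r) * (real (m - s) * E s))"
    by (simp add: lessThan_Suc_atMost[symmetric])
  finally have shifted: "(\<Sum>s\<le>m. real ((m - s) choose r) * (if 0 < s then real (m - (s - 1)) * E (s - 1) else 0)) =
      (\<Sum>s\<le>m. real ((m - s - 1) choose r) * (real (m - s) * E s))" .
  have "(\<Sum>s\<le>m. real ((m - s) choose r) *
            ((if 0 < s then real (m - (s - 1)) * E (s - 1) else 0) - real (m - s) * E s)) =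
     (\<Sum>s\<le>m. real ((m - s - 1) choose r) * (real (m - s) * E s) - real ((m - s) choose r) * (real (m - s) * E s))"
    by (simp only: right_diff_distrib sum_subtractf shifted)
  also have "\<dots> = (\<Sum>s\<le>m. - real r * (real ((m - s) choose r) * E s))"
  proof (intro sum.cong refl)
    fix s
    have "real ((m - s - 1) choose r) * (real (m - s) * E s) - real ((m - s) choose r) * (real (m - s) * E s)
        = - (real (m - s) * (real ((m - s) choose r) - real ((m - s - 1) choose r))) * E s"
      by (simp only: left_diff_distrib right_diff_distrib mult_minus_left minus_diff_eq mult.assoc mult.left_commute)
    then show "real ((m - s - 1) choose r) * (real (m - s) * E s) - real ((m - s) choose r) * (real (m - s) * E s)
        = - real r * (real ((m - s) choose r) * E s)"
      unfolding binomial_absorb_diff by simp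
  qed
  finally show ?thesis
    by (simp only: sum_distrib_left)
qed

lemma falling_fact_Suc: "falling_fact x (Suc r) = falling_fact x r * (x - real r)"
  by (simp add: falling_fact_def)

context hooking
begin

abbreviation "Dst j s \<equiv> D_star m \<tau> N i j s"

lemma falling_fact_denominator_pos:
  assumes "s \<le> m - 1"
  shows "0 < falling_fact (real m * real \<tau> - 2) s"
  unfolding falling_fact_def
proof (rule prod_pos)
  fix t assume "t \<in> {..<s}"
  then have "real t + 2 \<le> real m" using assms by auto
  then show "0 < real m * real \<tau> - 2 - real t"
    using \<alpha>_nonneg(1) unfolding \<alpha>_def by linarith
qed

lemma Dst_0: "(\<alpha> + real m) * Dst j 0 = \<alpha> * gain j"
proof -
  have "0 < \<alpha> + real m" using \<alpha>_nonneg m by linarith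
  moreover have "real m * real \<tau> - 1 = \<alpha> + real m" by (simp add: \<alpha>_def)
  ultimately show ?thesis
    using m by (simp add: D_star_def falling_fact_def y1_vec_def gain_def \<alpha>_def[symmetric])
qed

lemma Dst_Suc:
  assumes "s < m"
  shows "(\<alpha> + real (m - Suc s)) * Dst j (Suc s) = real (m - s) * Dst j s"
proof -
  define R where "R = falling_fact (real m - 1) s / falling_fact (real m * real \<tau> - 2) s"
  have pos: "0 < falling_fact (real m * real \<tau> - 2) s"
    using assms by (intro falling_fact_denominator_pos) simp
  have s: "Dst j s = \<alpha> * R * y1_vec m \<tau> N i j / real (m - s)"
    using assms by (simp add: D_star_def R_def \<alpha>_def)
  show ?thesis
  proof (cases "Suc s < m")
    case True
    have "real m * real \<tau> - 2 - real s = \<alpha> + real (m - Suc s)"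
      using True by (simp add: \<alpha>_def of_nat_diff)
    moreover have "real m - 1 - real s = real (m - Suc s)"
      using True by (simp add: of_nat_diff)
    ultimately have "Dst j (Suc s) = \<alpha> * (R * (real (m - Suc s) / (\<alpha> + real (m - Suc s)))) * y1_vec m \<tau> N i j / real (m - Suc s)"
      unfolding D_star_def R_def falling_fact_Suc \<alpha>_def[symmetric] if_P[OF True] by simp
    then show ?thesis
      unfolding s using True \<alpha>_nonneg(1) by simp
  next
    case False
    then have "Suc s = m" using assms by simp
    then have "Dst j (Suc s) = R * y1_vec m \<tau> N i j" "m - s = 1" "m - Suc s = 0"
      by (auto simp: D_star_def R_def)
    then show ?thesis unfolding s by simp
  qed
qed

lemma gain_nonneg: "j \<in> {1..k} \<Longrightarrow> 0 \<le> gain j"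
  by (metis card_new_degree of_nat_0_le_iff)

lemma Dst_nonneg:
  assumes "0 < \<alpha>" "j \<in> {1..k}" "s \<le> m"
  shows "0 \<le> Dst j s"
  using assms(3)
proof (induction s)
  case 0
  have "0 < \<alpha> + real m" using assms(1) by simp
  moreover have "0 \<le> (\<alpha> + real m) * Dst j 0"
    unfolding Dst_0 using assms gain_nonneg by simp
  ultimately show ?case by (simp add: zero_le_mult_iff)
next
  case (Suc s)
  have "0 < \<alpha> + real (m - Suc s)" using assms(1) by simp
  moreover have "0 \<le> (\<alpha> + real (m - Suc s)) * Dst j (Suc s)"
    using Suc by (subst Dst_Suc) auto
  ultimately show ?case by (simp add: zero_le_mult_iff)
qed

text \<open>The stationarity equation of the limit: inflow to class \<open>s\<close> minus outflow is what the linear growth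
  of the class requires.\<close>

lemma Dst_balance:
  assumes "s \<le> m"
  shows "(if 0 < s then real (m - (s - 1)) * Dst j (s - 1) else 0) - real (m - s) * Dst j s
       = \<alpha> * (Dst j s - (if s = 0 then gain j else 0))"
proof (cases s)
  case 0
  then show ?thesis using Dst_0[of j] by (simp add: algebra_simps)
next
  case (Suc t)
  then show ?thesis using Dst_Suc[of t j] assms by (simp add: algebra_simps)
qed

text \<open>The centring \<open>T n / \<alpha>\<close> is \<open>n\<close> plus the constant \<open>m * \<tau> / \<alpha>\<close>. With this choice the drift of the
  moments below is exactly diagonal, without a remainder of order \<open>1 / n\<close>.\<close>

definition excess :: "nat \<Rightarrow> (nat \<times> 'v) network \<Rightarrow> nat \<Rightarrow> nat \<Rightarrow> real" where
  "excess n G j s = real (degree_count G (d j) s) - T n / \<alpha> * Dst j s"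

text \<open>The moment with index \<open>(j, r)\<close> counts, after centring, the \<open>r\<close>-element sets of insertion positions
  that belong to one vertex of initial degree \<open>d j\<close>.\<close>

definition moment :: "nat \<Rightarrow> (nat \<times> 'v) network \<Rightarrow> nat \<times> nat \<Rightarrow> real" where
  "moment n G = (\<lambda>(j, r). \<Sum>s\<le>m. real ((m - s) choose r) * excess n G j s)"

definition moment_jump :: "nat \<times> nat \<Rightarrow> nat \<times> nat \<Rightarrow> real" where
  "moment_jump \<kappa> = (\<lambda>(j, r). \<Sum>s\<le>m. real ((m - s) choose r) *
     ((if \<kappa> = (j, s - 1) \<and> 0 < s then 1 else 0) - (if \<kappa> = (j, s) then 1 else 0)
       + (if s = 0 then gain j else 0) - Dst j s))"

definition limit_prob :: "nat \<times> nat \<Rightarrow> real" where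
  "limit_prob = (\<lambda>(j, s). real (m - s) * Dst j s / \<alpha>)"

definition inv_coeff :: "nat \<Rightarrow> nat \<Rightarrow> real" where
  "inv_coeff = (SOME \<beta>. \<forall>s\<le>m. \<forall>E. E s = (\<Sum>r\<le>m. \<beta> s r * (\<Sum>s'\<le>m. real ((m - s') choose r) * E s')))"

lemma excess_eq_moments:
  assumes "s \<le> m"
  shows "excess n G j s = (\<Sum>r\<le>m. inv_coeff s r * moment n G (j, r))"
  using someI_ex[OF factorial_moment_inversion[of m]] assms
  unfolding inv_coeff_def[symmetric] moment_def by simp

definition near_const :: real where
  "near_const = real m * (\<Sum>s\<le>m. \<Sum>r\<le>m. \<bar>inv_coeff s r\<bar>)"

text \<open>The form needed for the colour law to be close to its limit. The factor \<open>m\<close> bounds the number of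
  insertion positions of a vertex.\<close>

lemma abs_excess_le:
  assumes "s \<le> m" "j \<in> {1..k}"
  shows "real m * \<bar>excess n G j s\<bar> \<le> near_const * (\<Sum>x\<in>{1..k} \<times> {..m}. \<bar>moment n G x\<bar>)"
proof -
  have "\<bar>excess n G j s\<bar> \<le> (\<Sum>r\<le>m. \<bar>inv_coeff s r\<bar> * \<bar>moment n G (j, r)\<bar>)"
    unfolding excess_eq_moments[OF assms(1)] by (rule order_trans[OF sum_abs]) (simp add: abs_mult)
  also have "\<dots> \<le> (\<Sum>r\<le>m. \<bar>inv_coeff s r\<bar> * (\<Sum>x\<in>{1..k} \<times> {..m}. \<bar>moment n G x\<bar>))"
    using assms(2) by (intro sum_mono mult_left_mono member_le_sum) auto
  also have "\<dots> \<le> (\<Sum>s\<le>m. \<Sum>r\<le>m. \<bar>inv_coeff s r\<bar>) * (\<Sum>x\<in>{1..k} \<times> {..m}. \<bar>moment n G x\<bar>)"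
    unfolding sum_distrib_right[symmetric]
    by (intro mult_right_mono member_le_sum[of s "{..m}" "\<lambda>s. \<Sum>r\<le>m. \<bar>inv_coeff s r\<bar>"])
       (use assms(1) in \<open>auto intro: sum_nonneg\<close>)
  finally show ?thesis
    unfolding near_const_def mult.assoc by (rule mult_left_mono) simp
qed

lemma moment_attach:
  assumes "0 < \<alpha>" and wf: "wf_network n G" and e: "e \<in> insertion_positions m G" and j: "j \<in> {1..k}"
  shows "moment (Suc n) (attach S (Suc n) G (fst e)) (j, r) = moment n G (j, r) + moment_jump (colour G e) (j, r)"
proof -
  have "T (Suc n) / \<alpha> = T n / \<alpha> + 1"
    using assms(1) by (simp add: T_def field_simps)
  then show ?thesis
    unfolding moment_def moment_jump_def excess_def case_prod_conv sum.distrib[symmetric]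
    by (intro sum.cong refl, subst degree_count_attach[OF wf e j]) (simp add: algebra_simps)
qed

lemma sum_colour_indicator:
  fixes f :: "nat \<times> nat \<Rightarrow> real"
  assumes "j \<in> {1..k}"
  shows "(\<Sum>\<kappa>\<in>{1..k} \<times> {..<m}. f \<kappa> * (if \<kappa> = (j, s) then 1 else 0)) = (if s < m then f (j, s) else 0)"
  using assms by (simp add: if_distrib[of "\<lambda>u. _ * u"] sum.delta cong: if_cong)

text \<open>By the shift identity the counts contribute \<open>- r / T n\<close> times their own moment. By the stationarity
  equation the shift identity also turns the constant part of the jump into \<open>r / \<alpha>\<close> times the
  moment of the limit vector, which is exactly the centring.\<close>

lemma moment_drift:
  assumes \<alpha>: "0 < \<alpha>" and wf: "wf_network n G" and j: "j \<in> {1..k}"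
  defines "q \<equiv> pmf (map_pmf (colour G) (pmf_of_set (insertion_positions m G)))"
  shows "(\<Sum>\<kappa>\<in>{1..k} \<times> {..<m}. q \<kappa> * moment_jump \<kappa> (j, r)) = - (real r / T n) * moment n G (j, r)"
proof -
  let ?K = "{1..k} \<times> {..<m}"
  let ?c = "\<lambda>s. real ((m - s) choose r)"
  let ?D = "\<lambda>s. real (degree_count G (d j) s)"
  have one: "(\<Sum>\<kappa>\<in>?K. q \<kappa>) = 1"
    unfolding q_def
  proof (rule sum_pmf_eq_1)
    show "set_pmf (map_pmf (colour G) (pmf_of_set (insertion_positions m G))) \<subseteq> ?K"
      unfolding set_map_pmf set_pmf_of_set[OF insertion_positions_facts(3,1)[OF wf]]
      by (rule image_subsetI) (rule colour_position(1)[OF wf])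
  qed simp
  have q: "(if s < m then q (j, s) else 0) = real (m - s) * ?D s / T n" for s
    using pmf_colour[OF wf j] by (simp add: q_def)
  have "(\<Sum>\<kappa>\<in>?K. q \<kappa> * moment_jump \<kappa> (j, r)) =
     (\<Sum>s\<le>m. ?c s * (\<Sum>\<kappa>\<in>?K. q \<kappa> * ((if \<kappa> = (j, s - 1) \<and> 0 < s then 1 else 0) - (if \<kappa> = (j, s) then 1 else 0)
       + (if s = 0 then gain j else 0) - Dst j s)))"
    unfolding moment_jump_def case_prod_conv sum_distrib_left by (subst sum.swap) (simp add: mult.left_commute)
  also have "\<dots> = (\<Sum>s\<le>m. ?c s * ((if 0 < s then real (m - (s - 1)) * ?D (s - 1) / T n else 0)
        - real (m - s) * ?D s / T n + (if s = 0 then gain j else 0) - Dst j s))"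
  proof (intro sum.cong refl arg_cong2[of _ _ _ _ "(*)"])
    fix s
    have "(\<Sum>\<kappa>\<in>?K. q \<kappa> * ((if \<kappa> = (j, s - 1) \<and> 0 < s then 1 else 0) - (if \<kappa> = (j, s) then 1 else 0)
       + (if s = 0 then gain j else 0) - Dst j s)) =
       (\<Sum>\<kappa>\<in>?K. q \<kappa> * (if \<kappa> = (j, s - 1) \<and> 0 < s then 1 else 0)) - (\<Sum>\<kappa>\<in>?K. q \<kappa> * (if \<kappa> = (j, s) then 1 else 0))
        + ((if s = 0 then gain j else 0) - Dst j s) * (\<Sum>\<kappa>\<in>?K. q \<kappa>)"
      unfolding sum_distrib_left sum_subtractf[symmetric] sum.distrib[symmetric]
      by (intro sum.cong refl) (simp only: right_diff_distrib distrib_left left_diff_distrib mult.commute)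
    also have "(\<Sum>\<kappa>\<in>?K. q \<kappa> * (if \<kappa> = (j, s - 1) \<and> 0 < s then 1 else 0)) =
        (if 0 < s then real (m - (s - 1)) * ?D (s - 1) / T n else 0)"
      using sum_colour_indicator[OF j, of q "s - 1"] q[of "s - 1"] by (cases "0 < s") auto
    also have "(\<Sum>\<kappa>\<in>?K. q \<kappa> * (if \<kappa> = (j, s) then 1 else 0)) = real (m - s) * ?D s / T n"
      unfolding sum_colour_indicator[OF j] by (rule q)
    finally show "(\<Sum>\<kappa>\<in>?K. q \<kappa> * ((if \<kappa> = (j, s - 1) \<and> 0 < s then 1 else 0) - (if \<kappa> = (j, s) then 1 else 0)
       + (if s = 0 then gain j else 0) - Dst j s)) = (if 0 < s then real (m - (s - 1)) * ?D (s - 1) / T n else 0)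
        - real (m - s) * ?D s / T n + (if s = 0 then gain j else 0) - Dst j s"
      unfolding one by simp
  qed
  also have "\<dots> = (\<Sum>s\<le>m. ?c s * ((if 0 < s then real (m - (s - 1)) * ?D (s - 1) else 0) - real (m - s) * ?D s)) / T n
      - (\<Sum>s\<le>m. ?c s * ((if 0 < s then real (m - (s - 1)) * Dst j (s - 1) else 0) - real (m - s) * Dst j s)) / \<alpha>"
    unfolding sum_divide_distrib sum_subtractf[symmetric]
  proof (intro sum.cong refl)
    fix s assume "s \<in> {..m}"
    then have *: "((if 0 < s then real (m - (s - 1)) * Dst j (s - 1) else 0) - real (m - s) * Dst j s) / \<alpha>
        = Dst j s - (if s = 0 then gain j else 0)"
      using \<alpha> by (subst Dst_balance) auto
    have "?c s * ((if 0 < s then real (m - (s - 1)) * ?D (s - 1) else 0) - real (m - s) * ?D s) / T n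
        - ?c s * ((if 0 < s then real (m - (s - 1)) * Dst j (s - 1) else 0) - real (m - s) * Dst j s) / \<alpha>
       = ?c s * (((if 0 < s then real (m - (s - 1)) * ?D (s - 1) else 0) - real (m - s) * ?D s) / T n
        - ((if 0 < s then real (m - (s - 1)) * Dst j (s - 1) else 0) - real (m - s) * Dst j s) / \<alpha>)"
      by (simp add: right_diff_distrib)
    then show "?c s * ((if 0 < s then real (m - (s - 1)) * ?D (s - 1) / T n else 0)
        - real (m - s) * ?D s / T n + (if s = 0 then gain j else 0) - Dst j s) =
        ?c s * ((if 0 < s then real (m - (s - 1)) * ?D (s - 1) else 0) - real (m - s) * ?D s) / T n
        - ?c s * ((if 0 < s then real (m - (s - 1)) * Dst j (s - 1) else 0) - real (m - s) * Dst j s) / \<alpha>"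
      unfolding * by (simp add: diff_divide_distrib)
  qed
  also have "\<dots> = (- real r * (\<Sum>s\<le>m. ?c s * ?D s)) / T n - (- real r * (\<Sum>s\<le>m. ?c s * Dst j s)) / \<alpha>"
    unfolding factorial_moment_shift[where E="?D"] factorial_moment_shift[where E="Dst j"] ..
  also have "\<dots> = - (real r / T n) * ((\<Sum>s\<le>m. ?c s * ?D s) - T n / \<alpha> * (\<Sum>s\<le>m. ?c s * Dst j s))"
  proof -
    have "(- real r * A) / T n - (- real r * B) / \<alpha> = - (real r / T n) * (A - T n / \<alpha> * B)" for A B
      using T_ge(2)[of n] by (simp add: right_diff_distrib)
    then show ?thesis .
  qed
  also have "(\<Sum>s\<le>m. ?c s * ?D s) - T n / \<alpha> * (\<Sum>s\<le>m. ?c s * Dst j s) = moment n G (j, r)"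
  proof -
    have "?c s * excess n G j s = ?c s * ?D s - T n / \<alpha> * (?c s * Dst j s)" for s
      unfolding excess_def right_diff_distrib by (simp only: mult.left_commute)
    then show ?thesis
      by (simp only: moment_def case_prod_conv sum_subtractf sum_distrib_left)
  qed
  finally show ?thesis .
qed

lemma linear_urn_moments:
  assumes \<alpha>: "0 < \<alpha>"
  shows "linear_urn (hooking_network m S) (\<lambda>n G. pmf_of_set (insertion_positions m G))
     (\<lambda>n G e. attach S (Suc n) G (fst e)) colour ({1..k} \<times> {..<m}) ({1..k} \<times> {..m})
     moment moment_jump (\<lambda>x. real (snd x)) limit_prob \<alpha> (real m * real \<tau>) near_const T"
proof
  fix n G assume G: "G \<in> set_pmf (hooking_network m S n)"
  note wf = wf_hooking_network[OF G]
  show "finite (set_pmf (pmf_of_set (insertion_positions m G)))"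
    using set_pmf_positions[OF G] insertion_positions_facts[OF wf] by simp
  { fix e assume e: "e \<in> set_pmf (pmf_of_set (insertion_positions m G))"
    then have e': "e \<in> insertion_positions m G" using set_pmf_positions[OF G] by simp
    show "colour G e \<in> {1..k} \<times> {..<m}"
      by (rule colour_position[OF wf e'])
    fix x assume "x \<in> {1..k} \<times> {..m}"
    then show "moment (Suc n) (attach S (Suc n) G (fst e)) x = moment n G x + moment_jump (colour G e) x"
      using moment_attach[OF \<alpha> wf e', of "fst x" "snd x"] by auto }
  show "(\<Sum>\<kappa>\<in>{1..k} \<times> {..<m}. pmf (map_pmf (colour G) (pmf_of_set (insertion_positions m G))) \<kappa> * moment_jump \<kappa> x)
      = - (real (snd x) / T n) * moment n G x" if "x \<in> {1..k} \<times> {..m}" for x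
    using that moment_drift[OF \<alpha> wf, of "fst x" "snd x"] by auto
  show "\<bar>pmf (map_pmf (colour G) (pmf_of_set (insertion_positions m G))) \<kappa> - limit_prob \<kappa>\<bar>
      \<le> near_const / T n * (\<Sum>x\<in>{1..k} \<times> {..m}. \<bar>moment n G x\<bar>)" if \<kappa>: "\<kappa> \<in> {1..k} \<times> {..<m}" for \<kappa>
  proof -
    obtain j s where \<kappa>_eq: "\<kappa> = (j, s)" and j: "j \<in> {1..k}" and s: "s < m" using \<kappa> by auto
    have "pmf (map_pmf (colour G) (pmf_of_set (insertion_positions m G))) \<kappa> - limit_prob \<kappa>
        = real (m - s) * excess n G j s / T n"
      unfolding \<kappa>_eq pmf_colour[OF wf j s] limit_prob_def excess_def
      using T_ge(2)[of n] \<alpha> by (simp add: field_simps)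
    also have "\<bar>\<dots>\<bar> \<le> real m * \<bar>excess n G j s\<bar> / T n"
      using T_ge(2)[of n] by (simp add: abs_mult divide_right_mono mult_right_mono)
    also have "\<dots> \<le> near_const * (\<Sum>x\<in>{1..k} \<times> {..m}. \<bar>moment n G x\<bar>) / T n"
      using abs_excess_le[of s j n G] s j T_ge(2)[of n] by (intro divide_right_mono) auto
    finally show ?thesis by simp
  qed
next
  fix n
  show "hooking_network m S (Suc n) = hooking_network m S n \<bind>
     (\<lambda>G. map_pmf (\<lambda>e. attach S (Suc n) G (fst e)) (pmf_of_set (insertion_positions m G)))"
    by (simp add: case_prod_beta')
next
  fix \<kappa> assume "\<kappa> \<in> {1..k} \<times> {..<m}"
  then show "0 \<le> limit_prob \<kappa>"
    using Dst_nonneg[OF \<alpha>] \<alpha> by (auto simp: limit_prob_def)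
next
  fix n and x :: "nat \<times> nat" assume "x \<in> {1..k} \<times> {..m}"
  then show "real (snd x) \<le> T n" using T_ge(1)[of n] by auto
next
  show "0 < real m * real \<tau>" using m order by simp
  show "0 \<le> near_const" by (simp add: near_const_def sum_nonneg)
qed (auto simp: finite_hooking_network T_def \<alpha>)

section \<open>The limit law of the degrees\<close>

text \<open>If \<open>\<alpha> = 0\<close> then \<open>m = 1\<close> and \<open>\<tau> = 2\<close>: the network has two insertion positions at any age. At most
  two vertices are active, and all the others have recruited exactly once.\<close>

lemma abs_degree_count_critical:
  assumes \<alpha>0: "\<alpha> = 0" and wf: "wf_network n G" and j: "j \<in> {1..k}" and s: "s \<le> m"
    and total: "(\<Sum>v\<in>verts G. if orig_degree G v = d j then 1 else 0) = real (N j) + real n * gain j"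
  shows "\<bar>real (degree_count G (d j) s) - real n * Dst j s\<bar> \<le> real (N j) + 2"
proof -
  have fin: "finite (verts G)" using wf by (simp add: wf_network_def)
  have m1: "m = 1" using \<alpha>_nonneg(2) \<alpha>0 m by simp
  then have \<tau>2: "real \<tau> = 2" 
  proof -
    have "real m * real \<tau> - real m - 1 = 0" using \<alpha>0 by (simp only: \<alpha>_def)
    then show ?thesis unfolding m1 by simp
  qed
  have active: "real (degree_count G (d j) 0) \<le> 2"
  proof -
    have "real (degree_count G (d j) 0) \<le> (\<Sum>v\<in>verts G. real (m - recruits G v))"
      unfolding degree_count_def real_card_filter[OF fin] by (intro sum_mono) (simp add: m1)
    also have "\<dots> = T n" using wf unfolding wf_network_def by blast
    also have "\<dots> = real m * 2 + 0 * real n" unfolding T_def \<alpha>0 \<tau>2 ..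
    also have "\<dots> = 2" using m1 by simp
    finally show ?thesis .
  qed
  have split: "real (degree_count G (d j) 0) + real (degree_count G (d j) 1) = real (N j) + real n * gain j"
  proof -
    have rec: "recruits G v = 0 \<or> recruits G v = 1" if "v \<in> verts G" for v
    proof -
      have "recruits G v \<le> m" using wf that unfolding wf_network_def by blast
      then show ?thesis using m1 by auto
    qed
    show ?thesis
      unfolding degree_count_def real_card_filter[OF fin] sum.distrib[symmetric] total[symmetric]
    proof (intro sum.cong refl)
      fix v assume "v \<in> verts G"
      from rec[OF this] show "(if orig_degree G v = d j \<and> recruits G v = 0 then 1 else 0) +
          (if orig_degree G v = d j \<and> recruits G v = 1 then 1 else 0) =
          (if orig_degree G v = d j then 1 else (0 :: real))"
        by auto
    qed
  qed
  have "s = 0 \<or> s = 1" using s m1 by auto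
  then show ?thesis
  proof
    assume "s = 0"
    moreover have "Dst j 0 = 0"
      using Dst_0[of j] m unfolding \<alpha>0 by simp
    ultimately show ?thesis
      using active by simp
  next
    assume "s = 1"
    moreover have "Dst j 1 = gain j"
      by (simp add: D_star_def m1 falling_fact_def y1_vec_def \<tau>2 gain_def)
    ultimately show ?thesis
      using split active by simp
  qed
qed

lemma total_degree_count:
  assumes "G \<in> set_pmf (hooking_network m S n)" and j: "j \<in> {1..k}"
  shows "(\<Sum>v\<in>verts G. if orig_degree G v = d j then 1 else 0) = real (N j) + real n * gain j"
  using assms(1)
proof (induction n arbitrary: G)
  case 0
  have "orig_degree (initial_network S) (0, v) = vertex_degree S v" for v
    unfolding initial_network_def Let_def vertex_degree_def
    by (simp, rule vertex_degree_map) auto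
  then have "(\<Sum>v\<in>verts (initial_network S). if orig_degree (initial_network S) v = d j then 1 else 0) =
      (\<Sum>v\<in>verts S. if vertex_degree S v = d j then 1 else 0 :: real)"
    by (simp add: initial_network_def Let_def sum.reindex inj_on_def)
  also have "\<dots> = real (N j)"
    unfolding multiplicities[OF j] by (rule real_card_filter[symmetric]) (rule seed_facts)
  finally show ?case using 0 by simp
next
  case (Suc n)
  then obtain H e where H: "H \<in> set_pmf (hooking_network m S n)"
    and e: "e \<in> set_pmf (pmf_of_set (insertion_positions m H))"
    and G: "G = attach S (Suc n) H (fst e)"
    by (auto simp: split_beta)
  note wf = wf_hooking_network[OF H]
  have "fst e \<in> verts H"
    using e unfolding set_pmf_positions[OF H] by (rule colour_position(2)[OF wf])
  moreover have "(\<Sum>v\<in>verts S - {hook S}. if vertex_degree S v = d j then 1 else 0) = gain j"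
    using card_new_degree[OF j] unfolding real_card_filter[OF finite_Diff[OF seed_facts(1)]] .
  ultimately show ?case
    using sum_attach[OF wf, of "fst e" "\<lambda>a _. if a = d j then 1 else 0"] Suc.IH[OF H]
    unfolding G by (simp add: algebra_simps del: verts_attach)
qed

definition fluctuation :: "('c::finite \<Rightarrow> nat \<times> nat) \<Rightarrow> nat \<Rightarrow> (nat \<times> 'v) network \<Rightarrow> real^'c" where
  "fluctuation lab n G = (1 / sqrt (real n)) *\<^sub>R (degree_vec lab d G - real n *\<^sub>R D_star_vec lab m \<tau> N i)"

lemma inner_fluctuation:
  "inner a (fluctuation lab n G) =
     (\<Sum>c\<in>UNIV. vec_nth a c * (real (degree_count G (d (fst (lab c))) (snd (lab c)))
        - real n * Dst (fst (lab c)) (snd (lab c)))) / sqrt (real n)"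
  by (simp add: fluctuation_def inner_vec_def degree_vec_def D_star_vec_def sum_divide_distrib)

text \<open>The fluctuations before scaling are bounded, so the limit law is the point mass at the origin.\<close>

lemma normal_limit_critical:
  fixes lab :: "'c::finite \<Rightarrow> nat \<times> nat"
  assumes \<alpha>0: "\<alpha> = 0" and lab: "bij_betw lab UNIV ({1..k} \<times> {0..m})"
  shows "\<exists>(\<Sigma> :: real^'c^'c) L. multivariate_normal 0 \<Sigma> L \<and>
     converges_in_law (\<lambda>n. distr (measure_pmf (hooking_network m S n)) borel (fluctuation lab n)) L"
proof (rule normal_limit_of_chars)
  show "covariance_matrix (0 :: real^'c^'c)"
    by (simp add: covariance_matrix_def Finite_Cartesian_Product.transpose_def Finite_Cartesian_Product.vec_eq_iff)
  fix a :: "real^'c"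
  define B where "B = (\<Sum>c\<in>UNIV. \<bar>vec_nth a c\<bar> * (real (N (fst (lab c))) + 2))"
  have bound: "cmod (iexp (inner a (fluctuation lab n G)) - 1) \<le> B / sqrt (real n)"
    if G: "G \<in> set_pmf (hooking_network m S n)" for n G
  proof -
    have "cmod (iexp (inner a (fluctuation lab n G)) - 1) \<le> \<bar>inner a (fluctuation lab n G)\<bar>"
      using iexp_approx1[of "inner a (fluctuation lab n G)" 0] by simp
    also have "\<dots> = \<bar>\<Sum>c\<in>UNIV. vec_nth a c * (real (degree_count G (d (fst (lab c))) (snd (lab c)))
        - real n * Dst (fst (lab c)) (snd (lab c)))\<bar> / sqrt (real n)"
      by (simp add: inner_fluctuation)
    also have "\<dots> \<le> B / sqrt (real n)"
    proof (intro divide_right_mono)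
      show "\<bar>\<Sum>c\<in>UNIV. vec_nth a c * (real (degree_count G (d (fst (lab c))) (snd (lab c)))
        - real n * Dst (fst (lab c)) (snd (lab c)))\<bar> \<le> B"
        unfolding B_def
      proof (intro order_trans[OF sum_abs] sum_mono)
        fix c
        have c: "fst (lab c) \<in> {1..k}" "snd (lab c) \<le> m"
          using bij_betw_apply[OF lab, of c] by auto
        show "\<bar>vec_nth a c * (real (degree_count G (d (fst (lab c))) (snd (lab c)))
            - real n * Dst (fst (lab c)) (snd (lab c)))\<bar> \<le> \<bar>vec_nth a c\<bar> * (real (N (fst (lab c))) + 2)"
          unfolding abs_mult[of "vec_nth a c"]
          by (intro mult_left_mono abs_degree_count_critical[OF \<alpha>0 wf_hooking_network[OF G] c total_degree_count[OF G c(1)]]) simp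
      qed
    qed simp
    finally show ?thesis .
  qed
  have le: "cmod (measure_pmf.expectation (hooking_network m S n) (\<lambda>G. iexp (inner a (fluctuation lab n G))) - 1)
      \<le> B * (1 / sqrt (real n))" for n
  proof -
    have int: "integrable (measure_pmf (hooking_network m S n)) f" for f :: "(nat \<times> 'v) network \<Rightarrow> complex"
      by (rule integrable_measure_pmf_finite[OF finite_hooking_network])
    have eq: "measure_pmf.expectation (hooking_network m S n) (\<lambda>G. iexp (inner a (fluctuation lab n G))) - 1
        = measure_pmf.expectation (hooking_network m S n) (\<lambda>G. iexp (inner a (fluctuation lab n G)) - 1)"
      by (subst Bochner_Integration.integral_diff[OF int int]) simp
    have "cmod (measure_pmf.expectation (hooking_network m S n) (\<lambda>G. iexp (inner a (fluctuation lab n G))) - 1)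
        \<le> measure_pmf.expectation (hooking_network m S n) (\<lambda>G. cmod (iexp (inner a (fluctuation lab n G)) - 1))"
      unfolding eq by (rule integral_norm_bound)
    also have "\<dots> \<le> measure_pmf.expectation (hooking_network m S n) (\<lambda>G. B / sqrt (real n))"
      by (intro integral_mono_AE integrable_measure_pmf_finite[OF finite_hooking_network])
         (simp add: AE_measure_pmf_iff bound)
    finally show ?thesis by simp
  qed
  have lim: "(\<lambda>n. B * (1 / sqrt (real n))) \<longlonglongrightarrow> 0"
    by (rule tendsto_mult_right_zero) real_asymp
  have "(\<lambda>n. measure_pmf.expectation (hooking_network m S n) (\<lambda>G. iexp (inner a (fluctuation lab n G))) - 1) \<longlonglongrightarrow> 0"
    by (rule Lim_null_comparison[OF always_eventually[OF allI[OF le]] lim])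
  then have "(\<lambda>n. measure_pmf.expectation (hooking_network m S n) (\<lambda>G. iexp (inner a (fluctuation lab n G)))) \<longlonglongrightarrow> 1"
    by (rule LIM_zero_cancel)
  moreover have "of_real (exp (- inner a (0 *v a) / 2)) = (1 :: complex)"
    by simp
  ultimately show "(\<lambda>n. measure_pmf.expectation (hooking_network m S n) (\<lambda>G. iexp (inner a (fluctuation lab n G))))
      \<longlonglongrightarrow> of_real (exp (- inner a (0 *v a) / 2))"
    by (simp only:)
qed

text \<open>The scaled degree vector is a fixed linear image of the moments divided by \<open>sqrt n\<close>, up to the
  constant of the centring divided by \<open>sqrt n\<close>. The covariance matrix is the corresponding image of
  the limit covariance of the moments.\<close>

lemma normal_limit_supercritical:
  fixes lab :: "'c::finite \<Rightarrow> nat \<times> nat"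
  assumes \<alpha>: "0 < \<alpha>" and lab: "bij_betw lab UNIV ({1..k} \<times> {0..m})"
  shows "\<exists>(\<Sigma> :: real^'c^'c) L. multivariate_normal 0 \<Sigma> L \<and>
     converges_in_law (\<lambda>n. distr (measure_pmf (hooking_network m S n)) borel (fluctuation lab n)) L"
proof -
  interpret urn: linear_urn "hooking_network m S" "\<lambda>n G. pmf_of_set (insertion_positions m G)"
     "\<lambda>n G e. attach S (Suc n) G (fst e)" colour "{1..k} \<times> {..<m}" "{1..k} \<times> {..m}"
     moment moment_jump "\<lambda>x. real (snd x)" limit_prob \<alpha> "real m * real \<tau>" near_const T
    by (rule linear_urn_moments[OF \<alpha>])
  define I where "I = {1..k} \<times> {..m}"
  \<comment> \<open>the coefficients that express the coordinate \<open>c\<close> by the moments\<close>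
  define B where "B c x = (if fst x = fst (lab c) then inv_coeff (snd (lab c)) (snd x) else 0)" for c x
  define W where "W a x = (\<Sum>c\<in>UNIV. vec_nth a c * B c x)" for a x
  define \<Theta> where "\<Theta> = urn.limit_cov"
  define \<Sigma> :: "real^'c^'c" where "\<Sigma> = (\<chi> c c'. \<Sum>x\<in>I. \<Sum>y\<in>I. B c x * B c' y * \<Theta> x y)"
  have form: "inner a (\<Sigma> *v a) = (\<Sum>x\<in>I. \<Sum>y\<in>I. W a x * W a y * \<Theta> x y)" for a
  proof -
    have "inner a (\<Sigma> *v a) = (\<Sum>c\<in>UNIV. \<Sum>c'\<in>UNIV. \<Sum>x\<in>I. \<Sum>y\<in>I.
        vec_nth a c * B c x * (vec_nth a c' * B c' y) * \<Theta> x y)"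
      by (simp add: inner_vec_def matrix_vector_mult_def \<Sigma>_def sum_distrib_left sum_distrib_right mult_ac)
    also have "\<dots> = (\<Sum>c\<in>UNIV. \<Sum>x\<in>I. \<Sum>c'\<in>UNIV. \<Sum>y\<in>I.
        vec_nth a c * B c x * (vec_nth a c' * B c' y) * \<Theta> x y)"
      by (intro sum.cong refl sum.swap)
    also have "\<dots> = (\<Sum>x\<in>I. \<Sum>c\<in>UNIV. \<Sum>c'\<in>UNIV. \<Sum>y\<in>I.
        vec_nth a c * B c x * (vec_nth a c' * B c' y) * \<Theta> x y)"
      by (rule sum.swap)
    also have "\<dots> = (\<Sum>x\<in>I. \<Sum>c\<in>UNIV. \<Sum>y\<in>I. \<Sum>c'\<in>UNIV.
        vec_nth a c * B c x * (vec_nth a c' * B c' y) * \<Theta> x y)"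
      by (intro sum.cong refl sum.swap)
    also have "\<dots> = (\<Sum>x\<in>I. \<Sum>y\<in>I. \<Sum>c\<in>UNIV. \<Sum>c'\<in>UNIV.
        vec_nth a c * B c x * (vec_nth a c' * B c' y) * \<Theta> x y)"
      by (intro sum.cong refl sum.swap)
    finally show ?thesis
      unfolding W_def sum_product by (simp only: sum_distrib_right)
  qed
  have "covariance_matrix \<Sigma>"
  proof -
    have "vec_nth (vec_nth \<Sigma> c) c' = vec_nth (vec_nth \<Sigma> c') c" for c c'
    proof -
      have "vec_nth (vec_nth \<Sigma> c) c' = (\<Sum>x\<in>I. \<Sum>y\<in>I. B c x * B c' y * \<Theta> x y)"
        by (simp add: \<Sigma>_def)
      also have "\<dots> = (\<Sum>y\<in>I. \<Sum>x\<in>I. B c x * B c' y * \<Theta> x y)" by (rule sum.swap)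
      also have "\<dots> = (\<Sum>y\<in>I. \<Sum>x\<in>I. B c' y * B c x * \<Theta> y x)"
      proof (intro sum.cong refl)
        fix x y
        show "B c x * B c' y * \<Theta> x y = B c' y * B c x * \<Theta> y x"
          unfolding \<Theta>_def urn.limit_cov_commute[of x y] by simp
      qed
      also have "\<dots> = vec_nth (vec_nth \<Sigma> c') c" by (simp add: \<Sigma>_def)
      finally show ?thesis .
    qed
    moreover have "0 \<le> inner a (\<Sigma> *v a)" for a
      unfolding form \<Theta>_def I_def by (rule urn.limit_cov_nonneg)
    ultimately show ?thesis
      by (simp add: covariance_matrix_def Finite_Cartesian_Product.transpose_def Finite_Cartesian_Product.vec_eq_iff)
  qed
  then show ?thesis
  proof (rule normal_limit_of_chars)
    fix a :: "real^'c"
    define b where "b = real m * real \<tau> / \<alpha> * (\<Sum>c\<in>UNIV. vec_nth a c * Dst (fst (lab c)) (snd (lab c)))"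
    have coord: "real (degree_count G (d (fst (lab c))) (snd (lab c))) - real n * Dst (fst (lab c)) (snd (lab c))
        = (\<Sum>x\<in>I. B c x * moment n G x) + real m * real \<tau> / \<alpha> * Dst (fst (lab c)) (snd (lab c))" for c n G
    proof -
      have c: "fst (lab c) \<in> {1..k}" "snd (lab c) \<le> m"
        using bij_betw_apply[OF lab, of c] by auto
      have "(\<Sum>x\<in>I. B c x * moment n G x) =
          (\<Sum>j\<in>{1..k}. \<Sum>r\<le>m. B c (j, r) * moment n G (j, r))"
        unfolding I_def by (simp add: sum.cartesian_product)
      also have "\<dots> = (\<Sum>j\<in>{1..k}. if j = fst (lab c) then \<Sum>r\<le>m. inv_coeff (snd (lab c)) r * moment n G (j, r) else 0)"
        by (intro sum.cong refl) (simp add: B_def)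
      also have "\<dots> = excess n G (fst (lab c)) (snd (lab c))"
        using c by (simp add: excess_eq_moments)
      finally have "(\<Sum>x\<in>I. B c x * moment n G x) = excess n G (fst (lab c)) (snd (lab c))" .
      then show ?thesis
        using \<alpha> by (simp add: excess_def T_def field_simps)
    qed
    have lin: "inner a (fluctuation lab n G) = urn.lin (\<lambda>x. W a x / sqrt (real n)) (moment n G) + b / sqrt (real n)" for n G
    proof -
      have "(\<Sum>c\<in>UNIV. vec_nth a c * (\<Sum>x\<in>I. B c x * moment n G x)) = (\<Sum>x\<in>I. W a x * moment n G x)"
      proof -
        have "(\<Sum>c\<in>UNIV. vec_nth a c * (\<Sum>x\<in>I. B c x * moment n G x)) =
            (\<Sum>c\<in>UNIV. \<Sum>x\<in>I. vec_nth a c * B c x * moment n G x)"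
          by (simp only: sum_distrib_left mult.assoc)
        also have "\<dots> = (\<Sum>x\<in>I. \<Sum>c\<in>UNIV. vec_nth a c * B c x * moment n G x)" by (rule sum.swap)
        finally show ?thesis by (simp only: W_def sum_distrib_right)
      qed
      moreover have "(\<Sum>c\<in>UNIV. vec_nth a c * (real m * real \<tau> / \<alpha> * Dst (fst (lab c)) (snd (lab c)))) = b"
        by (simp add: b_def sum_distrib_left mult.left_commute)
      ultimately have "inner a (fluctuation lab n G) = ((\<Sum>x\<in>I. W a x * moment n G x) + b) / sqrt (real n)"
        unfolding inner_fluctuation coord by (simp add: distrib_left sum.distrib)
      then show ?thesis
        unfolding urn.lin_def unfolding I_def[symmetric] by (simp add: add_divide_distrib sum_divide_distrib)
    qed
    have "measure_pmf.expectation (hooking_network m S n) (\<lambda>G. iexp (inner a (fluctuation lab n G)))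
        = urn.charf n (\<lambda>x. W a x / sqrt (real n)) * iexp (b / sqrt (real n))" for n
    proof -
      have "iexp (inner a (fluctuation lab n G)) =
          iexp (urn.lin (\<lambda>x. W a x / sqrt (real n)) (moment n G)) * iexp (b / sqrt (real n))" for G
        unfolding lin by (simp add: exp_add[symmetric] distrib_left)
      then show ?thesis unfolding urn.charf_def by simp
    qed
    moreover have "(\<lambda>n. iexp (b / sqrt (real n))) \<longlonglongrightarrow> iexp 0"
    proof (intro tendsto_exp tendsto_mult tendsto_const tendsto_of_real)
      have "(\<lambda>n. b * (1 / sqrt (real n))) \<longlonglongrightarrow> 0"
        by (rule tendsto_mult_right_zero) real_asymp
      then show "(\<lambda>n. b / sqrt (real n)) \<longlonglongrightarrow> 0" by simp
    qed
    ultimately show "(\<lambda>n. measure_pmf.expectation (hooking_network m S n) (\<lambda>G. iexp (inner a (fluctuation lab n G))))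
        \<longlonglongrightarrow> of_real (exp (- inner a (\<Sigma> *v a) / 2))"
      using tendsto_mult[OF urn.charf_tendsto[of "W a"]] unfolding form \<Theta>_def I_def by fastforce
  qed
qed

end

theorem theorem4p2:
  fixes S :: "'v seed"
    and m k i \<tau> :: nat
    and d N :: "nat \<Rightarrow> nat"
    and v1 :: "complex Matrix.vec"
    and lab :: "'c::finite \<Rightarrow> nat \<times> nat"
  assumes m: "m \<ge> 1"
    and seed: "is_seed S"
    and order: "\<tau> = card (verts S)" "\<tau> \<ge> 2"
    and degrees: "strict_mono_on {1..k} d" "d ` {1..k} = vertex_degree S ` verts S"
    and multiplicities: "\<And>l. l \<in> {1..k} \<Longrightarrow> N l = card {v \<in> verts S. vertex_degree S v = d l}"
    and hook_degree: "i \<in> {1..k}" "vertex_degree S (hook S) = d i"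
    and principal: "principal_eigenvector (replacement_matrix m k N i) v1"
    and nondegenerate: "\<And>c. c < m * k \<Longrightarrow> vec_index v1 c \<noteq> 0"
    and labelling: "bij_betw lab UNIV ({1..k} \<times> {0..m})"
  shows "\<exists>(\<Sigma> :: real^'c^'c) L.
           multivariate_normal 0 \<Sigma> L \<and>
           converges_in_law
             (\<lambda>n. distr (measure_pmf (hooking_network m S n)) borel
                    (\<lambda>G. (1 / sqrt (real n)) *\<^sub>R
                          (degree_vec lab d G - real n *\<^sub>R D_star_vec lab m \<tau> N i)))
             L"
proof -
  interpret hooking S m k i \<tau> d N
    using m seed order degrees multiplicities hook_degree by unfold_locales
  show ?thesis
  proof (cases "\<alpha> = 0")
    case True
    then show ?thesis
      using normal_limit_critical[OF _ labelling] unfolding fluctuation_def by blast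
  next
    case False
    then have "0 < \<alpha>" using \<alpha>_nonneg(1) by simp
    then show ?thesis
      using normal_limit_supercritical[OF _ labelling] unfolding fluctuation_def by blast
  qed
qed

end
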